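(* Let $\mathcal{G}\rightrightarrows M$ be a Lie groupoid with Lie algebroid $A$. There is a $2$-vector space $$T^{p,q}_{\mathrm{aff}}(\mathcal{G})\rightrightarrows T^{p,q}_{\mathrm{mult}}(\mathcal{G}),$$ whose arrows are the affine $(p,q)$-tensors and whose objects are the multiplicative $(p,q)$-tensors on $\mathcal{G}$, with source and target maps $$s(F)=F_r:=F-\overrightarrow{f},\qquad t(F)=F_l:=F-\overleftarrow{f},\qquad f=\mathrm{pr}_{\wedge^pA\otimes\wedge^qT^*M}F|_M,$$ and, for $F_1,F_2\in T^{p,q}_{\mathrm{aff}}(\mathcal{G})$ with $(F_1)_r=(F_2)_l$, multiplication $$F_1*F_2=F_1+\overleftarrow{f_2},\qquad f_2=\mathrm{pr}_{\wedge^pA\otimes\wedge^qT^*M}F_2|_M.$$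
   Context: A $2$-vector space is a category internal to vector spaces: a category $V_1\rightrightarrows V_0$ whose sets of objects and arrows are vector spaces and whose source, target, identity-assigning and composition maps are all linear (it is then automatically a groupoid). Here the identity-assigning map is the inclusion of multiplicative into affine $(p,q)$-tensors. Conventions: $\mathcal{G}\rightrightarrows M$ has source $s$ and target $t$; $gh$ is defined iff $s(g)=t(h)$; $M\subset\mathcal{G}$ via units. $A=\ker(ds)|_M$, $T\mathcal{G}|_M=TM\oplus A$, $T^*\mathcal{G}|_M=T^*M\oplus A^*$; $\mathrm{pr}_{\wedge^pA\otimes\wedge^qT^*M}F|_M$ is the corresponding component of $F|_M$. For $u\in\Gamma(A)$, $\overrightarrow{u}(g)=dR_g(u_{t(g)})$, $\overleftarrow{u}(g)=-dL_g(d\,\mathrm{inv}(u_{s(g)}))$. The tangent groupoid $T\mathcal{G}\rightrightarrows TM$ has as structure maps the differentials of those of $\mathcal{G}$. The cotangent groupoid $T^*\mathcal{G}\rightrightarrows A^*$ has source and target of $\xi\in T_g^*\mathcal{G}$ given by $\langle s(\xi),u\rangle=\langle\xi,\overleftarrow{u}\rangle$ for $u\in A_{s(g)}$ and $\langle t(\xi),v\rangle=\langle\xi,\overrightarrow{v}\rangle$ for $v\in A_{t(g)}$, and product $(\xi\cdot\eta)(X\cdot Y)=\xi(X)+\eta(Y)$ for composable $X,Y$ in $T\mathcal{G}$. A $(p,q)$-tensor $F\in\Gamma(\wedge^pT\mathcal{G}\otimes\wedge^qT^*\mathcal{G})$ is viewed as a function on the Lie groupoid $\Gamma:\ \oplus^qT\mathcal{G}\oplus^pT^*\mathcal{G}\rightrightarrows\oplus^qTM\oplus^pA^*$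 (componentwise structure), with source and target $s_\Gamma,t_\Gamma$. A function $F$ on a Lie groupoid is affine if $F(gh)=F(g)+F(h)-F(s(g))$ for all composable $g,h$, and multiplicative if $F(gh)=F(g)+F(h)$. A $(p,q)$-tensor on $\mathcal{G}$ is affine (multiplicative) if it is an affine (multiplicative) function on $\Gamma$. For $f\in\Gamma(\wedge^pA\otimes\wedge^qT^*M)$, viewed as a function on $\oplus^qTM\oplus^pA^*$, $\overleftarrow{f}:=s_\Gamma^*f$ and $\overrightarrow{f}:=t_\Gamma^*f$, which are $(p,q)$-tensors on $\mathcal{G}$. *)

theory Defs
  imports "HOL-Analysis.Analysis" "HOL-Library.Function_Algebras"
begin

section \<open>Vector spaces of functions, 2-vector spaces\<close>

text \<open>Tangent vectors, covectors and tensors are all functions, and the vector space structures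
  are the pointwise ones.\<close>

instantiation "fun" :: (type, real_vector) real_vector
begin

definition scaleR_fun :: "real \<Rightarrow> ('a \<Rightarrow> 'b) \<Rightarrow> 'a \<Rightarrow> 'b"
  where "scaleR_fun c f = (\<lambda>x. c *\<^sub>R f x)"

instance
  by standard (simp_all add: scaleR_fun_def fun_eq_iff scaleR_add_right scaleR_add_left)

end

definition linear_on :: "'v::real_vector set \<Rightarrow> ('v \<Rightarrow> 'w::real_vector) \<Rightarrow> bool"
  where "linear_on V f \<longleftrightarrow>
    (\<forall>x\<in>V. \<forall>y\<in>V. f (x + y) = f x + f y) \<and> (\<forall>c. \<forall>x\<in>V. f (c *\<^sub>R x) = c *\<^sub>R f x)"

text \<open>A category with arrows \<open>V1\<close>, objects \<open>V0\<close>, source \<open>s\<close>, target \<open>t\<close>, identities \<open>e\<close> and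
  composition \<open>m a b\<close> (defined iff \<open>s a = t b\<close>), internal to real vector spaces. The last two
  assumptions say that \<open>m\<close> is linear on the fibre product of \<open>s\<close> and \<open>t\<close>.\<close>

locale two_vector_space =
  fixes V1 :: "'v::real_vector set" and V0 :: "'w::real_vector set"
    and s t :: "'v \<Rightarrow> 'w" and e :: "'w \<Rightarrow> 'v" and m :: "'v \<Rightarrow> 'v \<Rightarrow> 'v"
  assumes subspace_arrows: "subspace V1"
    and subspace_objects: "subspace V0"
    and src_closed: "a \<in> V1 \<Longrightarrow> s a \<in> V0"
    and tgt_closed: "a \<in> V1 \<Longrightarrow> t a \<in> V0"
    and ident_closed: "x \<in> V0 \<Longrightarrow> e x \<in> V1"
    and comp_closed: "\<lbrakk>a \<in> V1; b \<in> V1; s a = t b\<rbrakk> \<Longrightarrow> m a b \<in> V1"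
    and src_ident: "x \<in> V0 \<Longrightarrow> s (e x) = x"
    and tgt_ident: "x \<in> V0 \<Longrightarrow> t (e x) = x"
    and src_comp: "\<lbrakk>a \<in> V1; b \<in> V1; s a = t b\<rbrakk> \<Longrightarrow> s (m a b) = s b"
    and tgt_comp: "\<lbrakk>a \<in> V1; b \<in> V1; s a = t b\<rbrakk> \<Longrightarrow> t (m a b) = t a"
    and comp_ident_right: "a \<in> V1 \<Longrightarrow> m a (e (s a)) = a"
    and comp_ident_left: "a \<in> V1 \<Longrightarrow> m (e (t a)) a = a"
    and comp_assoc: "\<lbrakk>a \<in> V1; b \<in> V1; c \<in> V1; s a = t b; s b = t c\<rbrakk>
      \<Longrightarrow> m (m a b) c = m a (m b c)"
    and src_linear: "linear_on V1 s"
    and tgt_linear: "linear_on V1 t"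
    and ident_linear: "linear_on V0 e"
    and comp_add: "\<lbrakk>a \<in> V1; b \<in> V1; s a = t b; a' \<in> V1; b' \<in> V1; s a' = t b'\<rbrakk>
      \<Longrightarrow> m (a + a') (b + b') = m a b + m a' b'"
    and comp_scaleR: "\<lbrakk>a \<in> V1; b \<in> V1; s a = t b\<rbrakk> \<Longrightarrow> m (r *\<^sub>R a) (r *\<^sub>R b) = r *\<^sub>R m a b"

section \<open>Smooth maps and manifolds\<close>

text \<open>To be used for open sets in finite-dimensional spaces, where continuity of all directional
  derivatives amounts to continuity of the derivative.\<close>

primrec Ck_on :: "nat \<Rightarrow> 'e::real_normed_vector set \<Rightarrow> ('e \<Rightarrow> 'f::real_normed_vector) \<Rightarrow> bool" where
  "Ck_on 0 S f \<longleftrightarrow> continuous_on S f"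
| "Ck_on (Suc k) S f \<longleftrightarrow>
    (\<exists>f'. (\<forall>x\<in>S. (f has_derivative f' x) (at x)) \<and> (\<forall>v. Ck_on k S (\<lambda>x. f' x v)))"

definition smooth_on :: "'e::real_normed_vector set \<Rightarrow> ('e \<Rightarrow> 'f::real_normed_vector) \<Rightarrow> bool"
  where "smooth_on S f \<longleftrightarrow> (\<forall>k. Ck_on k S f)"

text \<open>A chart is a pair of a domain and a map which is only relevant on that domain. Charts take
  values in a finite-dimensional Banach space, and not in a type of class
  \<open>euclidean_space\<close>, because the latter excludes dimension zero, and hence Lie groups
  (Lie groupoids over a point). The instance for type \<open>unit\<close> below provides the model space, and
  the manifold, of dimension zero.\<close>

type_synonym ('a, 'e) atlas = "('a set \<times> ('a \<Rightarrow> 'e)) set"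

instantiation unit :: real_normed_vector
begin

definition zero_unit :: unit where "zero_unit = ()"
definition plus_unit :: "unit \<Rightarrow> unit \<Rightarrow> unit" where "plus_unit x y = ()"
definition minus_unit :: "unit \<Rightarrow> unit \<Rightarrow> unit" where "minus_unit x y = ()"
definition uminus_unit :: "unit \<Rightarrow> unit" where "uminus_unit x = ()"
definition scaleR_unit :: "real \<Rightarrow> unit \<Rightarrow> unit" where "scaleR_unit c x = ()"
definition norm_unit :: "unit \<Rightarrow> real" where "norm_unit x = 0"
definition dist_unit :: "unit \<Rightarrow> unit \<Rightarrow> real" where "dist_unit x y = 0"
definition sgn_unit :: "unit \<Rightarrow> unit" where "sgn_unit x = ()"
definition uniformity_unit :: "(unit \<times> unit) filter"
  where "uniformity_unit = (INF e\<in>{0<..}. principal {(x, y). dist x y < e})"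
definition open_unit :: "unit set \<Rightarrow> bool"
  where "open_unit U \<longleftrightarrow> (\<forall>x\<in>U. \<forall>\<^sub>F (x', y) in uniformity. x' = x \<longrightarrow> y \<in> U)"

instance
  by standard
    (auto simp: uniformity_unit_def open_unit_def norm_unit_def dist_unit_def)

end

instance unit :: banach
proof
  fix X :: "nat \<Rightarrow> unit"
  have "X = (\<lambda>_. ())" by auto
  then show "convergent X" by (simp add: convergent_const)
qed

instance unit :: second_countable_topology
proof
  show "\<exists>B::unit set set. countable B \<and> open = generate_topology B"
  proof (intro exI conjI)
    show "countable (UNIV :: unit set set)"
      by (rule countable_finite) simp
    have "open S" for S :: "unit set"
    proof (cases "S = {}")
      case False
      then have "S = UNIV" by auto
      then show ?thesis by simp
    qed simp
    then show "open = generate_topology (UNIV :: unit set set)"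
      by (auto simp: fun_eq_iff intro: generate_topology.Basis)
  qed
qed

definition smooth_manifold ::
  "('a::{t2_space,second_countable_topology}, 'e::banach) atlas \<Rightarrow> bool"
  where "smooth_manifold A \<longleftrightarrow>
    (\<exists>B::'e set. finite B \<and> span B = UNIV) \<and>
    (\<Union>(U, \<phi>)\<in>A. U) = UNIV \<and>
    (\<forall>(U, \<phi>)\<in>A. open U \<and> open (\<phi> ` U) \<and> homeomorphism U (\<phi> ` U) \<phi> (inv_into U \<phi>)) \<and>
    (\<forall>(U, \<phi>)\<in>A. \<forall>(V, \<psi>)\<in>A. smooth_on (\<phi> ` (U \<inter> V)) (\<psi> \<circ> inv_into U \<phi>))"

definition prod_atlas :: "('a, 'e) atlas \<Rightarrow> ('b, 'f) atlas \<Rightarrow> ('a \<times> 'b, 'e \<times> 'f) atlas"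
  where "prod_atlas A B = {(U \<times> V, map_prod \<phi> \<psi>) | U \<phi> V \<psi>. (U, \<phi>) \<in> A \<and> (V, \<psi>) \<in> B}"

text \<open>Smoothness at \<open>p\<close> means smoothness in a neighbourhood of \<open>p\<close>.\<close>

definition smooth_at ::
  "('a::topological_space, 'e::real_normed_vector) atlas \<Rightarrow>
   ('b::topological_space, 'f::real_normed_vector) atlas \<Rightarrow> ('a \<Rightarrow> 'b) \<Rightarrow> 'a \<Rightarrow> bool"
  where "smooth_at A B f p \<longleftrightarrow>
    (\<exists>(U, \<phi>)\<in>A. \<exists>(V, \<psi>)\<in>B. \<exists>W. open W \<and> p \<in> W \<and> W \<subseteq> U \<and> f ` W \<subseteq> V \<and>
      smooth_on (\<phi> ` W) (\<psi> \<circ> f \<circ> inv_into U \<phi>))"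

definition smooth_map ::
  "('a::topological_space, 'e::real_normed_vector) atlas \<Rightarrow>
   ('b::topological_space, 'f::real_normed_vector) atlas \<Rightarrow> ('a \<Rightarrow> 'b) \<Rightarrow> bool"
  where "smooth_map A B f \<longleftrightarrow> (\<forall>p. smooth_at A B f p)"

text \<open>Smoothness of a map which is only relevant on a subset \<open>S\<close> (here always an embedded
  submanifold): locally it extends to a smooth map.\<close>

definition smooth_map_on ::
  "('a::topological_space, 'e::real_normed_vector) atlas \<Rightarrow>
   ('b::topological_space, 'f::real_normed_vector) atlas \<Rightarrow> 'a set \<Rightarrow> ('a \<Rightarrow> 'b) \<Rightarrow> bool"
  where "smooth_map_on A B S f \<longleftrightarrow>
    (\<forall>p\<in>S. \<exists>f'. smooth_at A B f' p \<and> (\<forall>\<^sub>F x in nhds p. x \<in> S \<longrightarrow> f' x = f x))"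

section \<open>Tangent and cotangent spaces\<close>

text \<open>Tangent vectors at \<open>p\<close> are the velocities of curves \<open>c\<close> through \<open>p\<close>, represented as the
  derivations \<open>h \<mapsto> (h \<circ> c)'(0)\<close> on germs of smooth functions at \<open>p\<close>. It suffices that curves be
  differentiable at parameter \<open>0\<close>; this gives the same vectors as smooth curves. The base point
  is not recorded in the vector.\<close>

type_synonym 'a tvec = "('a \<Rightarrow> real) \<Rightarrow> real"
type_synonym 'a covec = "'a tvec \<Rightarrow> real"

definition curve_at ::
  "('a::topological_space, 'e::real_normed_vector) atlas \<Rightarrow> (real \<Rightarrow> 'a) \<Rightarrow> 'a \<Rightarrow> bool"
  where "curve_at A c p \<longleftrightarrow> c 0 = p \<and> isCont c 0 \<and>
    (\<exists>(U, \<phi>)\<in>A. p \<in> U \<and> (\<phi> \<circ> c) differentiable (at 0))"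

definition velocity ::
  "('a::topological_space, 'e::real_normed_vector) atlas \<Rightarrow> (real \<Rightarrow> 'a) \<Rightarrow> 'a tvec"
  where "velocity A c = (\<lambda>h.
    if smooth_at A {(UNIV, \<lambda>r::real. r)} h (c 0) then deriv (h \<circ> c) 0 else 0)"

definition tangent_space ::
  "('a::topological_space, 'e::real_normed_vector) atlas \<Rightarrow> 'a \<Rightarrow> 'a tvec set"
  where "tangent_space A p = {velocity A c | c. curve_at A c p}"

text \<open>Linear functionals on a space \<open>V\<close> of tangent vectors, extended by zero.\<close>

definition dual_on :: "'a tvec set \<Rightarrow> 'a covec set"
  where "dual_on V = {\<xi>. linear_on V \<xi> \<and> (\<forall>X. X \<notin> V \<longrightarrow> \<xi> X = 0)}"

abbreviation cotangent_space ::
  "('a::topological_space, 'e::real_normed_vector) atlas \<Rightarrow> 'a \<Rightarrow> 'a covec set"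
  where "cotangent_space A p \<equiv> dual_on (tangent_space A p)"

text \<open>The differential at \<open>p\<close> of a map \<open>f\<close> on a submanifold \<open>S\<close>, applied to a vector \<open>v\<close> tangent
  to \<open>S\<close>.\<close>

definition diff_on ::
  "('a::topological_space, 'e::real_normed_vector) atlas \<Rightarrow>
   ('b::topological_space, 'f::real_normed_vector) atlas \<Rightarrow>
   'a set \<Rightarrow> ('a \<Rightarrow> 'b) \<Rightarrow> 'a \<Rightarrow> 'a tvec \<Rightarrow> 'b tvec"
  where "diff_on A B S f p v = (THE w. \<exists>c. curve_at A c p \<and> (\<forall>\<^sub>F \<tau> in nhds 0. c \<tau> \<in> S) \<and>
    velocity A c = v \<and> velocity B (f \<circ> c) = w)"

abbreviation diff ::
  "('a::topological_space, 'e::real_normed_vector) atlas \<Rightarrow>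
   ('b::topological_space, 'f::real_normed_vector) atlas \<Rightarrow>
   ('a \<Rightarrow> 'b) \<Rightarrow> 'a \<Rightarrow> 'a tvec \<Rightarrow> 'b tvec"
  where "diff A B f \<equiv> diff_on A B UNIV f"

text \<open>The coordinate vector field in direction \<open>v\<close>, and the differential of the coordinate
  function \<open>l \<circ> \<phi>\<close> for a linear functional \<open>l\<close>, of a chart \<open>(U, \<phi>)\<close>.\<close>

definition coord_vec ::
  "('a::topological_space, 'e::real_normed_vector) atlas \<Rightarrow> 'a set \<Rightarrow> ('a \<Rightarrow> 'e) \<Rightarrow> 'a \<Rightarrow> 'e \<Rightarrow> 'a tvec"
  where "coord_vec A U \<phi> x v = velocity A (\<lambda>\<tau>. inv_into U \<phi> (\<phi> x + \<tau> *\<^sub>R v))"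

definition coord_covec ::
  "('a::topological_space, 'e::real_normed_vector) atlas \<Rightarrow> ('a \<Rightarrow> 'e) \<Rightarrow> 'a \<Rightarrow> ('e \<Rightarrow> real) \<Rightarrow> 'a covec"
  where "coord_covec A \<phi> x l = (\<lambda>X. if X \<in> tangent_space A x then X (l \<circ> \<phi>) else 0)"

section \<open>Lie groupoids\<close>

text \<open>\<open>mult G g h\<close> is only relevant if \<open>src G g = tgt G h\<close>.\<close>

record ('g, 'm, 'e, 'b) groupoid_data =
  arr_atlas :: "('g, 'e) atlas"
  obj_atlas :: "('m, 'b) atlas"
  src :: "'g \<Rightarrow> 'm"
  tgt :: "'g \<Rightarrow> 'm"
  unt :: "'m \<Rightarrow> 'g"
  inverse_arr :: "'g \<Rightarrow> 'g"
  mult :: "'g \<Rightarrow> 'g \<Rightarrow> 'g"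

definition composable :: "('g, 'm, 'e, 'b) groupoid_data \<Rightarrow> ('g \<times> 'g) set"
  where "composable G = {(g, h). src G g = tgt G h}"

locale lie_groupoid =
  fixes G :: "('g::{t2_space,second_countable_topology}, 'm::{t2_space,second_countable_topology},
    'e::banach, 'b::banach) groupoid_data"
  assumes arr_manifold: "smooth_manifold (arr_atlas G)"
    and obj_manifold: "smooth_manifold (obj_atlas G)"
    and src_unt: "src G (unt G x) = x"
    and tgt_unt: "tgt G (unt G x) = x"
    and src_mult: "src G g = tgt G h \<Longrightarrow> src G (mult G g h) = src G h"
    and tgt_mult: "src G g = tgt G h \<Longrightarrow> tgt G (mult G g h) = tgt G g"
    and mult_assoc: "\<lbrakk>src G g = tgt G h; src G h = tgt G k\<rbrakk>
      \<Longrightarrow> mult G (mult G g h) k = mult G g (mult G h k)"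
    and mult_unt_right: "mult G g (unt G (src G g)) = g"
    and mult_unt_left: "mult G (unt G (tgt G g)) g = g"
    and src_inverse: "src G (inverse_arr G g) = tgt G g"
    and tgt_inverse: "tgt G (inverse_arr G g) = src G g"
    and mult_inverse_right: "mult G g (inverse_arr G g) = unt G (tgt G g)"
    and mult_inverse_left: "mult G (inverse_arr G g) g = unt G (src G g)"
    and src_smooth: "smooth_map (arr_atlas G) (obj_atlas G) (src G)"
    and tgt_smooth: "smooth_map (arr_atlas G) (obj_atlas G) (tgt G)"
    and unt_smooth: "smooth_map (obj_atlas G) (arr_atlas G) (unt G)"
    and inverse_smooth: "smooth_map (arr_atlas G) (arr_atlas G) (inverse_arr G)"
    and mult_smooth: "smooth_map_on (prod_atlas (arr_atlas G) (arr_atlas G)) (arr_atlas G)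
      (composable G) (\<lambda>(g, h). mult G g h)"
    and src_submersion: "diff (arr_atlas G) (obj_atlas G) (src G) g ` tangent_space (arr_atlas G) g
      = tangent_space (obj_atlas G) (src G g)"
    and tgt_submersion: "diff (arr_atlas G) (obj_atlas G) (tgt G) g ` tangent_space (arr_atlas G) g
      = tangent_space (obj_atlas G) (tgt G g)"

type_synonym ('g, 'm, 'e, 'b) lgd = "('g, 'm, 'e, 'b) groupoid_data"

abbreviation TG :: "('g::topological_space, 'm, 'e::real_normed_vector, 'b) lgd \<Rightarrow> 'g \<Rightarrow> 'g tvec set"
  where "TG G \<equiv> tangent_space (arr_atlas G)"

abbreviation TM :: "('g, 'm::topological_space, 'e, 'b::real_normed_vector) lgd \<Rightarrow> 'm \<Rightarrow> 'm tvec set"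
  where "TM G \<equiv> tangent_space (obj_atlas G)"

abbreviation cotG :: "('g::topological_space, 'm, 'e::real_normed_vector, 'b) lgd \<Rightarrow> 'g \<Rightarrow> 'g covec set"
  where "cotG G \<equiv> cotangent_space (arr_atlas G)"

subsection \<open>Lie algebroid, translations\<close>

text \<open>The fibre over \<open>x\<close> of the vector bundle \<open>A\<close>, and of its dual.\<close>

definition algd :: "('g::topological_space, 'm::topological_space, 'e::real_normed_vector,
    'b::real_normed_vector) lgd \<Rightarrow> 'm \<Rightarrow> 'g tvec set"
  where "algd G x =
    {u \<in> TG G (unt G x). diff (arr_atlas G) (obj_atlas G) (src G) (unt G x) u = 0}"

abbreviation dual_algd :: "('g::topological_space, 'm::topological_space, 'e::real_normed_vector,
    'b::real_normed_vector) lgd \<Rightarrow> 'm \<Rightarrow> 'g covec set"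
  where "dual_algd G x \<equiv> dual_on (algd G x)"

text \<open>The value at \<open>g\<close> of the right (left) invariant vector field of \<open>u \<in> A\<close>. Right translation by
  \<open>g\<close> is defined on the source fibre over \<open>tgt g\<close>, left translation on the target fibre over
  \<open>src g\<close>.\<close>

definition right_inv :: "('g::topological_space, 'm, 'e::real_normed_vector, 'b) lgd \<Rightarrow>
    'g \<Rightarrow> 'g tvec \<Rightarrow> 'g tvec"
  where "right_inv G g u = diff_on (arr_atlas G) (arr_atlas G) {k. src G k = tgt G g}
    (\<lambda>k. mult G k g) (unt G (tgt G g)) u"

definition left_inv :: "('g::topological_space, 'm, 'e::real_normed_vector, 'b) lgd \<Rightarrow>
    'g \<Rightarrow> 'g tvec \<Rightarrow> 'g tvec"
  where "left_inv G g u = - diff_on (arr_atlas G) (arr_atlas G) {k. tgt G k = src G g}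
    (\<lambda>k. mult G g k) (unt G (src G g))
    (diff (arr_atlas G) (arr_atlas G) (inverse_arr G) (unt G (src G g)) u)"

subsection \<open>Tangent and cotangent groupoids\<close>

text \<open>The graph of the multiplication of the tangent groupoid, that is, of the differential of the
  multiplication on the manifold of composable pairs: \<open>Z = X \<cdot> Y\<close> for \<open>X\<close> at \<open>g\<close> and \<open>Y\<close> at \<open>h\<close>.\<close>

definition tangent_mult :: "('g::topological_space, 'm, 'e::real_normed_vector, 'b) lgd \<Rightarrow>
    'g \<Rightarrow> 'g \<Rightarrow> 'g tvec \<Rightarrow> 'g tvec \<Rightarrow> 'g tvec \<Rightarrow> bool"
  where "tangent_mult G g h X Y Z \<longleftrightarrow>
    (\<exists>c d. curve_at (arr_atlas G) c g \<and> curve_at (arr_atlas G) d h \<and>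
      (\<forall>\<^sub>F \<tau> in nhds 0. (c \<tau>, d \<tau>) \<in> composable G) \<and>
      velocity (arr_atlas G) c = X \<and> velocity (arr_atlas G) d = Y \<and>
      velocity (arr_atlas G) (\<lambda>\<tau>. mult G (c \<tau>) (d \<tau>)) = Z)"

definition cot_src :: "('g::topological_space, 'm::topological_space, 'e::real_normed_vector,
    'b::real_normed_vector) lgd \<Rightarrow> 'g \<Rightarrow> 'g covec \<Rightarrow> 'g covec"
  where "cot_src G g \<xi> = (\<lambda>u. if u \<in> algd G (src G g) then \<xi> (left_inv G g u) else 0)"

definition cot_tgt :: "('g::topological_space, 'm::topological_space, 'e::real_normed_vector,
    'b::real_normed_vector) lgd \<Rightarrow> 'g \<Rightarrow> 'g covec \<Rightarrow> 'g covec"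
  where "cot_tgt G g \<xi> = (\<lambda>u. if u \<in> algd G (tgt G g) then \<xi> (right_inv G g u) else 0)"

text \<open>The units of the cotangent groupoid: \<open>\<alpha> \<in> A\<^sup>*\<close> at \<open>x\<close> is viewed as a covector of the
  groupoid at the unit of \<open>x\<close> by means of the splitting into \<open>TM\<close> and \<open>A\<close>, where \<open>X\<close> has the
  \<open>TM\<close>-component \<open>d unt (d src X)\<close>.\<close>

definition cot_unit :: "('g::topological_space, 'm::topological_space, 'e::real_normed_vector,
    'b::real_normed_vector) lgd \<Rightarrow> 'm \<Rightarrow> 'g covec \<Rightarrow> 'g covec"
  where "cot_unit G x \<alpha> = (\<lambda>X. if X \<in> TG G (unt G x)
    then \<alpha> (X - diff (obj_atlas G) (arr_atlas G) (unt G) x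
      (diff (arr_atlas G) (obj_atlas G) (src G) (unt G x) X)) else 0)"

text \<open>The graph of the multiplication of the cotangent groupoid: \<open>\<zeta> = \<xi> \<cdot> \<eta>\<close>.\<close>

definition cot_mult :: "('g::topological_space, 'm::topological_space, 'e::real_normed_vector,
    'b::real_normed_vector) lgd \<Rightarrow> 'g \<Rightarrow> 'g \<Rightarrow> 'g covec \<Rightarrow> 'g covec \<Rightarrow> 'g covec \<Rightarrow> bool"
  where "cot_mult G g h \<xi> \<eta> \<zeta> \<longleftrightarrow>
    \<xi> \<in> cotG G g \<and> \<eta> \<in> cotG G h \<and> cot_src G g \<xi> = cot_tgt G h \<eta> \<and>
    \<zeta> \<in> cotG G (mult G g h) \<and>
    (\<forall>X Y Z. tangent_mult G g h X Y Z \<longrightarrow> \<zeta> Z = \<xi> X + \<eta> Y)"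

subsection \<open>The groupoid \<open>\<Gamma>\<close> of \<open>q\<close> vectors and \<open>p\<close> covectors\<close>

type_synonym 'g gam_arr = "'g \<times> 'g tvec list \<times> 'g covec list"
type_synonym ('g, 'm) gam_obj = "'m \<times> 'm tvec list \<times> 'g covec list"

definition gam_arrows :: "('g::topological_space, 'm, 'e::real_normed_vector, 'b) lgd \<Rightarrow>
    nat \<Rightarrow> nat \<Rightarrow> 'g gam_arr set"
  where "gam_arrows G p q = {(g, Xs, \<xi>s). length Xs = q \<and> set Xs \<subseteq> TG G g \<and>
    length \<xi>s = p \<and> set \<xi>s \<subseteq> cotG G g}"

definition gam_objects :: "('g::topological_space, 'm::topological_space, 'e::real_normed_vector,
    'b::real_normed_vector) lgd \<Rightarrow> nat \<Rightarrow> nat \<Rightarrow> ('g, 'm) gam_obj set"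
  where "gam_objects G p q = {(x, vs, \<alpha>s). length vs = q \<and> set vs \<subseteq> TM G x \<and>
    length \<alpha>s = p \<and> set \<alpha>s \<subseteq> dual_algd G x}"

definition gam_src :: "('g::topological_space, 'm::topological_space, 'e::real_normed_vector,
    'b::real_normed_vector) lgd \<Rightarrow> 'g gam_arr \<Rightarrow> ('g, 'm) gam_obj"
  where "gam_src G = (\<lambda>(g, Xs, \<xi>s).
    (src G g, map (diff (arr_atlas G) (obj_atlas G) (src G) g) Xs, map (cot_src G g) \<xi>s))"

definition gam_tgt :: "('g::topological_space, 'm::topological_space, 'e::real_normed_vector,
    'b::real_normed_vector) lgd \<Rightarrow> 'g gam_arr \<Rightarrow> ('g, 'm) gam_obj"
  where "gam_tgt G = (\<lambda>(g, Xs, \<xi>s).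
    (tgt G g, map (diff (arr_atlas G) (obj_atlas G) (tgt G) g) Xs, map (cot_tgt G g) \<xi>s))"

definition gam_unit :: "('g::topological_space, 'm::topological_space, 'e::real_normed_vector,
    'b::real_normed_vector) lgd \<Rightarrow> ('g, 'm) gam_obj \<Rightarrow> 'g gam_arr"
  where "gam_unit G = (\<lambda>(x, vs, \<alpha>s).
    (unt G x, map (diff (obj_atlas G) (arr_atlas G) (unt G) x) vs, map (cot_unit G x) \<alpha>s))"

text \<open>\<open>gam_mult G p q a b c\<close>: the arrows \<open>a\<close> and \<open>b\<close> of \<open>\<Gamma>\<close> are composable and \<open>c = a \<cdot> b\<close>.\<close>

fun gam_mult :: "('g::topological_space, 'm::topological_space, 'e::real_normed_vector,
    'b::real_normed_vector) lgd \<Rightarrow> nat \<Rightarrow> nat \<Rightarrow> 'g gam_arr \<Rightarrow> 'g gam_arr \<Rightarrow> 'g gam_arr \<Rightarrow> bool"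
  where "gam_mult G p q (g, Xs, \<xi>s) (h, Ys, \<eta>s) (k, Zs, \<zeta>s) \<longleftrightarrow>
    (g, Xs, \<xi>s) \<in> gam_arrows G p q \<and> (h, Ys, \<eta>s) \<in> gam_arrows G p q \<and>
    gam_src G (g, Xs, \<xi>s) = gam_tgt G (h, Ys, \<eta>s) \<and>
    (k, Zs, \<zeta>s) \<in> gam_arrows G p q \<and> k = mult G g h \<and>
    (\<forall>i<q. tangent_mult G g h (Xs ! i) (Ys ! i) (Zs ! i)) \<and>
    (\<forall>j<p. cot_mult G g h (\<xi>s ! j) (\<eta>s ! j) (\<zeta>s ! j))"

definition affine_function :: "('g::topological_space, 'm::topological_space,
    'e::real_normed_vector, 'b::real_normed_vector) lgd \<Rightarrow> nat \<Rightarrow> nat \<Rightarrow> ('g gam_arr \<Rightarrow> real) \<Rightarrow> bool"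
  where "affine_function G p q F \<longleftrightarrow>
    (\<forall>a b c. gam_mult G p q a b c \<longrightarrow> F c = F a + F b - F (gam_unit G (gam_src G a)))"

definition multiplicative_function :: "('g::topological_space, 'm::topological_space,
    'e::real_normed_vector, 'b::real_normed_vector) lgd \<Rightarrow> nat \<Rightarrow> nat \<Rightarrow> ('g gam_arr \<Rightarrow> real) \<Rightarrow> bool"
  where "multiplicative_function G p q F \<longleftrightarrow>
    (\<forall>a b c. gam_mult G p q a b c \<longrightarrow> F c = F a + F b)"

section \<open>Tensors\<close>

definition alt_multilinear :: "'v::real_vector set \<Rightarrow> nat \<Rightarrow> ('v list \<Rightarrow> real) \<Rightarrow> bool"
  where "alt_multilinear V n \<Phi> \<longleftrightarrow>
    (\<forall>xs. length xs = n \<and> set xs \<subseteq> V \<longrightarrow>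
      (\<forall>i<n. linear_on V (\<lambda>x. \<Phi> (xs[i := x]))) \<and>
      (\<forall>i<n. \<forall>j<n. i \<noteq> j \<and> xs ! i = xs ! j \<longrightarrow> \<Phi> xs = 0))"

text \<open>Smooth sections of \<open>\<And>\<^sup>pTG \<otimes> \<And>\<^sup>qT\<^sup>*G\<close>, viewed as functions on the arrows of \<open>\<Gamma>\<close> and extended by
  zero: alternating and multilinear in the \<open>q\<close> vectors and in the \<open>p\<close> covectors, with smooth
  components in all charts.\<close>

definition tensors :: "('g::topological_space, 'm, 'e::real_normed_vector, 'b) lgd \<Rightarrow>
    nat \<Rightarrow> nat \<Rightarrow> ('g gam_arr \<Rightarrow> real) set"
  where "tensors G p q = {F.
    (\<forall>a. a \<notin> gam_arrows G p q \<longrightarrow> F a = 0) \<and>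
    (\<forall>g \<xi>s. length \<xi>s = p \<and> set \<xi>s \<subseteq> cotG G g \<longrightarrow>
      alt_multilinear (TG G g) q (\<lambda>Xs. F (g, Xs, \<xi>s))) \<and>
    (\<forall>g Xs. length Xs = q \<and> set Xs \<subseteq> TG G g \<longrightarrow>
      alt_multilinear (cotG G g) p (\<lambda>\<xi>s. F (g, Xs, \<xi>s))) \<and>
    (\<forall>(U, \<phi>)\<in>arr_atlas G. \<forall>vs ls. length vs = q \<and> length ls = p \<and> (\<forall>l\<in>set ls. linear l) \<longrightarrow>
      smooth_on (\<phi> ` U) (\<lambda>y. let x = inv_into U \<phi> y in
        F (x, map (coord_vec (arr_atlas G) U \<phi> x) vs, map (coord_covec (arr_atlas G) \<phi> x) ls)))}"

definition affine_tensors :: "('g::topological_space, 'm::topological_space,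
    'e::real_normed_vector, 'b::real_normed_vector) lgd \<Rightarrow> nat \<Rightarrow> nat \<Rightarrow> ('g gam_arr \<Rightarrow> real) set"
  where "affine_tensors G p q = {F \<in> tensors G p q. affine_function G p q F}"

definition multiplicative_tensors :: "('g::topological_space, 'm::topological_space,
    'e::real_normed_vector, 'b::real_normed_vector) lgd \<Rightarrow> nat \<Rightarrow> nat \<Rightarrow> ('g gam_arr \<Rightarrow> real) set"
  where "multiplicative_tensors G p q = {F \<in> tensors G p q. multiplicative_function G p q F}"

text \<open>The component in \<open>\<And>\<^sup>pA \<otimes> \<And>\<^sup>qT\<^sup>*M\<close> of the restriction of \<open>F\<close> to \<open>M\<close>, as a function on
  the objects of \<open>\<Gamma>\<close>. With respect to \<open>TG = TM \<oplus> A\<close> and \<open>T\<^sup>*G = T\<^sup>*M \<oplus> A\<^sup>*\<close> along \<open>M\<close>, taking this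
  component means evaluating \<open>F\<close> on vectors from \<open>TM\<close> and covectors from \<open>A\<^sup>*\<close>.\<close>

definition unit_component :: "('g::topological_space, 'm::topological_space,
    'e::real_normed_vector, 'b::real_normed_vector) lgd \<Rightarrow> nat \<Rightarrow> nat \<Rightarrow>
    ('g gam_arr \<Rightarrow> real) \<Rightarrow> ('g, 'm) gam_obj \<Rightarrow> real"
  where "unit_component G p q F =
    (\<lambda>b. if b \<in> gam_objects G p q then F (gam_unit G b) else 0)"

text \<open>The tensors written with a left (right) arrow over \<open>f\<close>.\<close>

definition left_tensor :: "('g::topological_space, 'm::topological_space,
    'e::real_normed_vector, 'b::real_normed_vector) lgd \<Rightarrow> nat \<Rightarrow> nat \<Rightarrow>
    (('g, 'm) gam_obj \<Rightarrow> real) \<Rightarrow> 'g gam_arr \<Rightarrow> real"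
  where "left_tensor G p q f = (\<lambda>a. if a \<in> gam_arrows G p q then f (gam_src G a) else 0)"

definition right_tensor :: "('g::topological_space, 'm::topological_space,
    'e::real_normed_vector, 'b::real_normed_vector) lgd \<Rightarrow> nat \<Rightarrow> nat \<Rightarrow>
    (('g, 'm) gam_obj \<Rightarrow> real) \<Rightarrow> 'g gam_arr \<Rightarrow> real"
  where "right_tensor G p q f = (\<lambda>a. if a \<in> gam_arrows G p q then f (gam_tgt G a) else 0)"

end

theory Submission
  imports Defs
begin

text \<open>Write \<open>R F\<close> and \<open>L F\<close> for the pullbacks of \<open>F\<close> along \<open>a \<mapsto> 1\<^bsub>t(a)\<^esub>\<close> and \<open>a \<mapsto> 1\<^bsub>s(a)\<^esub>\<close> on \<open>\<Gamma>\<close>; these are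
  the right and left invariant tensors of the unit component of \<open>F\<close>. If \<open>F\<close> is affine, then
  \<open>F - R F\<close> and \<open>F - L F\<close> are multiplicative, because \<open>s(a) = t(b)\<close>, \<open>t(ab) = t(a)\<close> and \<open>s(ab) = s(b)\<close>.
  As multiplicative functions vanish at units and units have themselves as source and target,
  \<open>R\<close> and \<open>L\<close> satisfy \<open>R L = R R = R\<close> and \<open>L R = L L = L\<close>, and vanish on multiplicative \<open>F\<close>; all axioms of
  a 2-vector space follow from these identities.

  What needs work is that \<open>R F\<close> and \<open>L F\<close> are smooth tensors and that \<open>\<Gamma>\<close> has these source, target and
  unit properties. Vectors of \<open>A\<close> have to be represented by curves in source fibres, which is a
  form of the implicit function theorem. In charts, the coefficients of the images under
  \<open>a \<mapsto> 1\<^bsub>t(a)\<^esub>\<close> of coordinate vectors and covectors are partial derivatives of smooth functions, and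
  \<open>R F\<close> is a polynomial in these coefficients and in the components of \<open>F\<close> along the units.\<close>

text \<open>The product is defined and smooth only on composable pairs, where smoothness means local
  extendability. The differential of a partially defined map is therefore computed from a smooth
  extension to an open set, applied to velocities of curves that stay in the domain. For vectors of
  A such curves exist because the units form a section of the source map: its derivative is the
  right inverse in the contraction argument. The extension makes the translations visibly linear
  and, being smooth jointly in both variables, controls how they depend on the base point.

  Vectors pass to a unit by the differential of \<open>unt o tgt\<close> or
  \<open>unt o src\<close>. Covectors pass by the transpose of a translation followed by the
  transpose of the projection onto A, so their coefficients are partial derivatives of the extended
  product.

  The algebra sees \<Gamma> through three groups of facts: source and target of a product, source
  and target of a unit, and the product of a unit with itself. As products of vectors and covectors
  are given by graphs, each of these is a statement about triples in the graph.\<close>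

section \<open>Calculus in finite-dimensional spaces\<close>

text \<open>Both claims go through one induction because adding a vector \<open>a\<close> outside
  the span is controlled by its distance to the span, which is positive once the span is
  closed.\<close>

lemma span_finite_closed_and_linear_bounded:
  fixes B :: "'e::real_normed_vector set"
  assumes "finite B"
  shows "closed (span B) \<and>
    (\<forall>f::'e \<Rightarrow> 'f::real_normed_vector. linear f \<longrightarrow> (\<exists>K. \<forall>v\<in>span B. norm (f v) \<le> K * norm v))"
  using assms
proof (induction B)
  case empty
  show ?case by (auto simp: linear_0)
next
  case (insert a B)
  show ?case
  proof (cases "a \<in> span B")
    case True
    then have "span (insert a B) = span B" by (rule span_redundant)
    then show ?thesis using insert.IH by simp
  next
    case False
    define d where "d = infdist a (span B)"
    have ne: "span B \<noteq> {}" using span_zero by blast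
    have cl: "closed (span B)" using insert.IH by simp
    have d: "d > 0"
      using False in_closed_iff_infdist_zero[OF cl ne] infdist_nonneg[of a "span B"]
      unfolding d_def by (metis less_eq_real_def)
    \<comment> \<open>Dividing by \<open>c\<close> exhibits a point of \<open>span B\<close> at
      distance \<open>norm v / |c|\<close> from \<open>a\<close>, so the coefficient of
      \<open>a\<close> is at most \<open>norm v / d\<close>. This yields both the convergence of
      coefficients and the bound for \<open>f\<close>.\<close>
    have coeff: "\<bar>c\<bar> * d \<le> norm v" if "v - c *\<^sub>R a \<in> span B" for v c
    proof (cases "c = 0")
      case False
      let ?y = "(-1/c) *\<^sub>R (v - c *\<^sub>R a)"
      have "?y \<in> span B" using that by (rule span_scale)
      then have "d \<le> dist a ?y" unfolding d_def by (rule infdist_le)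
      moreover have "a - ?y = (1/c) *\<^sub>R v" using False by (simp add: algebra_simps)
      ultimately have "d \<le> norm v / \<bar>c\<bar>" by (simp add: dist_norm)
      then show ?thesis using False by (simp add: field_simps)
    qed simp
    have "closed (span (insert a B))"
      unfolding closed_sequential_limits
    proof (intro allI impI, elim conjE)
      fix x l
      assume x: "\<forall>n. x n \<in> span (insert a B)" and lim: "x \<longlonglongrightarrow> l"
      then obtain c where c: "\<And>n. x n - c n *\<^sub>R a \<in> span B"
        unfolding span_breakdown_eq by metis
      have "Cauchy c"
        unfolding Cauchy_def
      proof (intro allI impI)
        fix e :: real assume e: "e > 0"
        then have "e * d > 0" using d by simp
        then obtain M where M: "\<And>m n. m \<ge> M \<Longrightarrow> n \<ge> M \<Longrightarrow> dist (x m) (x n) < e * d"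
          using LIMSEQ_imp_Cauchy[OF lim] unfolding Cauchy_def by metis
        have "dist (c m) (c n) < e" if "m \<ge> M" "n \<ge> M" for m n
        proof -
          have "(x m - x n) - (c m - c n) *\<^sub>R a = (x m - c m *\<^sub>R a) - (x n - c n *\<^sub>R a)"
            by (simp add: algebra_simps)
          also have "\<dots> \<in> span B" by (rule span_diff[OF c c])
          finally have "\<bar>c m - c n\<bar> * d \<le> norm (x m - x n)" by (rule coeff)
          also have "\<dots> < e * d" using M[OF that] by (simp add: dist_norm)
          finally show ?thesis using d by (simp add: dist_real_def)
        qed
        then show "\<exists>M. \<forall>m\<ge>M. \<forall>n\<ge>M. dist (c m) (c n) < e" by blast
      qed
      then obtain k where "c \<longlonglongrightarrow> k" using Cauchy_convergent convergent_def by blast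
      then have "(\<lambda>n. x n - c n *\<^sub>R a) \<longlonglongrightarrow> l - k *\<^sub>R a" using lim by (intro tendsto_intros)
      then have "l - k *\<^sub>R a \<in> span B" by (rule closed_sequentially[OF cl c])
      then show "l \<in> span (insert a B)" unfolding span_breakdown_eq by blast
    qed
    moreover have "\<exists>K. \<forall>v\<in>span (insert a B). norm (f v) \<le> K * norm v"
      if f: "linear f" for f :: "'e \<Rightarrow> 'f"
    proof -
      obtain K0 where K0: "\<And>v. v \<in> span B \<Longrightarrow> norm (f v) \<le> K0 * norm v"
        using insert.IH f by blast
      define K where "K = \<bar>K0\<bar>"
      have K: "norm (f v) \<le> K * norm v" if "v \<in> span B" for v
        using K0[OF that] mult_right_mono[OF abs_ge_self norm_ge_zero, of K0 v] unfolding K_def by (rule order_trans)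
      \<comment> \<open>Split \<open>v\<close> into \<open>v - c a\<close> and \<open>c a\<close>
        with \<open>|c| <= norm v / d\<close>; the quotient in the constant collects everything
        proportional to \<open>|c|\<close>.\<close>
      have "norm (f v) \<le> (K + (K * norm a + norm (f a)) / d) * norm v"
        if v: "v \<in> span (insert a B)" for v
      proof -
        obtain c where c: "v - c *\<^sub>R a \<in> span B" using v unfolding span_breakdown_eq by blast
        have "f v = f (v - c *\<^sub>R a) + c *\<^sub>R f a"
          by (simp add: linear_diff[OF f] linear_scale[OF f])
        then have "norm (f v) \<le> norm (f (v - c *\<^sub>R a)) + \<bar>c\<bar> * norm (f a)"
          by (metis norm_triangle_ineq norm_scaleR)
        also have "\<dots> \<le> K * norm (v - c *\<^sub>R a) + \<bar>c\<bar> * norm (f a)" using K[OF c] by simp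
        also have "\<dots> \<le> K * (norm v + \<bar>c\<bar> * norm a) + \<bar>c\<bar> * norm (f a)"
          using mult_left_mono[OF norm_triangle_ineq4[of v "c *\<^sub>R a"], of K] K_def by simp
        also have "\<dots> = K * norm v + \<bar>c\<bar> * (K * norm a + norm (f a))" by (simp add: algebra_simps)
        also have "\<dots> \<le> K * norm v + (norm v / d) * (K * norm a + norm (f a))"
          using coeff[OF c] d K_def by (intro add_left_mono mult_right_mono) (auto simp: field_simps)
        finally show ?thesis by (simp add: algebra_simps add_divide_distrib)
      qed
      then show ?thesis by blast
    qed
    ultimately show ?thesis by blast
  qed
qed

definition finite_dimensional :: "'e::real_vector itself \<Rightarrow> bool"
  where "finite_dimensional _ \<longleftrightarrow> (\<exists>B::'e set. finite B \<and> span B = UNIV)"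

lemma finite_dimensional_real: "finite_dimensional TYPE(real)"
  unfolding finite_dimensional_def
proof (intro exI conjI)
  have "x \<in> span {1}" for x :: real
    using span_scale[OF span_base[of "1::real" "{1}"], of x] by simp
  then show "span {1::real} = UNIV" by blast
qed simp

lemma finite_dimensional_prod:
  assumes "finite_dimensional TYPE('e::real_vector)" and "finite_dimensional TYPE('f::real_vector)"
  shows "finite_dimensional TYPE('e \<times> 'f)"
proof -
  obtain B :: "'e set" and C :: "'f set"
    where B: "finite B" "span B = UNIV" and C: "finite C" "span C = UNIV"
    using assms unfolding finite_dimensional_def by blast
  let ?D = "(\<lambda>b. (b, 0)) ` B \<union> (\<lambda>c. (0, c)) ` C"
  have l1: "linear (\<lambda>b::'e. (b, 0::'f))" and l2: "linear (\<lambda>c::'f. (0::'e, c))"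
    by (auto intro!: linearI)
  have "(x, y) \<in> span ?D" for x y
  proof -
    have "(x, 0) \<in> span ((\<lambda>b. (b, 0::'f)) ` B)" using B(2) by (auto simp: linear_span_image[OF l1])
    moreover have "(0, y) \<in> span ((\<lambda>c. (0::'e, c)) ` C)" using C(2) by (auto simp: linear_span_image[OF l2])
    ultimately have "(x, 0) + (0, y) \<in> span ?D"
      by (intro span_add) (metis UnCI span_mono subsetD subsetI)+
    then show ?thesis by simp
  qed
  then have "span ?D = UNIV" by auto
  then show ?thesis using B C unfolding finite_dimensional_def by (intro exI[of _ ?D]) auto
qed

lemma linear_imp_bounded_linear:
  fixes f :: "'e::real_normed_vector \<Rightarrow> 'f::real_normed_vector"
  assumes "finite_dimensional TYPE('e)" and "linear f"
  shows "bounded_linear f"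
proof -
  obtain B :: "'e set" where "finite B" "span B = UNIV"
    using assms(1) unfolding finite_dimensional_def by blast
  then obtain K where "\<forall>v. norm (f v) \<le> K * norm v"
    using span_finite_closed_and_linear_bounded[of B] assms(2) by (metis UNIV_I)
  then show ?thesis using assms(2)
    by (auto simp: bounded_linear_def bounded_linear_axioms_def mult.commute)
qed

text \<open>Model spaces carry no inner product; the coordinates of a basis contained in the
  spanning set take its place.\<close>

lemma finite_dimensional_coordinates:
  assumes "finite_dimensional TYPE('e::real_normed_vector)"
  obtains B :: "'e::real_normed_vector set" and r :: "'e \<Rightarrow> 'e \<Rightarrow> real"
  where "finite B" "\<forall>b. bounded_linear (r b)" "\<forall>v. (\<Sum>b\<in>B. r b v *\<^sub>R b) = v"
proof -
  obtain C :: "'e set" where C: "finite C" "span C = UNIV"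
    using assms unfolding finite_dimensional_def by blast
  obtain B where B: "B \<subseteq> C" "independent B" "span B = UNIV"
    using maximal_independent_subset[of C] C by (metis span_mono span_span top.extremum_uniqueI)
  have fin: "finite B" using B C finite_subset by blast
  have "linear (\<lambda>v. representation B v b)" for b
    using B by (intro linearI) (simp_all add: representation_add representation_scale)
  moreover have "(\<Sum>b\<in>B. representation B v b *\<^sub>R b) = v" for v
    using B fin by (simp add: sum_representation_eq)
  ultimately show ?thesis
    using that[OF fin, of "\<lambda>b v. representation B v b"] linear_imp_bounded_linear[OF assms] by blast
qed

section \<open>Closure properties of C^k and smooth maps\<close>

lemma Ck_on_continuous: "Ck_on k S f \<Longrightarrow> continuous_on S f"
proof (cases k)
  case (Suc n)
  assume "Ck_on k S f"
  then have "\<forall>x\<in>S. isCont f x" unfolding Suc by (auto dest: has_derivative_continuous)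
  then show ?thesis by (simp add: continuous_at_imp_continuous_on)
qed simp

lemma Ck_on_Suc: "Ck_on (Suc k) S f \<Longrightarrow> Ck_on k S f"
proof (induction k arbitrary: f)
  case 0
  then show ?case using Ck_on_continuous[OF 0] by simp
next
  case (Suc k)
  from Suc.prems obtain f' where f': "\<forall>x\<in>S. (f has_derivative f' x) (at x)"
    "\<forall>v. Ck_on (Suc k) S (\<lambda>x. f' x v)"
    unfolding Ck_on.simps(2)[of "Suc k"] by blast
  then have "\<forall>v. Ck_on k S (\<lambda>x. f' x v)" using Suc.IH by blast
  with f'(1) show ?case unfolding Ck_on.simps(2)[of k] by blast
qed

lemma Ck_on_subset: "\<lbrakk>Ck_on k S f; T \<subseteq> S\<rbrakk> \<Longrightarrow> Ck_on k T f"
  by (induction k arbitrary: f) (auto intro: continuous_on_subset, blast)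

lemma Ck_on_cong:
  assumes "open S" and "\<And>x. x \<in> S \<Longrightarrow> f x = g x" and "Ck_on k S f"
  shows "Ck_on k S g"
proof (cases k)
  case 0
  then show ?thesis using assms by (auto cong: continuous_on_cong)
next
  case (Suc n)
  then show ?thesis using assms by (auto intro: has_derivative_transform_within_open)
qed

lemma Ck_on_const: "Ck_on k S (\<lambda>_. c)"
proof (induction k arbitrary: c)
  case (Suc k)
  show ?case by (auto intro!: exI[of _ "\<lambda>_ _. 0"] Suc)
qed simp

lemma Ck_on_bounded_linear_comp:
  assumes "bounded_linear l" and "Ck_on k S f"
  shows "Ck_on k S (\<lambda>x. l (f x))"
  using assms(2)
proof (induction k arbitrary: f)
  case 0
  then show ?case using bounded_linear.continuous_on[OF assms(1)] by auto
next
  case (Suc k)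
  then obtain f' where f': "\<forall>x\<in>S. (f has_derivative f' x) (at x)" "\<forall>v. Ck_on k S (\<lambda>x. f' x v)"
    by auto
  then show ?case
    by (auto intro!: exI[of _ "\<lambda>x v. l (f' x v)"] Suc.IH bounded_linear.has_derivative[OF assms(1)])
qed

lemma Ck_on_ident: "Ck_on k S (\<lambda>x. x)"
proof (cases k)
  case (Suc n)
  then show ?thesis by (auto intro!: exI[of _ "\<lambda>_ v. v"] Ck_on_const has_derivative_ident)
qed simp

lemma Ck_on_add:
  assumes "Ck_on k S f" "Ck_on k S g"
  shows "Ck_on k S (\<lambda>x. f x + g x)"
  using assms
proof (induction k arbitrary: f g)
  case 0
  then show ?case by (auto intro: continuous_on_add)
next
  case (Suc k)
  then obtain f' g' where "\<forall>x\<in>S. (f has_derivative f' x) (at x)" "\<forall>v. Ck_on k S (\<lambda>x. f' x v)"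
    "\<forall>x\<in>S. (g has_derivative g' x) (at x)" "\<forall>v. Ck_on k S (\<lambda>x. g' x v)"
    by auto
  then show ?case
    by (auto intro!: exI[of _ "\<lambda>x v. f' x v + g' x v"] Suc.IH has_derivative_add)
qed

lemma Ck_on_scaleR:
  fixes f :: "'e::real_normed_vector \<Rightarrow> real"
  assumes "Ck_on k S f" "Ck_on k S g"
  shows "Ck_on k S (\<lambda>x. f x *\<^sub>R g x)"
  using assms
proof (induction k arbitrary: f g)
  case 0
  then show ?case by (auto intro: continuous_on_scaleR)
next
  case (Suc k)
  then obtain f' g' where D: "\<forall>x\<in>S. (f has_derivative f' x) (at x)" "\<forall>v. Ck_on k S (\<lambda>x. f' x v)"
    "\<forall>x\<in>S. (g has_derivative g' x) (at x)" "\<forall>v. Ck_on k S (\<lambda>x. g' x v)"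
    by auto
  have "Ck_on k S f" "Ck_on k S g" using Suc.prems by (auto intro: Ck_on_Suc simp del: Ck_on.simps)
  then show ?case using D
    by (auto intro!: exI[of _ "\<lambda>x v. f x *\<^sub>R g' x v + f' x v *\<^sub>R g x"] Suc.IH Ck_on_add
        has_derivative_scaleR)
qed

lemma Ck_on_sum:
  assumes "\<And>i. i \<in> I \<Longrightarrow> Ck_on k S (f i)"
  shows "Ck_on k S (\<lambda>x. \<Sum>i\<in>I. f i x)"
  using assms by (induction I rule: infinite_finite_induct) (auto intro: Ck_on_const Ck_on_add)

text \<open>\<open>Ck_on\<close> speaks of derivatives in a fixed direction, whereas the chain rule
  produces \<open>g' (f x)\<close> in the direction \<open>f' x v\<close>, which moves with
  \<open>x\<close>. Expanding that direction in a basis leaves sums of products of functions with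
  fixed directions.\<close>

lemma Ck_on_compose:
  fixes f :: "'d::real_normed_vector \<Rightarrow> 'e::real_normed_vector"
    and g :: "'e \<Rightarrow> 'f::real_normed_vector"
  assumes fd: "finite_dimensional TYPE('e)"
    and "Ck_on k S f" "Ck_on k T g" "f ` S \<subseteq> T"
  shows "Ck_on k S (\<lambda>x. g (f x))"
  using assms(2-)
proof (induction k arbitrary: g)
  case 0
  then show ?case using continuous_on_compose2[of T g S f] unfolding Ck_on.simps by blast
next
  case (Suc k)
  obtain B :: "'e set" and r where B: "finite B" "\<forall>b. bounded_linear (r b)"
    "\<forall>v. (\<Sum>b\<in>B. r b v *\<^sub>R b) = v"
    using finite_dimensional_coordinates[OF fd] by blast
  obtain f' g' where D: "\<forall>x\<in>S. (f has_derivative f' x) (at x)" "\<forall>v. Ck_on k S (\<lambda>x. f' x v)"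
    "\<forall>x\<in>T. (g has_derivative g' x) (at x)" "\<forall>v. Ck_on k T (\<lambda>x. g' x v)"
    using Suc.prems(1,2) by auto
  have f: "Ck_on k S f" using Suc.prems(1) by (rule Ck_on_Suc)
  let ?h = "\<lambda>x v. \<Sum>b\<in>B. r b (f' x v) *\<^sub>R g' (f x) b"
  have "\<forall>x\<in>S. ((\<lambda>x. g (f x)) has_derivative ?h x) (at x)"
  proof
    fix x assume x: "x \<in> S"
    have T: "f x \<in> T" using x Suc.prems by blast
    then have lin: "linear (g' (f x))" using D(3) has_derivative_linear[of g "g' (f x)"] by blast
    have "(\<Sum>b\<in>B. r b v *\<^sub>R g' (f x) b) = g' (f x) v" for v
      using arg_cong[where f="g' (f x)", OF B(3)[rule_format, of v]]
      by (simp add: linear_sum[OF lin] linear_scale[OF lin])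
    then have "?h x = (\<lambda>v. g' (f x) (f' x v))" by simp
    moreover have "((\<lambda>x. g (f x)) has_derivative (\<lambda>v. g' (f x) (f' x v))) (at x)"
      by (rule has_derivative_compose[OF D(1)[rule_format, OF x] D(3)[rule_format, OF T]])
    ultimately show "((\<lambda>x. g (f x)) has_derivative ?h x) (at x)" by simp
  qed
  moreover have "\<forall>v. Ck_on k S (\<lambda>x. ?h x v)"
  proof (intro allI Ck_on_sum Ck_on_scaleR)
    fix v b
    have "Ck_on k S (\<lambda>x. f' x v)" using D(2) by blast
    then show "Ck_on k S (\<lambda>x. r b (f' x v))" by (rule Ck_on_bounded_linear_comp[OF B(2)[rule_format]])
    have "Ck_on k T (\<lambda>y. g' y b)" using D(4) by blast
    then show "Ck_on k S (\<lambda>x. g' (f x) b)" by (rule Suc.IH[OF f _ Suc.prems(3)])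
  qed
  ultimately show ?case unfolding Ck_on.simps(2) by (intro exI[of _ ?h]) simp
qed

lemma Ck_on_Pair:
  assumes "Ck_on k S f" "Ck_on k S g"
  shows "Ck_on k S (\<lambda>x. (f x, g x))"
proof -
  have "bounded_linear (\<lambda>a::'b. (a, 0::'c))" "bounded_linear (\<lambda>b::'c. (0::'b, b))"
    by (rule bounded_linear_Pair bounded_linear_ident bounded_linear_zero)+
  then have "Ck_on k S (\<lambda>x. (f x, 0) + (0, g x))"
    using assms by (intro Ck_on_add Ck_on_bounded_linear_comp[where l="\<lambda>a. (a, 0)"]
        Ck_on_bounded_linear_comp[where l="\<lambda>a. (0, a)"])
  then show ?thesis by simp
qed

lemma Ck_on_local:
  assumes "\<And>x. x \<in> S \<Longrightarrow> \<exists>T. open T \<and> x \<in> T \<and> Ck_on k T f"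
  shows "Ck_on k S f"
  using assms
proof (induction k arbitrary: f)
  case 0
  have "isCont f x" if x: "x \<in> S" for x
  proof -
    obtain T where "open T" "x \<in> T" "continuous_on T f" using 0[OF x] unfolding Ck_on.simps by blast
    then show ?thesis by (simp add: continuous_on_eq_continuous_at)
  qed
  then show ?case by (simp add: continuous_at_imp_continuous_on)
next
  case (Suc k)
  \<comment> \<open>One derivative has to serve all of \<open>S\<close>. The local witnesses may
    differ as functions, but by uniqueness each agrees with the Frechet derivative on its open
    set.\<close>
  define f' where "f' x = frechet_derivative f (at x)" for x
  have D: "(f has_derivative f' y) (at y)" if "Ck_on (Suc k) T f" "y \<in> T" for y T
  proof -
    have "f differentiable (at y)" using that unfolding Ck_on.simps(2) differentiable_def by blast
    then show ?thesis unfolding f'_def by (simp add: frechet_derivative_works)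
  qed
  have "\<exists>T. open T \<and> x \<in> T \<and> Ck_on k T (\<lambda>x. f' x v)" if x: "x \<in> S" for x v
  proof -
    obtain T where T: "open T" "x \<in> T" "Ck_on (Suc k) T f" using Suc.prems[OF x] by blast
    from T(3) obtain g' where g: "\<forall>x\<in>T. (f has_derivative g' x) (at x)" "\<forall>v. Ck_on k T (\<lambda>x. g' x v)"
      unfolding Ck_on.simps(2) by blast
    have eq: "g' y v = f' y v" if "y \<in> T" for y
      using has_derivative_unique[OF D[OF T(3) that], of "g' y"] g(1) that by simp
    have "Ck_on k T (\<lambda>x. g' x v)" using g(2) by blast
    from Ck_on_cong[OF T(1) eq this] have "Ck_on k T (\<lambda>x. f' x v)" .
    then show ?thesis using T by blast
  qed
  then have "\<forall>v. Ck_on k S (\<lambda>x. f' x v)" by (intro allI Suc.IH)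
  moreover have "\<forall>x\<in>S. (f has_derivative f' x) (at x)" using D Suc.prems by blast
  ultimately show ?case unfolding Ck_on.simps(2) by (intro exI[of _ f']) simp
qed

lemma smooth_on_continuous: "smooth_on S f \<Longrightarrow> continuous_on S f"
  unfolding smooth_on_def using Ck_on_continuous by blast

lemma smooth_on_subset: "\<lbrakk>smooth_on S f; T \<subseteq> S\<rbrakk> \<Longrightarrow> smooth_on T f"
  unfolding smooth_on_def using Ck_on_subset by blast

lemma smooth_on_cong:
  assumes "open S" "\<And>x. x \<in> S \<Longrightarrow> f x = g x" "smooth_on S f"
  shows "smooth_on S g"
  using assms Ck_on_cong[of S f g] unfolding smooth_on_def by blast

lemma smooth_on_compose:
  fixes f :: "'d::real_normed_vector \<Rightarrow> 'e::real_normed_vector"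
  assumes "finite_dimensional TYPE('e)" "smooth_on S f" "smooth_on T g" "f ` S \<subseteq> T"
  shows "smooth_on S (\<lambda>x. g (f x))"
  using assms(2,3) Ck_on_compose[OF assms(1) _ _ assms(4)] unfolding smooth_on_def by blast

lemma smooth_on_const: "smooth_on S (\<lambda>_. c)"
  and smooth_on_ident: "smooth_on S (\<lambda>x. x)"
  by (simp_all add: smooth_on_def Ck_on_const Ck_on_ident)

lemma smooth_on_bounded_linear: "bounded_linear l \<Longrightarrow> smooth_on S l"
  unfolding smooth_on_def using Ck_on_bounded_linear_comp[OF _ Ck_on_ident] by blast

lemma smooth_on_Pair:
  "\<lbrakk>smooth_on S f; smooth_on S g\<rbrakk> \<Longrightarrow> smooth_on S (\<lambda>x. (f x, g x))"
  by (simp add: smooth_on_def Ck_on_Pair)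

lemma smooth_on_add:
  "\<lbrakk>smooth_on S f; smooth_on S g\<rbrakk> \<Longrightarrow> smooth_on S (\<lambda>x. f x + g x)"
  by (simp add: smooth_on_def Ck_on_add)

lemma smooth_on_scaleR:
  fixes f :: "'a::real_normed_vector \<Rightarrow> real"
  shows "\<lbrakk>smooth_on S f; smooth_on S g\<rbrakk> \<Longrightarrow> smooth_on S (\<lambda>x. f x *\<^sub>R g x)"
  by (simp add: smooth_on_def Ck_on_scaleR)

lemma smooth_on_local:
  assumes "\<And>x. x \<in> S \<Longrightarrow> \<exists>T. open T \<and> x \<in> T \<and> smooth_on T f"
  shows "smooth_on S f"
  unfolding smooth_on_def
proof
  fix k
  show "Ck_on k S f" using assms unfolding smooth_on_def by (intro Ck_on_local) blast
qed

text \<open>\<open>Ck_on\<close> supplies a possibly different derivative for every order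
  \<open>k\<close>; uniqueness makes all of them equal on \<open>S\<close> to the one for order
  0.\<close>

lemma smooth_on_derivative:
  assumes S: "open S" and f: "smooth_on S f"
  obtains f' where "\<forall>x\<in>S. (f has_derivative f' x) (at x)" "\<forall>v. smooth_on S (\<lambda>x. f' x v)"
proof -
  have "\<forall>k. \<exists>f'. (\<forall>x\<in>S. (f has_derivative f' x) (at x)) \<and> (\<forall>v. Ck_on k S (\<lambda>x. f' x v))"
    using f unfolding smooth_on_def using Ck_on.simps(2)[of _ S f] by metis
  then obtain F where F: "\<forall>k. \<forall>x\<in>S. (f has_derivative F k x) (at x)"
    "\<forall>k v. Ck_on k S (\<lambda>x. F k x v)" by metis
  have eq: "F k x v = F 0 x v" if "x \<in> S" for k x v
    using has_derivative_unique[of f "F k x" x "F 0 x"] F(1) that by auto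
  have "smooth_on S (\<lambda>x. F 0 x v)" for v
    unfolding smooth_on_def
  proof
    fix k
    have "Ck_on k S (\<lambda>x. F k x v)" using F(2) by blast
    from Ck_on_cong[OF S eq this] show "Ck_on k S (\<lambda>x. F 0 x v)" .
  qed
  then show ?thesis using that[of "F 0"] F(1) by blast
qed

section \<open>Strict differentiability and curves in level sets\<close>

text \<open>Continuity of the derivative upgrades the derivative at one point to a uniform estimate:
  on a small ball \<open>f - D\<close> has derivative of norm at most \<open>e\<close>, and the mean
  value inequality applies.\<close>

lemma strict_derivative:
  fixes f :: "'e::real_normed_vector \<Rightarrow> 'f::real_normed_vector"
  assumes fd: "finite_dimensional TYPE('e)" and S: "open S" "a \<in> S" and f: "smooth_on S f"
    and D: "(f has_derivative D) (at a)" and e: "e > 0"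
  obtains d where "d > 0" "cball a d \<subseteq> S"
    "\<forall>y\<in>cball a d. \<forall>z\<in>cball a d. norm (f y - f z - D (y - z)) \<le> e * norm (y - z)"
proof -
  obtain f' where f': "\<forall>x\<in>S. (f has_derivative f' x) (at x)" "\<forall>v. Ck_on 0 S (\<lambda>x. f' x v)"
    using f unfolding smooth_on_def using Ck_on.simps(2)[of 0 S f] by metis
  have D_eq: "f' a = D" using has_derivative_unique f'(1) S(2) D by blast
  obtain B :: "'e set" and r where B: "finite B" "\<forall>b. bounded_linear (r b)"
    "\<forall>v. (\<Sum>b\<in>B. r b v *\<^sub>R b) = v"
    using finite_dimensional_coordinates[OF fd] by blast
  define N where "N = (\<Sum>b\<in>B. onorm (r b))"
  have N: "N \<ge> 0" unfolding N_def using B(2) by (intro sum_nonneg onorm_pos_le) blast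
  \<comment> \<open>Only directional derivatives are known to be continuous. If those along the
    basis vary by less than \<open>e'\<close>, the operator norm varies by at most
    \<open>N * e'\<close>. The \<open>+ 1\<close> keeps the quotient positive when \<open>N\<close>
    is 0, as in dimension zero.\<close>
  define e' where "e' = e / (N + 1)"
  have e': "e' > 0" using e N by (simp add: e'_def)
  have "\<forall>b\<in>B. \<forall>\<^sub>F x in nhds a. norm (f' x b - f' a b) < e'"
  proof
    fix b
    have "continuous_on S (\<lambda>x. f' x b)" using f'(2) by simp
    then have "isCont (\<lambda>x. f' x b) a" using S continuous_on_eq_continuous_at by blast
    then have "((\<lambda>x. f' x b) \<longlongrightarrow> f' a b) (nhds a)" using isCont_def tendsto_at_iff_tendsto_nhds by blast
    from tendstoD[OF this e'] show "\<forall>\<^sub>F x in nhds a. norm (f' x b - f' a b) < e'" by (simp add: dist_norm)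
  qed
  then have "\<forall>\<^sub>F x in nhds a. \<forall>b\<in>B. norm (f' x b - f' a b) < e'"
    using B(1) by (simp add: eventually_ball_finite)
  moreover have "\<forall>\<^sub>F x in nhds a. x \<in> S" using S by (rule eventually_nhds_in_open)
  ultimately have "\<forall>\<^sub>F x in nhds a. x \<in> S \<and> (\<forall>b\<in>B. norm (f' x b - f' a b) < e')"
    by eventually_elim simp
  then obtain d0 where d0: "d0 > 0"
    "\<And>x. dist x a < d0 \<Longrightarrow> x \<in> S \<and> (\<forall>b\<in>B. norm (f' x b - f' a b) < e')"
    unfolding eventually_nhds_metric by blast
  define d where "d = d0 / 2"
  have d: "d > 0" "\<And>x. x \<in> cball a d \<Longrightarrow> x \<in> S \<and> (\<forall>b\<in>B. norm (f' x b - f' a b) < e')"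
    using d0 unfolding d_def by (auto simp: dist_commute)
  have bound: "onorm (\<lambda>v. f' x v - D v) \<le> e" if x: "x \<in> cball a d" for x
  proof (rule onorm_bound)
    show "0 \<le> e" using e by simp
    fix v
    have l: "linear (f' x)" "linear D" using f'(1) d(2)[OF x] D has_derivative_linear by blast+
    have "f' x v - D v = (\<Sum>b\<in>B. r b v *\<^sub>R (f' x b - D b))"
    proof -
      have "f' x v = (\<Sum>b\<in>B. r b v *\<^sub>R f' x b)" "D v = (\<Sum>b\<in>B. r b v *\<^sub>R D b)"
        using arg_cong[where f="f' x", OF B(3)[rule_format, of v]]
          arg_cong[where f=D, OF B(3)[rule_format, of v]]
        by (simp_all add: linear_sum[OF l(1)] linear_scale[OF l(1)] linear_sum[OF l(2)] linear_scale[OF l(2)])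
      then show ?thesis by (simp add: scaleR_diff_right sum_subtractf)
    qed
    then have "norm (f' x v - D v) \<le> (\<Sum>b\<in>B. norm (r b v *\<^sub>R (f' x b - D b)))"
      using norm_sum by metis
    also have "\<dots> \<le> (\<Sum>b\<in>B. onorm (r b) * norm v * e')"
    proof (intro sum_mono)
      fix b assume b: "b \<in> B"
      have "\<bar>r b v\<bar> \<le> onorm (r b) * norm v" using onorm[OF B(2)[rule_format, of b], of v] by simp
      moreover have "norm (f' x b - D b) \<le> e'" using d(2)[OF x] b D_eq by (simp add: less_imp_le)
      ultimately have "\<bar>r b v\<bar> * norm (f' x b - D b) \<le> (onorm (r b) * norm v) * e'"
        by (intro mult_mono) (auto intro: mult_nonneg_nonneg onorm_pos_le B(2)[rule_format])
      then show "norm (r b v *\<^sub>R (f' x b - D b)) \<le> onorm (r b) * norm v * e'" by simp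
    qed
    also have "\<dots> = N * e' * norm v" unfolding N_def by (simp add: sum_distrib_left mult_ac)
    also have "\<dots> \<le> e * norm v"
      using N e by (intro mult_right_mono) (auto simp: e'_def field_simps)
    finally show "norm (f' x v - D v) \<le> e * norm v" .
  qed
  have lip: "norm (f y - f z - D (y - z)) \<le> e * norm (y - z)" if "y \<in> cball a d" "z \<in> cball a d" for y z
  proof -
    have bl: "bounded_linear D" using D by (rule has_derivative_bounded_linear)
    have der: "((\<lambda>x. f x - D x) has_derivative (\<lambda>v. f' x v - D v)) (at x within cball a d)"
      if "x \<in> cball a d" for x
      using f'(1) d(2)[OF that] bounded_linear_imp_has_derivative[OF bl]
      by (intro has_derivative_diff) (auto intro: has_derivative_at_withinI)
    have "norm ((f y - D y) - (f z - D z)) \<le> e * norm (y - z)"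
      by (rule differentiable_bound[OF convex_cball der bound that])
    then show ?thesis by (simp add: linear_diff[OF bounded_linear.linear[OF bl]] algebra_simps)
  qed
  have "cball a d \<subseteq> S" using d(2) by blast
  then show ?thesis using that d(1) lip by blast
qed

text \<open>The corrected points are \<open>y + R z\<close>, with \<open>z\<close> a fixed point of the contraction
  \<open>z \<mapsto> z - (f (y + R z) - f a)\<close>.\<close>

lemma curve_in_level_set:
  fixes f :: "'e::real_normed_vector \<Rightarrow> 'f::banach"
  assumes fd: "finite_dimensional TYPE('e)" and S: "open S" "a \<in> S" and f: "smooth_on S f"
    and D: "(f has_derivative D) (at a)"
    and R: "bounded_linear R" "\<And>z. D (R z) = z" and v: "D v = 0"
  obtains c where "c 0 = a" "(c has_vector_derivative v) (at 0)" "\<forall>\<^sub>F t in nhds 0. f (c t) = f a"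
proof -
  obtain K where K: "K > 0" "\<And>z. norm (R z) \<le> norm z * K"
    using bounded_linear.pos_bounded[OF R(1)] by blast
  \<comment> \<open>The slack \<open>1 / (2 * K)\<close> against the bound \<open>K\<close> of
    \<open>R\<close> makes the iteration a contraction with factor 1/2.\<close>
  obtain d where d: "d > 0" "cball a d \<subseteq> S" and lip:
    "\<forall>y\<in>cball a d. \<forall>z\<in>cball a d. norm (f y - f z - D (y - z)) \<le> (1 / (2 * K)) * norm (y - z)"
    using strict_derivative[OF fd S f D, of "1 / (2 * K)"] K by (metis divide_pos_pos mult_pos_pos zero_less_numeral zero_less_one)
  have lD: "linear D" using D has_derivative_linear by blast
  \<comment> \<open>The radius \<open>2 * norm (f y - f a)\<close> is twice the first step of the
    iteration from 0, so a contraction with factor 1/2 maps the ball to itself. The two conditions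
    on \<open>y\<close> keep all \<open>y + R z\<close> where the estimate holds.\<close>
  have ex: "\<exists>z. norm z \<le> 2 * norm (f y - f a) \<and> f (y + R z) = f a"
    if y: "dist y a \<le> d / 2" "2 * K * norm (f y - f a) \<le> d / 2" for y
  proof -
    define T where "T z = z - (f (y + R z) - f a)" for z
    define C where "C = cball (0::'f) (2 * norm (f y - f a))"
    have inb: "y + R z \<in> cball a d" if "z \<in> C" for z
    proof -
      have "norm (R z) \<le> norm z * K" by (rule K(2))
      also have "\<dots> \<le> (2 * norm (f y - f a)) * K" using that K(1) unfolding C_def by (intro mult_right_mono) auto
      also have "\<dots> \<le> d / 2" using y(2) by (simp add: mult_ac)
      finally have "norm (R z) \<le> d / 2" .
      moreover have "norm (y + R z - a) \<le> norm (y - a) + norm (R z)"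
        by (metis add_diff_eq add.commute diff_add_eq norm_triangle_ineq)
      ultimately show ?thesis using y(1) by (simp add: dist_norm norm_minus_commute)
    qed
    have contr: "norm (T z - T w) \<le> (1/2) * norm (z - w)" if "z \<in> C" "w \<in> C" for z w
    proof -
      have "D (R z - R w) = z - w" by (simp add: linear_diff[OF lD] R(2))
      then have "T z - T w = - (f (y + R z) - f (y + R w) - D ((y + R z) - (y + R w)))"
        by (simp add: T_def)
      then have "norm (T z - T w) = norm (f (y + R z) - f (y + R w) - D ((y + R z) - (y + R w)))"
        by (metis norm_minus_cancel)
      also have "\<dots> \<le> (1 / (2 * K)) * norm ((y + R z) - (y + R w))" using lip inb that by blast
      also have "\<dots> = (1 / (2 * K)) * norm (R (z - w))"
        by (simp add: linear_diff[OF bounded_linear.linear[OF R(1)]])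
      also have "\<dots> \<le> (1 / (2 * K)) * (norm (z - w) * K)" using K by (intro mult_left_mono) auto
      also have "\<dots> = (1/2) * norm (z - w)" using K(1) by simp
      finally show ?thesis .
    qed
    have zC: "0 \<in> C" unfolding C_def by simp
    have R0: "R 0 = 0" using R(1) by (simp add: linear_0 bounded_linear.linear)
    have "\<exists>!z. z \<in> C \<and> T z = z"
    proof (rule Banach_fix[of C "1/2" T])
      show "complete C" unfolding C_def by (simp add: complete_eq_closed)
      show "C \<noteq> {}" using zC by blast
      show "T ` C \<subseteq> C"
      proof clarify
        fix z assume z: "z \<in> C"
        have "norm (T z) \<le> norm (T z - T 0) + norm (T 0)" by (metis diff_add_cancel norm_triangle_ineq)
        also have "\<dots> \<le> (1/2) * norm z + norm (f y - f a)"
          using contr[OF z zC] by (simp add: T_def R0 norm_minus_commute)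
        also have "\<dots> \<le> 2 * norm (f y - f a)" using z unfolding C_def by simp
        finally show "T z \<in> C" unfolding C_def by simp
      qed
      show "dist (T z) (T w) \<le> 1/2 * dist z w" if "z \<in> C" "w \<in> C" for z w
        using contr[OF that] by (simp add: dist_norm)
    qed auto
    then obtain z where "z \<in> C" "T z = z" by blast
    then show ?thesis unfolding C_def T_def by (intro exI[of _ z]) auto
  qed
  define good where "good y \<longleftrightarrow> dist y a \<le> d / 2 \<and> 2 * K * norm (f y - f a) \<le> d / 2" for y
  obtain Z where Z: "\<And>y. good y \<Longrightarrow> norm (Z y) \<le> 2 * norm (f y - f a)"
    "\<And>y. good y \<Longrightarrow> f (y + R (Z y)) = f a"
    using ex unfolding good_def by metis
  define b where "b t = a + t *\<^sub>R v" for t :: real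
  define c where "c t = b t + R (Z (b t))" for t
  have R0: "R 0 = 0" using R(1) by (simp add: linear_0 bounded_linear.linear)
  have good_a: "good a" using d(1) by (simp add: good_def)
  have Za: "Z a = 0" using Z(1)[OF good_a] by simp
  have b: "(b has_vector_derivative v) (at 0)" unfolding b_def
    by (auto intro!: derivative_eq_intros)
  have b0: "b 0 = a" by (simp add: b_def)
  have fb: "((\<lambda>t. f (b t)) has_vector_derivative 0) (at 0)"
  proof -
    have "((\<lambda>t. f (b t)) has_derivative (\<lambda>h. D (h *\<^sub>R v))) (at 0)"
      by (rule has_derivative_compose[of b]) (use b D b0 in \<open>auto simp: has_vector_derivative_def\<close>)
    then show ?thesis by (simp add: has_vector_derivative_def linear_scale[OF lD] v)
  qed
  \<comment> \<open>Since \<open>D v = 0\<close>, the straight line leaves the level set only by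
    o(t). The correction \<open>R (Z (b t))\<close> is bounded by a multiple of this defect, so the
    corrected curve still has derivative \<open>v\<close>.\<close>
  have lim: "((\<lambda>t. norm (f (b t) - f a) / \<bar>t\<bar>) \<longlongrightarrow> 0) (at 0)"
    using fb b0 unfolding has_vector_derivative_def has_derivative_at by simp
  have good_ev: "\<forall>\<^sub>F t in nhds 0. good (b t)"
  proof -
    have "isCont b 0" using b has_vector_derivative_continuous by blast
    then have "(b \<longlongrightarrow> b 0) (nhds 0)" using isCont_def tendsto_at_iff_tendsto_nhds by blast
    then have 1: "((\<lambda>t. dist (b t) a) \<longlongrightarrow> 0) (nhds 0)" using b0 tendsto_dist_iff by metis
    have "isCont (\<lambda>t. f (b t)) 0" using fb has_vector_derivative_continuous by blast
    then have "((\<lambda>t. f (b t)) \<longlongrightarrow> f (b 0)) (nhds 0)" using isCont_def tendsto_at_iff_tendsto_nhds by metis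
    then have "((\<lambda>t. 2 * K * norm (f (b t) - f a)) \<longlongrightarrow> 2 * K * norm (f (b 0) - f a)) (nhds 0)"
      by (intro tendsto_intros)
    then have 2: "((\<lambda>t. 2 * K * norm (f (b t) - f a)) \<longlongrightarrow> 0) (nhds 0)" by (simp add: b0)
    have "d / 2 > 0" using d(1) by simp
    from order_tendstoD(2)[OF 1 this] order_tendstoD(2)[OF 2 this]
    show ?thesis by eventually_elim (simp add: good_def)
  qed
  have "(c has_vector_derivative v) (at 0)"
  proof -
    have "((\<lambda>t. norm (R (Z (b t))) / \<bar>t\<bar>) \<longlongrightarrow> 0) (at 0)"
    proof (rule tendsto_sandwich)
      show "\<forall>\<^sub>F t in at 0. 0 \<le> norm (R (Z (b t))) / \<bar>t\<bar>" by simp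
      have "\<forall>\<^sub>F t in at 0. good (b t)" using good_ev eventually_at_filter eventually_mono by fastforce
      then show "\<forall>\<^sub>F t in at 0. norm (R (Z (b t))) / \<bar>t\<bar> \<le> (2 * K) * (norm (f (b t) - f a) / \<bar>t\<bar>)"
      proof eventually_elim
        case (elim t)
        have "norm (R (Z (b t))) \<le> norm (Z (b t)) * K" by (rule K(2))
        also have "\<dots> \<le> 2 * norm (f (b t) - f a) * K" using Z(1)[OF elim] K(1) by simp
        finally show ?case by (simp add: divide_right_mono mult_ac)
      qed
      show "((\<lambda>t. (2 * K) * (norm (f (b t) - f a) / \<bar>t\<bar>)) \<longlongrightarrow> 0) (at 0)"
        using tendsto_mult_right_zero[OF lim] by simp
    qed simp
    then have "((\<lambda>t. R (Z (b t))) has_vector_derivative 0) (at 0)"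
      unfolding has_vector_derivative_def has_derivative_at by (simp add: b0 Za R0)
    from has_vector_derivative_add[OF b this] show ?thesis unfolding c_def by simp
  qed
  moreover have "c 0 = a" by (simp add: c_def b0 Za R0)
  moreover have "\<forall>\<^sub>F t in nhds 0. f (c t) = f a"
    using good_ev by eventually_elim (simp add: c_def Z(2))
  ultimately show ?thesis using that by blast
qed

section \<open>Smooth maps between manifolds\<close>

abbreviation real_atlas :: "(real, real) atlas"
  where "real_atlas \<equiv> {(UNIV, \<lambda>r. r)}"

lemma manifold_finite_dimensional:
  "smooth_manifold (A :: ('a::{t2_space,second_countable_topology}, 'e::banach) atlas)
    \<Longrightarrow> finite_dimensional TYPE('e)"
  unfolding smooth_manifold_def finite_dimensional_def by blast

lemma manifold_chart_at:
  assumes "smooth_manifold A"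
  obtains U \<phi> where "(U, \<phi>) \<in> A" "p \<in> U"
proof -
  have "p \<in> (\<Union>(U, \<phi>)\<in>A. U)" using assms unfolding smooth_manifold_def by simp
  then show ?thesis using that by auto
qed

lemma manifold_chart:
  assumes "smooth_manifold A" and "(U, \<phi>) \<in> A"
  shows "open U" "open (\<phi> ` U)" "homeomorphism U (\<phi> ` U) \<phi> (inv_into U \<phi>)"
  using assms unfolding smooth_manifold_def by fast+

lemma chart_continuous:
  assumes "smooth_manifold A" and "(U, \<phi>) \<in> A"
  shows "continuous_on U \<phi>" "continuous_on (\<phi> ` U) (inv_into U \<phi>)"
  using manifold_chart(3)[OF assms] unfolding homeomorphism_def by blast+

lemma chart_inverse_isCont:
  assumes "smooth_manifold A" and "(U, \<phi>) \<in> A" and "p \<in> U"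
  shows "isCont (inv_into U \<phi>) (\<phi> p)"
  using chart_continuous(2)[OF assms(1,2)] continuous_on_eq_continuous_at[OF manifold_chart(2)[OF assms(1,2)]] assms(3)
  by blast

lemma manifold_transition:
  assumes "smooth_manifold A" and "(U, \<phi>) \<in> A" and "(V, \<psi>) \<in> A"
  shows "smooth_on (\<phi> ` (U \<inter> V)) (\<lambda>y. \<psi> (inv_into U \<phi> y))"
  using assms unfolding smooth_manifold_def o_def by fast

lemma chart_inverse:
  assumes "smooth_manifold A" and "(U, \<phi>) \<in> A" and "x \<in> U"
  shows "inv_into U \<phi> (\<phi> x) = x"
  using manifold_chart(3)[OF assms(1,2)] assms(3) unfolding homeomorphism_def by blast

lemma chart_open_image:
  assumes A: "smooth_manifold A" "(U, \<phi>) \<in> A" and W: "open W" "W \<subseteq> U"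
  shows "open (\<phi> ` W)"
proof -
  have "\<phi> ` W = \<phi> ` U \<inter> inv_into U \<phi> -` W"
    using W chart_inverse[OF A] by (auto simp: image_iff)
  then show ?thesis
    by (simp add: continuous_open_preimage[OF chart_continuous(2)[OF A] manifold_chart(2)[OF A] W(1)])
qed

lemma smooth_atI:
  assumes "(U, \<phi>) \<in> A" "(V, \<psi>) \<in> B" "open W" "p \<in> W" "W \<subseteq> U" "f ` W \<subseteq> V"
    "smooth_on (\<phi> ` W) (\<lambda>y. \<psi> (f (inv_into U \<phi> y)))"
  shows "smooth_at A B f p"
  unfolding smooth_at_def o_def
  by (rule bexI[OF _ assms(1)], unfold prod.case, rule bexI[OF _ assms(2)], unfold prod.case,
      rule exI[of _ W]) (use assms(3-) in blast)

lemma smooth_atE: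
  assumes "smooth_at A B f p"
  obtains U \<phi> V \<psi> W where "(U, \<phi>) \<in> A" "(V, \<psi>) \<in> B" "open W" "p \<in> W" "W \<subseteq> U" "f ` W \<subseteq> V"
    "smooth_on (\<phi> ` W) (\<lambda>y. \<psi> (f (inv_into U \<phi> y)))"
  using assms unfolding smooth_at_def o_def by (elim bexE exE conjE case_prodE, hypsubst) (rule that)

text \<open>Continuity of \<open>f\<close> is not built into \<open>smooth_at\<close>; it is
  recovered by conjugating the smooth coordinate expression with the chart homeomorphisms.\<close>

lemma smooth_at_continuous_nhd:
  assumes A: "smooth_manifold A" and B: "smooth_manifold B"
    and UV: "(U, \<phi>) \<in> A" "(V, \<psi>) \<in> B" and W: "W \<subseteq> U" "f ` W \<subseteq> V"
    and f: "smooth_on (\<phi> ` W) (\<lambda>y. \<psi> (f (inv_into U \<phi> y)))"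
  shows "continuous_on W f"
proof -
  have 1: "continuous_on W \<phi>" by (rule continuous_on_subset[OF chart_continuous(1)[OF A UV(1)] W(1)])
  have "continuous_on W (\<lambda>x. \<psi> (f (inv_into U \<phi> (\<phi> x))))"
    by (rule continuous_on_compose2[OF smooth_on_continuous[OF f] 1]) blast
  moreover have "\<psi> (f (inv_into U \<phi> (\<phi> x))) \<in> \<psi> ` V" if "x \<in> W" for x
    using that W chart_inverse[OF A UV(1)] by (metis image_eqI image_subset_iff subsetD)
  ultimately have "continuous_on W (\<lambda>x. inv_into V \<psi> (\<psi> (f (inv_into U \<phi> (\<phi> x)))))"
    by (intro continuous_on_compose2[OF chart_continuous(2)[OF B UV(2)]]) blast+
  moreover have "inv_into V \<psi> (\<psi> (f (inv_into U \<phi> (\<phi> x)))) = f x" if "x \<in> W" for x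
    using that W chart_inverse[OF A UV(1)] chart_inverse[OF B UV(2)] by (metis image_subset_iff subsetD)
  ultimately show ?thesis by (simp cong: continuous_on_cong)
qed

text \<open>\<open>smooth_at\<close> offers one pair of charts. Continuity of \<open>f\<close>
  allows shrinking the neighbourhood to fit any other pair, and transition maps on both sides carry
  the coordinate expression over.\<close>

lemma smooth_at_charts:
  assumes A: "smooth_manifold A" and B: "smooth_manifold B" and f: "smooth_at A B f p"
    and U: "(U, \<phi>) \<in> A" "p \<in> U" and V: "(V, \<psi>) \<in> B" "f p \<in> V"
  obtains W where "open W" "p \<in> W" "W \<subseteq> U" "f ` W \<subseteq> V"
    "smooth_on (\<phi> ` W) (\<lambda>y. \<psi> (f (inv_into U \<phi> y)))"
proof -
  obtain U0 \<phi>0 V0 \<psi>0 W0 where 0: "(U0, \<phi>0) \<in> A" "(V0, \<psi>0) \<in> B" "open W0" "p \<in> W0" "W0 \<subseteq> U0"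
    "f ` W0 \<subseteq> V0" "smooth_on (\<phi>0 ` W0) (\<lambda>y. \<psi>0 (f (inv_into U0 \<phi>0 y)))"
    using f by (rule smooth_atE)
  have cont: "continuous_on W0 f" by (rule smooth_at_continuous_nhd[OF A B 0(1,2,5,6,7)])
  define W where "W = (W0 \<inter> f -` V) \<inter> U"
  have W: "open W" "p \<in> W" "W \<subseteq> U" "f ` W \<subseteq> V" "W \<subseteq> W0" "W \<subseteq> U0" "f ` W \<subseteq> V0"
    unfolding W_def using 0 U V manifold_chart(1)[OF A U(1)] manifold_chart(1)[OF B V(1)]
      continuous_open_preimage[OF cont] by auto
  note inv = chart_inverse[OF A U(1)] chart_inverse[OF A 0(1)] chart_inverse[OF B 0(2)]
  have 1: "smooth_on (\<phi> ` W) (\<lambda>y. \<phi>0 (inv_into U \<phi> y))"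
    by (rule smooth_on_subset[OF manifold_transition[OF A U(1) 0(1)]]) (use W in blast)
  have "\<phi>0 (inv_into U \<phi> y) \<in> \<phi>0 ` W0" if "y \<in> \<phi> ` W" for y
    using that W inv(1) by (metis image_iff subsetD)
  then have "smooth_on (\<phi> ` W) (\<lambda>y. \<psi>0 (f (inv_into U0 \<phi>0 (\<phi>0 (inv_into U \<phi> y)))))"
    by (intro smooth_on_compose[OF manifold_finite_dimensional[OF A] 1 0(7)]) blast
  moreover have "(\<lambda>y. \<psi>0 (f (inv_into U0 \<phi>0 (\<phi>0 (inv_into U \<phi> y))))) ` \<phi> ` W \<subseteq> \<psi>0 ` (V0 \<inter> V)"
  proof clarify
    fix x assume x: "x \<in> W"
    then have xs: "x \<in> U" "x \<in> U0" "f x \<in> V0 \<inter> V" using W by auto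
    then show "\<psi>0 (f (inv_into U0 \<phi>0 (\<phi>0 (inv_into U \<phi> (\<phi> x))))) \<in> \<psi>0 ` (V0 \<inter> V)"
      by (simp only: inv xs image_eqI)
  qed
  ultimately have 2: "smooth_on (\<phi> ` W)
    (\<lambda>y. \<psi> (inv_into V0 \<psi>0 (\<psi>0 (f (inv_into U0 \<phi>0 (\<phi>0 (inv_into U \<phi> y)))))))"
    by (rule smooth_on_compose[OF manifold_finite_dimensional[OF B] _ manifold_transition[OF B 0(2) V(1)]])
  have eq: "\<psi> (inv_into V0 \<psi>0 (\<psi>0 (f (inv_into U0 \<phi>0 (\<phi>0 (inv_into U \<phi> y))))))
      = \<psi> (f (inv_into U \<phi> y))" if y: "y \<in> \<phi> ` W" for y
  proof -
    obtain x where x: "x \<in> W" "y = \<phi> x" using y by blast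
    then have "x \<in> U" "x \<in> U0" "f x \<in> V0" using W by auto
    then show ?thesis by (simp only: inv x(2))
  qed
  from smooth_on_cong[OF chart_open_image[OF A U(1) W(1,3)] eq 2] W that show ?thesis by blast
qed

lemma smooth_at_isCont:
  assumes A: "smooth_manifold A" and B: "smooth_manifold B" and f: "smooth_at A B f p"
  shows "isCont f p"
proof -
  obtain U \<phi> V \<psi> W where 0: "(U, \<phi>) \<in> A" "(V, \<psi>) \<in> B" "open W" "p \<in> W" "W \<subseteq> U" "f ` W \<subseteq> V"
    "smooth_on (\<phi> ` W) (\<lambda>y. \<psi> (f (inv_into U \<phi> y)))"
    using f by (rule smooth_atE)
  show ?thesis using smooth_at_continuous_nhd[OF A B 0(1,2,5,6,7)] 0(3,4)
    continuous_on_eq_continuous_at by blast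
qed

lemma smooth_at_tendsto:
  assumes "smooth_manifold A" "smooth_manifold B" "smooth_at A B f p" "eventually P (nhds (f p))"
  shows "\<forall>\<^sub>F x in nhds p. P (f x)"
  using smooth_at_isCont[OF assms(1-3)] assms(4)
  by (metis eventually_compose_filterlim isCont_def tendsto_at_iff_tendsto_nhds)

lemma smooth_at_eventually:
  assumes "smooth_at A B f p"
  shows "\<forall>\<^sub>F x in nhds p. smooth_at A B f x"
proof -
  obtain U \<phi> V \<psi> W where 0: "(U, \<phi>) \<in> A" "(V, \<psi>) \<in> B" "open W" "p \<in> W" "W \<subseteq> U" "f ` W \<subseteq> V"
    "smooth_on (\<phi> ` W) (\<lambda>y. \<psi> (f (inv_into U \<phi> y)))"
    using assms by (rule smooth_atE)
  have "smooth_at A B f x" if "x \<in> W" for x by (rule smooth_atI[OF 0(1-3) that 0(5-7)])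
  then show ?thesis using 0(3,4) eventually_nhds by blast
qed

lemma smooth_at_cong:
  assumes A: "smooth_manifold A" and f: "smooth_at A B f p" and eq: "\<forall>\<^sub>F x in nhds p. f x = g x"
  shows "smooth_at A B g p"
proof -
  obtain U \<phi> V \<psi> W where 0: "(U, \<phi>) \<in> A" "(V, \<psi>) \<in> B" "open W" "p \<in> W" "W \<subseteq> U" "f ` W \<subseteq> V"
    "smooth_on (\<phi> ` W) (\<lambda>y. \<psi> (f (inv_into U \<phi> y)))"
    using f by (rule smooth_atE)
  obtain T where T: "open T" "p \<in> T" "\<forall>x\<in>T. f x = g x" using eq unfolding eventually_nhds by blast
  have W: "open (W \<inter> T)" "W \<inter> T \<subseteq> U" "p \<in> W \<inter> T" using 0 T by auto
  have eq': "\<psi> (f (inv_into U \<phi> y)) = \<psi> (g (inv_into U \<phi> y))" if y: "y \<in> \<phi> ` (W \<inter> T)" for y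
  proof -
    obtain x where "x \<in> W \<inter> T" "y = \<phi> x" using y by blast
    then show ?thesis using chart_inverse[OF A 0(1)] 0(5) T(3) by auto
  qed
  have "smooth_on (\<phi> ` (W \<inter> T)) (\<lambda>y. \<psi> (f (inv_into U \<phi> y)))"
    by (rule smooth_on_subset[OF 0(7)]) blast
  from smooth_on_cong[OF chart_open_image[OF A 0(1) W(1,2)] eq' this]
  have "smooth_on (\<phi> ` (W \<inter> T)) (\<lambda>y. \<psi> (g (inv_into U \<phi> y)))" .
  moreover have "g ` (W \<inter> T) \<subseteq> V" using 0(6) T(3) by auto
  ultimately show ?thesis by (intro smooth_atI[OF 0(1,2) W(1,3,2)])
qed

lemma smooth_at_compose:
  assumes A: "smooth_manifold A" and B: "smooth_manifold B" and C: "smooth_manifold C"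
    and f: "smooth_at A B f p" and g: "smooth_at B C g (f p)"
  shows "smooth_at A C (\<lambda>x. g (f x)) p"
proof -
  obtain U \<phi> V \<psi> Z \<kappa> where ch: "(U, \<phi>) \<in> A" "p \<in> U" "(V, \<psi>) \<in> B" "f p \<in> V" "(Z, \<kappa>) \<in> C" "g (f p) \<in> Z"
    using manifold_chart_at[OF A] manifold_chart_at[OF B] manifold_chart_at[OF C] by metis
  obtain W1 where W1: "open W1" "p \<in> W1" "W1 \<subseteq> U" "f ` W1 \<subseteq> V"
    "smooth_on (\<phi> ` W1) (\<lambda>y. \<psi> (f (inv_into U \<phi> y)))"
    using smooth_at_charts[OF A B f ch(1-4)] by blast
  obtain W2 where W2: "open W2" "f p \<in> W2" "W2 \<subseteq> V" "g ` W2 \<subseteq> Z"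
    "smooth_on (\<psi> ` W2) (\<lambda>y. \<kappa> (g (inv_into V \<psi> y)))"
    using smooth_at_charts[OF B C g ch(3-6)] by blast
  define W where "W = W1 \<inter> f -` W2"
  have W: "open W" "p \<in> W" "W \<subseteq> U" "(\<lambda>x. g (f x)) ` W \<subseteq> Z" "W \<subseteq> W1" "f ` W \<subseteq> W2"
    unfolding W_def using W1 W2
      continuous_open_preimage[OF smooth_at_continuous_nhd[OF A B ch(1,3) W1(3-5)] W1(1) W2(1)]
    by auto
  note inv = chart_inverse[OF A ch(1)] chart_inverse[OF B ch(3)]
  have "smooth_on (\<phi> ` W) (\<lambda>y. \<psi> (f (inv_into U \<phi> y)))" using smooth_on_subset[OF W1(5)] W(5) by blast
  moreover have "(\<lambda>y. \<psi> (f (inv_into U \<phi> y))) ` \<phi> ` W \<subseteq> \<psi> ` W2"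
    using W inv(1) by (auto simp: subset_iff)
  ultimately have 1: "smooth_on (\<phi> ` W) (\<lambda>y. \<kappa> (g (inv_into V \<psi> (\<psi> (f (inv_into U \<phi> y))))))"
    by (rule smooth_on_compose[OF manifold_finite_dimensional[OF B] _ W2(5)])
  have eq: "\<kappa> (g (inv_into V \<psi> (\<psi> (f (inv_into U \<phi> y))))) = \<kappa> (g (f (inv_into U \<phi> y)))"
    if y: "y \<in> \<phi> ` W" for y
  proof -
    obtain x where x: "x \<in> W" "y = \<phi> x" using y by blast
    then have "x \<in> U" "f x \<in> V" using W W2(3) by auto
    then show ?thesis by (simp only: inv x(2))
  qed
  show ?thesis
    by (rule smooth_atI[OF ch(1,5) W(1-4) smooth_on_cong[OF chart_open_image[OF A ch(1) W(1,3)] eq 1]])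
qed

lemma smooth_manifold_real: "smooth_manifold real_atlas"
proof -
  have inv: "inv_into UNIV (\<lambda>r::real. r) = (\<lambda>r. r)"
  proof
    show "inv_into UNIV (\<lambda>r::real. r) x = x" for x using inv_f_f[of "\<lambda>r::real. r" x] by simp
  qed
  have "\<exists>B::real set. finite B \<and> span B = UNIV"
    using finite_dimensional_real unfolding finite_dimensional_def .
  moreover have "homeomorphism UNIV UNIV (\<lambda>r::real. r) (\<lambda>r. r)"
    unfolding homeomorphism_def by simp
  ultimately show ?thesis
    unfolding smooth_manifold_def by (simp add: inv o_def smooth_on_ident)
qed

lemma smooth_at_real_charts:
  assumes A: "smooth_manifold A" and h: "smooth_at A real_atlas h p" and U: "(U, \<phi>) \<in> A" "p \<in> U"
  obtains W where "open W" "p \<in> W" "W \<subseteq> U" "smooth_on (\<phi> ` W) (\<lambda>y. h (inv_into U \<phi> y))"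
proof -
  have "(UNIV, \<lambda>r. r) \<in> real_atlas" "h p \<in> UNIV" by simp_all
  then show ?thesis by (rule smooth_at_charts[OF A smooth_manifold_real h U]) (rule that)
qed

text \<open>The bridge between the definition of \<open>tensors\<close>, which asks for smooth
  components on whole charts, and the local notion \<open>smooth_at\<close> with which the proof
  works.\<close>

lemma smooth_on_chart_iff:
  assumes A: "smooth_manifold A" and U: "(U, \<phi>) \<in> A"
  shows "smooth_on (\<phi> ` U) (\<lambda>y. h (inv_into U \<phi> y)) \<longleftrightarrow> (\<forall>x\<in>U. smooth_at A real_atlas h x)"
proof
  assume "smooth_on (\<phi> ` U) (\<lambda>y. h (inv_into U \<phi> y))"
  then show "\<forall>x\<in>U. smooth_at A real_atlas h x"
    by (intro ballI smooth_atI[OF U _ manifold_chart(1)[OF A U], where \<psi>="\<lambda>r. r" and V=UNIV]) auto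
next
  assume *: "\<forall>x\<in>U. smooth_at A real_atlas h x"
  show "smooth_on (\<phi> ` U) (\<lambda>y. h (inv_into U \<phi> y))"
  proof (rule smooth_on_local)
    fix y assume "y \<in> \<phi> ` U"
    then obtain x where x: "x \<in> U" "y = \<phi> x" by blast
    then obtain W where "open W" "x \<in> W" "W \<subseteq> U" "smooth_on (\<phi> ` W) (\<lambda>y. h (inv_into U \<phi> y))"
      using smooth_at_real_charts[OF A _ U] * by blast
    then show "\<exists>T. open T \<and> y \<in> T \<and> smooth_on T (\<lambda>y. h (inv_into U \<phi> y))"
      using chart_open_image[OF A U] x by blast
  qed
qed

lemma smooth_at_chart_comp:
  assumes A: "smooth_manifold A" and U: "(U, \<phi>) \<in> A" "x \<in> U" and G: "smooth_on (\<phi> ` W) G"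
    and W: "open W" "x \<in> W" "W \<subseteq> U"
  shows "smooth_at A real_atlas (\<lambda>x. G (\<phi> x)) x"
proof (rule smooth_atI[OF U(1), of UNIV "\<lambda>r. r" real_atlas W])
  show "smooth_on (\<phi> ` W) (\<lambda>y. G (\<phi> (inv_into U \<phi> y)))"
  proof (rule smooth_on_cong[OF chart_open_image[OF A U(1) W(1,3)] _ G])
    fix y assume "y \<in> \<phi> ` W"
    then show "G y = G (\<phi> (inv_into U \<phi> y))" using W(3) by (metis f_inv_into_f image_mono subsetD)
  qed
qed (use W in auto)

lemma smooth_at_chart_coordinate:
  assumes A: "smooth_manifold (A :: ('a::{t2_space,second_countable_topology}, 'e::banach) atlas)"
    and U: "(U, \<phi>) \<in> A" "x \<in> U" and l: "linear (l :: 'e \<Rightarrow> real)"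
  shows "smooth_at A real_atlas (\<lambda>x. l (\<phi> x)) x"
  using smooth_at_chart_comp[OF A U smooth_on_bounded_linear, of l U]
    linear_imp_bounded_linear[OF manifold_finite_dimensional[OF A] l] U manifold_chart(1)[OF A U(1)] by blast

lemma smooth_at_ident:
  assumes A: "smooth_manifold A"
  shows "smooth_at A A (\<lambda>x. x) p"
proof -
  obtain U \<phi> where U: "(U, \<phi>) \<in> A" "p \<in> U" using manifold_chart_at[OF A] by blast
  have "smooth_on (\<phi> ` U) (\<lambda>y. \<phi> (inv_into U \<phi> y))"
    using manifold_transition[OF A U(1) U(1)] by simp
  then show ?thesis by (intro smooth_atI[OF U(1) U(1) manifold_chart(1)[OF A U(1)] U(2)]) auto
qed

lemma smooth_at_const:
  assumes A: "smooth_manifold A" and B: "smooth_manifold B"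
  shows "smooth_at A B (\<lambda>_. b) p"
proof -
  obtain U \<phi> where U: "(U, \<phi>) \<in> A" "p \<in> U" using manifold_chart_at[OF A] by blast
  obtain V \<psi> where V: "(V, \<psi>) \<in> B" "b \<in> V" using manifold_chart_at[OF B] by blast
  show ?thesis
    by (rule smooth_atI[OF U(1) V(1) manifold_chart(1)[OF A U(1)] U(2)]) (use V smooth_on_const in auto)
qed

lemma smooth_at_real_const: "smooth_manifold A \<Longrightarrow> smooth_at A real_atlas (\<lambda>_. r) p"
  using smooth_at_const smooth_manifold_real by blast

lemma
  assumes A: "smooth_manifold A" and h: "smooth_at A real_atlas h p" "smooth_at A real_atlas k p"
  shows smooth_at_real_add: "smooth_at A real_atlas (\<lambda>x. h x + k x) p"
    and smooth_at_real_mult: "smooth_at A real_atlas (\<lambda>x. h x * k x) p"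
proof -
  obtain U \<phi> where U: "(U, \<phi>) \<in> A" "p \<in> U" using manifold_chart_at[OF A] by blast
  obtain W1 where W1: "open W1" "p \<in> W1" "W1 \<subseteq> U" "smooth_on (\<phi> ` W1) (\<lambda>y. h (inv_into U \<phi> y))"
    using smooth_at_real_charts[OF A h(1) U] by blast
  obtain W2 where W2: "open W2" "p \<in> W2" "W2 \<subseteq> U" "smooth_on (\<phi> ` W2) (\<lambda>y. k (inv_into U \<phi> y))"
    using smooth_at_real_charts[OF A h(2) U] by blast
  have W: "open (W1 \<inter> W2)" "p \<in> W1 \<inter> W2" "W1 \<inter> W2 \<subseteq> U" using W1 W2 by auto
  have s: "smooth_on (\<phi> ` (W1 \<inter> W2)) (\<lambda>y. h (inv_into U \<phi> y))"
    "smooth_on (\<phi> ` (W1 \<inter> W2)) (\<lambda>y. k (inv_into U \<phi> y))"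
    by (rule smooth_on_subset[OF W1(4)], blast, rule smooth_on_subset[OF W2(4)], blast)
  show "smooth_at A real_atlas (\<lambda>x. h x + k x) p"
    by (rule smooth_atI[OF U(1) _ W, where \<psi>="\<lambda>r. r" and V=UNIV]) (use smooth_on_add[OF s] in auto)
  show "smooth_at A real_atlas (\<lambda>x. h x * k x) p"
    by (rule smooth_atI[OF U(1) _ W, where \<psi>="\<lambda>r. r" and V=UNIV]) (use smooth_on_scaleR[OF s] in auto)
qed

lemma smooth_at_real_sum:
  assumes A: "smooth_manifold A" and "\<And>i. i \<in> I \<Longrightarrow> smooth_at A real_atlas (h i) p"
  shows "smooth_at A real_atlas (\<lambda>x. \<Sum>i\<in>I. h i x) p"
  using assms(2)
  by (induction I rule: infinite_finite_induct)
    (simp_all add: smooth_at_real_const[OF A] smooth_at_real_add[OF A])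

section \<open>Product manifolds\<close>

lemma chart_inj: "smooth_manifold A \<Longrightarrow> (U, \<phi>) \<in> A \<Longrightarrow> inj_on \<phi> U"
  using chart_inverse by (metis inj_onI)

lemma inv_into_map_prod:
  assumes "inj_on \<phi> U" "inj_on \<psi> V" "y \<in> \<phi> ` U" "z \<in> \<psi> ` V"
  shows "inv_into (U \<times> V) (map_prod \<phi> \<psi>) (y, z) = (inv_into U \<phi> y, inv_into V \<psi> z)"
proof (rule inv_into_f_eq)
  show "inj_on (map_prod \<phi> \<psi>) (U \<times> V)" using assms(1,2) by (rule map_prod_inj_on)
  show "(inv_into U \<phi> y, inv_into V \<psi> z) \<in> U \<times> V" using assms(3,4) by (simp add: inv_into_into)
  show "map_prod \<phi> \<psi> (inv_into U \<phi> y, inv_into V \<psi> z) = (y, z)"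
    using assms(3,4) by (simp add: f_inv_into_f)
qed

lemma prod_atlasI: "\<lbrakk>(U, \<phi>) \<in> A; (V, \<psi>) \<in> B\<rbrakk> \<Longrightarrow> (U \<times> V, map_prod \<phi> \<psi>) \<in> prod_atlas A B"
  unfolding prod_atlas_def by blast

lemma prod_atlasE:
  assumes "c \<in> prod_atlas A B"
  obtains U \<phi> V \<psi> where "c = (U \<times> V, map_prod \<phi> \<psi>)" "(U, \<phi>) \<in> A" "(V, \<psi>) \<in> B"
  using assms unfolding prod_atlas_def by blast

lemma smooth_manifold_prod:
  fixes A :: "('a::{t2_space,second_countable_topology}, 'e::banach) atlas"
    and B :: "('b::{t2_space,second_countable_topology}, 'f::banach) atlas"
  assumes A: "smooth_manifold A" and B: "smooth_manifold B"
  shows "smooth_manifold (prod_atlas A B)"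
  unfolding smooth_manifold_def
proof (intro conjI ballI)
  show "\<exists>D::('e \<times> 'f) set. finite D \<and> span D = UNIV"
    using finite_dimensional_prod[OF manifold_finite_dimensional[OF A] manifold_finite_dimensional[OF B]]
    unfolding finite_dimensional_def .
  show "(\<Union>(U, \<phi>)\<in>prod_atlas A B. U) = UNIV"
  proof -
    have "\<exists>c\<in>prod_atlas A B. (x, y) \<in> fst c" for x y
    proof -
      obtain U \<phi> where U: "(U, \<phi>) \<in> A" "x \<in> U" using manifold_chart_at[OF A] by blast
      obtain V \<psi> where V: "(V, \<psi>) \<in> B" "y \<in> V" using manifold_chart_at[OF B] by blast
      show ?thesis by (rule bexI[OF _ prod_atlasI[OF U(1) V(1)]]) (simp add: U(2) V(2))
    qed
    then show ?thesis by (auto simp: case_prod_beta)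
  qed
next
  fix c assume "c \<in> prod_atlas A B"
  then obtain U \<phi> V \<psi> where c: "c = (U \<times> V, map_prod \<phi> \<psi>)" "(U, \<phi>) \<in> A" "(V, \<psi>) \<in> B"
    by (rule prod_atlasE)
  note inj = chart_inj[OF A c(2)] chart_inj[OF B c(3)]
  have im: "map_prod \<phi> \<psi> ` (U \<times> V) = \<phi> ` U \<times> \<psi> ` V" by (rule map_prod_surj_on[OF refl refl])
  have op: "open (U \<times> V)" "open (map_prod \<phi> \<psi> ` (U \<times> V))"
    unfolding im using manifold_chart[OF A c(2)] manifold_chart[OF B c(3)] by (auto intro: open_Times)
  have cont1: "continuous_on (U \<times> V) (map_prod \<phi> \<psi>)"
    unfolding map_prod_def case_prod_beta
    by (intro continuous_on_Pair continuous_on_compose2[OF chart_continuous(1)[OF A c(2)] continuous_on_fst]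
        continuous_on_compose2[OF chart_continuous(1)[OF B c(3)] continuous_on_snd] continuous_on_id) auto
  have cont2: "continuous_on (\<phi> ` U \<times> \<psi> ` V) (\<lambda>z. (inv_into U \<phi> (fst z), inv_into V \<psi> (snd z)))"
    by (intro continuous_on_Pair continuous_on_compose2[OF chart_continuous(2)[OF A c(2)] continuous_on_fst]
        continuous_on_compose2[OF chart_continuous(2)[OF B c(3)] continuous_on_snd] continuous_on_id) auto
  have inv: "inv_into (U \<times> V) (map_prod \<phi> \<psi>) z = (inv_into U \<phi> (fst z), inv_into V \<psi> (snd z))"
    if "z \<in> \<phi> ` U \<times> \<psi> ` V" for z
    using inv_into_map_prod[OF inj] that by (cases z) auto
  have cont3: "continuous_on (\<phi> ` U \<times> \<psi> ` V) (inv_into (U \<times> V) (map_prod \<phi> \<psi>))"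
    using cont2 by (rule continuous_on_eq) (simp add: inv)
  have "homeomorphism (U \<times> V) (map_prod \<phi> \<psi> ` (U \<times> V)) (map_prod \<phi> \<psi>) (inv_into (U \<times> V) (map_prod \<phi> \<psi>))"
    unfolding homeomorphism_def
    using cont1 cont3[folded im] map_prod_inj_on[OF inj]
    by (simp add: f_inv_into_f inv_into_image_cancel)
  then show "case c of (U, \<phi>) \<Rightarrow> open U \<and> open (\<phi> ` U) \<and> homeomorphism U (\<phi> ` U) \<phi> (inv_into U \<phi>)"
    using op by (simp add: c(1))
  show "case c of (U, \<phi>) \<Rightarrow> \<forall>(V, \<psi>)\<in>prod_atlas A B. smooth_on (\<phi> ` (U \<inter> V)) (\<psi> \<circ> inv_into U \<phi>)"
    unfolding c(1) prod.case
  proof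
    fix d assume "d \<in> prod_atlas A B"
    then obtain U' \<phi>' V' \<psi>' where d: "d = (U' \<times> V', map_prod \<phi>' \<psi>')" "(U', \<phi>') \<in> A" "(V', \<psi>') \<in> B"
      by (rule prod_atlasE)
    let ?S = "\<phi> ` (U \<inter> U')" and ?T = "\<psi> ` (V \<inter> V')"
    have "open ?S" "open ?T"
      using chart_open_image[OF A c(2), of "U \<inter> U'"] chart_open_image[OF B c(3), of "V \<inter> V'"]
        manifold_chart(1)[OF A c(2)] manifold_chart(1)[OF A d(2)]
        manifold_chart(1)[OF B c(3)] manifold_chart(1)[OF B d(3)] by auto
    then have opST: "open (?S \<times> ?T)" by (rule open_Times)
    have 1: "smooth_on (?S \<times> ?T) (\<lambda>z. \<phi>' (inv_into U \<phi> (fst z)))"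
      by (rule smooth_on_compose[OF manifold_finite_dimensional[OF A]
            smooth_on_bounded_linear[OF bounded_linear_fst] manifold_transition[OF A c(2) d(2)]]) auto
    have 2: "smooth_on (?S \<times> ?T) (\<lambda>z. \<psi>' (inv_into V \<psi> (snd z)))"
      by (rule smooth_on_compose[OF manifold_finite_dimensional[OF B]
            smooth_on_bounded_linear[OF bounded_linear_snd] manifold_transition[OF B c(3) d(3)]]) auto
    have eq: "(\<phi>' (inv_into U \<phi> (fst z)), \<psi>' (inv_into V \<psi> (snd z)))
        = (map_prod \<phi>' \<psi>' \<circ> inv_into (U \<times> V) (map_prod \<phi> \<psi>)) z" if "z \<in> ?S \<times> ?T" for z
    proof -
      have "z \<in> \<phi> ` U \<times> \<psi> ` V" using that by auto
      then show ?thesis by (simp add: inv)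
    qed
    have "map_prod \<phi> \<psi> ` (U \<times> V \<inter> U' \<times> V') = ?S \<times> ?T"
      by (simp add: Times_Int_Times map_prod_surj_on)
    with smooth_on_cong[OF opST eq smooth_on_Pair[OF 1 2]]
    show "case d of (V', \<psi>') \<Rightarrow>
      smooth_on (map_prod \<phi> \<psi> ` (U \<times> V \<inter> V')) (\<psi>' \<circ> inv_into (U \<times> V) (map_prod \<phi> \<psi>))"
      by (simp add: d(1) o_def)
  qed
qed

lemma smooth_at_Pair:
  assumes A: "smooth_manifold A" and B: "smooth_manifold B" and C: "smooth_manifold C"
    and f: "smooth_at A B f p" and g: "smooth_at A C g p"
  shows "smooth_at A (prod_atlas B C) (\<lambda>x. (f x, g x)) p"
proof -
  obtain U \<phi> where U: "(U, \<phi>) \<in> A" "p \<in> U" using manifold_chart_at[OF A] by blast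
  obtain V \<psi> where V: "(V, \<psi>) \<in> B" "f p \<in> V" using manifold_chart_at[OF B] by blast
  obtain Z \<kappa> where Z: "(Z, \<kappa>) \<in> C" "g p \<in> Z" using manifold_chart_at[OF C] by blast
  obtain W1 where W1: "open W1" "p \<in> W1" "W1 \<subseteq> U" "f ` W1 \<subseteq> V"
    "smooth_on (\<phi> ` W1) (\<lambda>y. \<psi> (f (inv_into U \<phi> y)))"
    using smooth_at_charts[OF A B f U V] by blast
  obtain W2 where W2: "open W2" "p \<in> W2" "W2 \<subseteq> U" "g ` W2 \<subseteq> Z"
    "smooth_on (\<phi> ` W2) (\<lambda>y. \<kappa> (g (inv_into U \<phi> y)))"
    using smooth_at_charts[OF A C g U Z] by blast
  have W: "open (W1 \<inter> W2)" "p \<in> W1 \<inter> W2" "W1 \<inter> W2 \<subseteq> U" "(\<lambda>x. (f x, g x)) ` (W1 \<inter> W2) \<subseteq> V \<times> Z"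
    using W1(1-4) W2(1-4) by auto
  have 1: "smooth_on (\<phi> ` (W1 \<inter> W2)) (\<lambda>y. \<psi> (f (inv_into U \<phi> y)))"
    by (rule smooth_on_subset[OF W1(5)]) blast
  have 2: "smooth_on (\<phi> ` (W1 \<inter> W2)) (\<lambda>y. \<kappa> (g (inv_into U \<phi> y)))"
    by (rule smooth_on_subset[OF W2(5)]) blast
  show ?thesis
    by (rule smooth_atI[OF U(1) prod_atlasI[OF V(1) Z(1)] W])
      (simp only: map_prod_simp smooth_on_Pair[OF 1 2])
qed

lemma
  assumes A: "smooth_manifold A" and B: "smooth_manifold B"
  shows smooth_at_fst: "smooth_at (prod_atlas A B) A fst p" and smooth_at_snd: "smooth_at (prod_atlas A B) B snd p"
proof -
  obtain U \<phi> where U: "(U, \<phi>) \<in> A" "fst p \<in> U" using manifold_chart_at[OF A] by blast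
  obtain V \<psi> where V: "(V, \<psi>) \<in> B" "snd p \<in> V" using manifold_chart_at[OF B] by blast
  note P = smooth_manifold_prod[OF A B]
  note pc = prod_atlasI[OF U(1) V(1)]
  have p: "p \<in> U \<times> V" using U V by (simp add: mem_Times_iff)
  have eq: "fst y = \<phi> (fst (inv_into (U \<times> V) (map_prod \<phi> \<psi>) y))"
     "snd y = \<psi> (snd (inv_into (U \<times> V) (map_prod \<phi> \<psi>) y))" if "y \<in> map_prod \<phi> \<psi> ` (U \<times> V)" for y
    using f_inv_into_f[OF that] by (metis fst_map_prod, metis snd_map_prod)
  show "smooth_at (prod_atlas A B) A fst p"
    by (rule smooth_atI[OF pc U(1) manifold_chart(1)[OF P pc] p order.refl _
      smooth_on_cong[OF manifold_chart(2)[OF P pc] eq(1) smooth_on_bounded_linear[OF bounded_linear_fst]]]) auto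
  show "smooth_at (prod_atlas A B) B snd p"
    by (rule smooth_atI[OF pc V(1) manifold_chart(1)[OF P pc] p order.refl _
      smooth_on_cong[OF manifold_chart(2)[OF P pc] eq(2) smooth_on_bounded_linear[OF bounded_linear_snd]]]) auto
qed

section \<open>Curves and their velocities\<close>

text \<open>A chain rule at the single parameter 0. The curve lies in the chart only near 0, so the
  coordinate expression agrees with \<open>F (c t)\<close> only eventually.\<close>

lemma derivative_along_curve:
  assumes A: "smooth_manifold A" and U: "(U, \<phi>) \<in> A" "c 0 \<in> U"
    and c: "isCont c 0" "((\<lambda>t. \<phi> (c t)) has_vector_derivative v) (at 0)"
    and F: "((\<lambda>y. F (inv_into U \<phi> y)) has_derivative D) (at (\<phi> (c 0)))"
  shows "((\<lambda>t. F (c t)) has_vector_derivative D v) (at 0)"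
proof -
  have "((\<lambda>t. F (inv_into U \<phi> (\<phi> (c t)))) has_derivative (\<lambda>h. D (h *\<^sub>R v))) (at 0)"
    by (rule has_derivative_compose[OF c(2)[unfolded has_vector_derivative_def] F])
  moreover have "\<forall>\<^sub>F t in at 0. F (inv_into U \<phi> (\<phi> (c t))) = F (c t)"
  proof -
    have "(c \<longlongrightarrow> c 0) (at 0)" using c(1) by (simp add: isCont_def)
    then have "\<forall>\<^sub>F t in at 0. c t \<in> U"
      using topological_tendstoD manifold_chart(1)[OF A U(1)] U(2) by blast
    then show ?thesis by eventually_elim (simp add: chart_inverse[OF A U(1)])
  qed
  moreover have "F (inv_into U \<phi> (\<phi> (c 0))) = F (c 0)" by (simp add: chart_inverse[OF A U])
  ultimately have "((\<lambda>t. F (c t)) has_derivative (\<lambda>h. D (h *\<^sub>R v))) (at 0)"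
    by (rule has_derivative_transform_eventually) simp
  then show ?thesis
    unfolding has_vector_derivative_def by (simp add: linear_scale[OF has_derivative_linear[OF F]])
qed

lemma smooth_on_has_derivative:
  assumes "open S" "smooth_on S f" "x \<in> S"
  obtains D where "(f has_derivative D) (at x)"
proof -
  obtain f' where "\<forall>x\<in>S. (f has_derivative f' x) (at x)" by (rule smooth_on_derivative[OF assms(1,2)])
  then show ?thesis using that assms(3) by blast
qed

lemma curve_at_chart:
  assumes A: "smooth_manifold A" and c: "curve_at A c p" and U: "(U, \<phi>) \<in> A" "p \<in> U"
  obtains v where "((\<lambda>t. \<phi> (c t)) has_vector_derivative v) (at 0)"
proof -
  from c have c0: "c 0 = p" "isCont c 0" unfolding curve_at_def by blast+
  from c obtain V \<psi> where V: "(V, \<psi>) \<in> A" "p \<in> V" "(\<psi> \<circ> c) differentiable (at 0)"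
    unfolding curve_at_def by blast
  have "((\<lambda>t. \<psi> (c t)) has_vector_derivative vector_derivative (\<psi> \<circ> c) (at 0)) (at 0)"
    using V(3) vector_derivative_works[of "\<psi> \<circ> c" "at 0"] unfolding o_def by blast
  note d = this
  have op: "open (\<psi> ` (V \<inter> U))" using chart_open_image[OF A V(1), of "V \<inter> U"]
      manifold_chart(1)[OF A V(1)] manifold_chart(1)[OF A U(1)] by auto
  have "\<psi> p \<in> \<psi> ` (V \<inter> U)" using V U by blast
  then obtain D where "((\<lambda>y. \<phi> (inv_into V \<psi> y)) has_derivative D) (at (\<psi> p))"
    using smooth_on_has_derivative[OF op manifold_transition[OF A V(1) U(1)]] by blast
  then have "((\<lambda>y. \<phi> (inv_into V \<psi> y)) has_derivative D) (at (\<psi> (c 0)))" by (simp only: c0)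
  from derivative_along_curve[OF A V(1) _ c0(2) d this] V(2) c0(1) that show ?thesis by blast
qed

lemma curve_atI:
  assumes "(U, \<phi>) \<in> A" "p \<in> U" "c 0 = p" "isCont c 0" "((\<lambda>t. \<phi> (c t)) has_vector_derivative v) (at 0)"
  shows "curve_at A c p"
proof -
  have "(\<phi> \<circ> c) differentiable (at 0)"
    using differentiableI_vector[OF assms(5)] by (simp add: o_def)
  then show ?thesis using assms unfolding curve_at_def by blast
qed

lemma curve_at_0: "curve_at A c p \<Longrightarrow> c 0 = p" and curve_at_isCont: "curve_at A c p \<Longrightarrow> isCont c 0"
  unfolding curve_at_def by blast+

lemma curve_at_eventually:
  assumes "curve_at A c p" "eventually P (nhds p)"
  shows "\<forall>\<^sub>F t in nhds 0. P (c t)"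
  using curve_at_isCont[OF assms(1)] assms(2) curve_at_0[OF assms(1)]
  by (metis eventually_compose_filterlim isCont_def tendsto_at_iff_tendsto_nhds)

lemma curve_at_compose:
  assumes A: "smooth_manifold A" and B: "smooth_manifold B"
    and c: "curve_at A c p" and f: "smooth_at A B f p"
  shows "curve_at B (\<lambda>t. f (c t)) (f p)"
proof -
  obtain U \<phi> where U: "(U, \<phi>) \<in> A" "p \<in> U" using manifold_chart_at[OF A] by blast
  obtain V \<psi> where V: "(V, \<psi>) \<in> B" "f p \<in> V" using manifold_chart_at[OF B] by blast
  obtain v where v: "((\<lambda>t. \<phi> (c t)) has_vector_derivative v) (at 0)" by (rule curve_at_chart[OF A c U])
  obtain W where W: "open W" "p \<in> W" "W \<subseteq> U" "f ` W \<subseteq> V"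
    "smooth_on (\<phi> ` W) (\<lambda>y. \<psi> (f (inv_into U \<phi> y)))"
    using smooth_at_charts[OF A B f U V] by blast
  obtain D where "((\<lambda>y. \<psi> (f (inv_into U \<phi> y))) has_derivative D) (at (\<phi> p))"
    using smooth_on_has_derivative[OF chart_open_image[OF A U(1) W(1,3)] W(5)] W(2) by blast
  then have D: "((\<lambda>y. \<psi> (f (inv_into U \<phi> y))) has_derivative D) (at (\<phi> (c 0)))"
    by (simp only: curve_at_0[OF c])
  have c0: "c 0 \<in> U" using U(2) curve_at_0[OF c] by simp
  have "((\<lambda>t. \<psi> (f (c t))) has_vector_derivative D v) (at 0)"
    by (rule derivative_along_curve[OF A U(1) c0 curve_at_isCont[OF c] v D])
  moreover have "isCont (\<lambda>t. f (c t)) 0"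
    by (rule isCont_o2[OF curve_at_isCont[OF c]]) (simp add: curve_at_0[OF c] smooth_at_isCont[OF A B f])
  ultimately show ?thesis using curve_at_0[OF c] by (intro curve_atI[OF V]) simp_all
qed

lemma curve_at_cong:
  assumes A: "smooth_manifold A" and c: "curve_at A c p" and eq: "\<forall>\<^sub>F t in nhds 0. c t = d t"
  shows "curve_at A d p"
proof -
  obtain U \<phi> where U: "(U, \<phi>) \<in> A" "p \<in> U" using manifold_chart_at[OF A] by blast
  obtain v where v: "((\<lambda>t. \<phi> (c t)) has_vector_derivative v) (at 0)" by (rule curve_at_chart[OF A c U])
  have 0: "c 0 = d 0" using eq by (rule eventually_nhds_x_imp_x)
  have "isCont d 0" using isCont_cong[OF eq] curve_at_isCont[OF c] by simp
  moreover have "((\<lambda>t. \<phi> (d t)) has_vector_derivative v) (at 0)"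
    unfolding has_vector_derivative_def
  proof (rule has_derivative_transform_eventually[OF v[unfolded has_vector_derivative_def]])
    have "\<forall>\<^sub>F t in nhds 0. \<phi> (c t) = \<phi> (d t)" using eq by eventually_elim simp
    then show "\<forall>\<^sub>F t in at 0. \<phi> (c t) = \<phi> (d t)" unfolding eventually_at_filter by eventually_elim simp
  qed (use 0 in auto)
  ultimately show ?thesis using 0 curve_at_0[OF c] by (intro curve_atI[OF U]) simp_all
qed

lemma curve_at_const: "smooth_manifold A \<Longrightarrow> curve_at A (\<lambda>_. p) p"
  by (rule manifold_chart_at[of A p])
    (auto intro!: curve_atI[where v=0] has_vector_derivative_const)

lemma velocity_cong:
  assumes eq: "\<forall>\<^sub>F t in nhds 0. c t = d t"
  shows "velocity A c = velocity A d"
proof -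
  have 0: "c 0 = d 0" using eq by (rule eventually_nhds_x_imp_x)
  have "deriv (h \<circ> c) 0 = deriv (h \<circ> d) 0" for h
    using eq by (intro deriv_cong_ev) (auto elim: eventually_mono)
  then show ?thesis unfolding velocity_def by (intro ext) (simp add: 0)
qed

lemma velocity_not_smooth:
  "\<not> smooth_at A real_atlas h (c 0) \<Longrightarrow> velocity A c h = 0"
  unfolding velocity_def by simp

lemma velocity_eqI:
  assumes "smooth_at A real_atlas h (c 0)" "((\<lambda>t. h (c t)) has_real_derivative d) (at 0)"
  shows "velocity A c h = d"
  using assms DERIV_imp_deriv[of "h \<circ> c"] unfolding velocity_def o_def by simp

section \<open>Tangent vectors and differentials\<close>

lemma smooth_at_has_derivative:
  assumes A: "smooth_manifold A" and h: "smooth_at A real_atlas h p" and U: "(U, \<phi>) \<in> A" "p \<in> U"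
  obtains D where "((\<lambda>y. h (inv_into U \<phi> y)) has_derivative D) (at (\<phi> p))"
proof -
  obtain W where W: "open W" "p \<in> W" "W \<subseteq> U" "smooth_on (\<phi> ` W) (\<lambda>y. h (inv_into U \<phi> y))"
    by (rule smooth_at_real_charts[OF A h U])
  from W(2) have "\<phi> p \<in> \<phi> ` W" by blast
  from smooth_on_has_derivative[OF chart_open_image[OF A U(1) W(1,3)] W(4) this]
  show ?thesis using that by blast
qed

text \<open>Curves are differentiable at 0 only, but this is enough for the \<open>deriv\<close> in
  \<open>velocity\<close> to be a genuine derivative on smooth functions.\<close>

lemma velocity_has_derivative:
  assumes A: "smooth_manifold A" and c: "curve_at A c p" and h: "smooth_at A real_atlas h p"
  shows "((\<lambda>t. h (c t)) has_real_derivative velocity A c h) (at 0)"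
proof -
  obtain U \<phi> where U: "(U, \<phi>) \<in> A" "p \<in> U" using manifold_chart_at[OF A] by blast
  obtain v where v: "((\<lambda>t. \<phi> (c t)) has_vector_derivative v) (at 0)" by (rule curve_at_chart[OF A c U])
  obtain D where D: "((\<lambda>y. h (inv_into U \<phi> y)) has_derivative D) (at (\<phi> p))"
    by (rule smooth_at_has_derivative[OF A h U])
  have "((\<lambda>t. h (c t)) has_real_derivative D v) (at 0)"
    unfolding has_real_derivative_iff_has_vector_derivative
    by (rule derivative_along_curve[OF A U(1) _ curve_at_isCont[OF c] v])
      (simp_all add: curve_at_0[OF c] U D)
  then show ?thesis using velocity_eqI[of A h c "D v"] h curve_at_0[OF c] by simp
qed

lemma velocity_const:
  assumes "smooth_manifold A"
  shows "velocity A (\<lambda>_. p) = 0"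
proof
  fix h
  have "((\<lambda>t. h p) has_real_derivative 0) (at 0)" by (rule DERIV_const)
  then show "velocity A (\<lambda>_. p) h = 0 h"
    by (cases "smooth_at A real_atlas h p") (simp_all add: velocity_eqI velocity_not_smooth)
qed

lemma tangent_spaceI: "curve_at A c p \<Longrightarrow> velocity A c \<in> tangent_space A p"
  unfolding tangent_space_def by blast

lemma tangent_spaceE:
  assumes "X \<in> tangent_space A p"
  obtains c where "curve_at A c p" "velocity A c = X"
  using assms unfolding tangent_space_def by blast

lemma tangent_vector_not_smooth:
  assumes "X \<in> tangent_space A p" "\<not> smooth_at A real_atlas h p"
  shows "X h = 0"
proof -
  obtain c where "curve_at A c p" "velocity A c = X" using assms(1) by (rule tangent_spaceE)
  then show ?thesis using velocity_not_smooth[of A h c] assms(2) curve_at_0 by metis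
qed

text \<open>The differential as an explicit operation on derivations, which is visibly linear,
  whereas \<open>diff_on\<close> is a definite description over curves. The guard matches the value
  0 that \<open>velocity\<close> assigns to functions that are not smooth at the point.\<close>

definition push :: "('b::topological_space, 'f::real_normed_vector) atlas \<Rightarrow> ('a \<Rightarrow> 'b) \<Rightarrow> 'a \<Rightarrow>
    'a tvec \<Rightarrow> 'b tvec"
  where "push B f p X = (\<lambda>h. if smooth_at B real_atlas h (f p) then X (\<lambda>x. h (f x)) else 0)"

lemma push_add: "push B f p (X + Y) = push B f p X + push B f p Y"
  and push_scaleR: "push B f p (r *\<^sub>R X) = r *\<^sub>R push B f p X"
  and push_zero: "push B f p 0 = 0"
  and push_minus: "push B f p (- X) = - push B f p X"
  and push_diff: "push B f p (X - Y) = push B f p X - push B f p Y"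
  unfolding push_def by (auto simp: scaleR_fun_def)

lemma velocity_compose:
  assumes A: "smooth_manifold A" and B: "smooth_manifold B"
    and c: "curve_at A c p" and f: "smooth_at A B f p"
  shows "velocity B (\<lambda>t. f (c t)) = push B f p (velocity A c)"
proof
  fix h
  show "velocity B (\<lambda>t. f (c t)) h = push B f p (velocity A c) h"
  proof (cases "smooth_at B real_atlas h (f p)")
    case True
    have "smooth_at A real_atlas (\<lambda>x. h (f x)) p"
      by (rule smooth_at_compose[OF A B smooth_manifold_real f True])
    from velocity_has_derivative[OF A c this] True
    show ?thesis unfolding push_def by (intro velocity_eqI) (simp_all add: curve_at_0[OF c])
  next
    case False
    then show ?thesis unfolding push_def using velocity_not_smooth[of B h "\<lambda>t. f (c t)"]
      by (simp add: curve_at_0[OF c])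
  qed
qed

lemma push_tangent:
  assumes A: "smooth_manifold A" and B: "smooth_manifold B"
    and f: "smooth_at A B f p" and X: "X \<in> tangent_space A p"
  shows "push B f p X \<in> tangent_space B (f p)"
proof -
  obtain c where c: "curve_at A c p" "velocity A c = X" using X by (rule tangent_spaceE)
  from tangent_spaceI[OF curve_at_compose[OF A B c(1) f]] show ?thesis
    by (simp add: velocity_compose[OF A B c(1) f] c(2))
qed

lemma push_compose:
  assumes B: "smooth_manifold B" and C: "smooth_manifold C" and g: "smooth_at B C g (f p)"
  shows "push C g (f p) (push B f p X) = push C (\<lambda>x. g (f x)) p X"
  unfolding push_def using smooth_at_compose[OF B C smooth_manifold_real g] by auto

text \<open>Along a curve in \<open>S\<close> the map \<open>f\<close> agrees with its extension
  \<open>F\<close>, so the velocity of the image depends only on \<open>X\<close>. Hence the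
  definite description in \<open>diff_on\<close> is well defined as soon as one such curve
  exists.\<close>

lemma diff_on_eq_push:
  assumes A: "smooth_manifold A" and B: "smooth_manifold B"
    and F: "smooth_at A B F p" and eq: "\<forall>\<^sub>F x in nhds p. x \<in> S \<longrightarrow> F x = f x"
    and c: "curve_at A c p" "\<forall>\<^sub>F t in nhds 0. c t \<in> S" "velocity A c = X"
  shows "diff_on A B S f p X = push B F p X"
  unfolding diff_on_def
proof (rule the_equality)
  have vel: "velocity B (f \<circ> d) = push B F p X"
    if d: "curve_at A d p" "\<forall>\<^sub>F t in nhds 0. d t \<in> S" "velocity A d = X" for d
  proof -
    have "\<forall>\<^sub>F t in nhds 0. F (d t) = (f \<circ> d) t"
      using curve_at_eventually[OF d(1) eq] d(2) by eventually_elim simp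
    from velocity_cong[OF this, of B] show ?thesis
      unfolding velocity_compose[OF A B d(1) F] d(3) by (simp add: o_def)
  qed
  show "\<exists>c. curve_at A c p \<and> (\<forall>\<^sub>F t in nhds 0. c t \<in> S) \<and> velocity A c = X \<and>
    velocity B (f \<circ> c) = push B F p X"
    using c vel by blast
  show "w = push B F p X" if "\<exists>c. curve_at A c p \<and> (\<forall>\<^sub>F t in nhds 0. c t \<in> S) \<and> velocity A c = X \<and>
    velocity B (f \<circ> c) = w" for w
    using that vel by blast
qed

lemma diff_eq_push:
  assumes A: "smooth_manifold A" and B: "smooth_manifold B"
    and f: "smooth_at A B f p" and X: "X \<in> tangent_space A p"
  shows "diff A B f p X = push B f p X"
proof -
  obtain c where c: "curve_at A c p" "velocity A c = X" using X by (rule tangent_spaceE)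
  show ?thesis by (rule diff_on_eq_push[OF A B f _ c(1) _ c(2)]) simp_all
qed

section \<open>Coordinate vectors and tangent spaces in a chart\<close>

lemma coord_curve:
  fixes A :: "('a::{t2_space,second_countable_topology}, 'e::banach) atlas" and v :: 'e
  assumes A: "smooth_manifold A" and U: "(U, \<phi>) \<in> A" "p \<in> U"
  defines "c \<equiv> \<lambda>t::real. inv_into U \<phi> (\<phi> p + t *\<^sub>R v)"
  shows "curve_at A c p" and "((\<lambda>t. \<phi> (c t)) has_vector_derivative v) (at 0)"
proof -
  have c0: "c 0 = p" unfolding c_def using chart_inverse[OF A U] by simp
  have line: "((\<lambda>t. \<phi> p + t *\<^sub>R v) has_vector_derivative v) (at 0)"
    by (auto intro!: derivative_eq_intros)
  have contl: "isCont (\<lambda>t. \<phi> p + t *\<^sub>R v) 0" using line by (rule has_vector_derivative_continuous)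
  then have "((\<lambda>t. \<phi> p + t *\<^sub>R v) \<longlongrightarrow> \<phi> p) (at 0)" unfolding isCont_def by simp
  from topological_tendstoD[OF this manifold_chart(2)[OF A U(1)]] U(2)
  have ev: "\<forall>\<^sub>F t in at 0. \<phi> p + t *\<^sub>R v = \<phi> (c t)"
    unfolding c_def by (auto elim!: eventually_mono simp: f_inv_into_f)
  show d: "((\<lambda>t. \<phi> (c t)) has_vector_derivative v) (at 0)"
    unfolding has_vector_derivative_def
    by (rule has_derivative_transform_eventually[OF line[unfolded has_vector_derivative_def] ev])
      (simp_all add: c0)
  have "isCont (inv_into U \<phi>) (\<phi> p)" by (rule chart_inverse_isCont[OF A U])
  then have "isCont c 0" unfolding c_def by (intro isCont_o2[OF contl]) simp
  then show "curve_at A c p" using d by (rule curve_atI[where c=c and p=p and v=v, OF U c0])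
qed

lemma coord_vec_eval:
  assumes A: "smooth_manifold A" and U: "(U, \<phi>) \<in> A" "p \<in> U" and h: "smooth_at A real_atlas h p"
    and D: "((\<lambda>y. h (inv_into U \<phi> y)) has_derivative D) (at (\<phi> p))"
  shows "coord_vec A U \<phi> p v h = D v"
proof -
  note c = coord_curve[OF A U, of v]
  note c0 = curve_at_0[OF c(1)]
  have "((\<lambda>t. h (inv_into U \<phi> (\<phi> p + t *\<^sub>R v))) has_real_derivative D v) (at 0)"
    unfolding has_real_derivative_iff_has_vector_derivative
    by (rule derivative_along_curve[OF A U(1) _ curve_at_isCont[OF c(1)] c(2)])
      (simp_all only: c0 U D)
  then show ?thesis unfolding coord_vec_def by (intro velocity_eqI) (simp_all only: c0 h)
qed

text \<open>A derivation sees of a curve only its velocity in the chart, so the straight line with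
  that velocity represents the same vector. This is why tangent spaces are linear images of the
  model space.\<close>

lemma velocity_eq_coord_vec:
  assumes A: "smooth_manifold A" and U: "(U, \<phi>) \<in> A" "p \<in> U"
    and c: "curve_at A c p" "((\<lambda>t. \<phi> (c t)) has_vector_derivative v) (at 0)"
  shows "velocity A c = coord_vec A U \<phi> p v"
proof
  fix h
  show "velocity A c h = coord_vec A U \<phi> p v h"
  proof (cases "smooth_at A real_atlas h p")
    case True
    obtain D where D: "((\<lambda>y. h (inv_into U \<phi> y)) has_derivative D) (at (\<phi> p))"
      by (rule smooth_at_has_derivative[OF A True U])
    have "((\<lambda>t. h (c t)) has_real_derivative D v) (at 0)"
      unfolding has_real_derivative_iff_has_vector_derivative
      by (rule derivative_along_curve[OF A U(1) _ curve_at_isCont[OF c(1)] c(2)])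
        (simp_all only: curve_at_0[OF c(1)] U D)
    then show ?thesis
      using velocity_eqI[of A h c "D v"] coord_vec_eval[OF A U True D] True curve_at_0[OF c(1)] by simp
  next
    case False
    then show ?thesis
      using tangent_vector_not_smooth[OF tangent_spaceI[OF c(1)] False]
        tangent_vector_not_smooth[OF tangent_spaceI[OF coord_curve(1)[OF A U]] False]
      unfolding coord_vec_def by simp
  qed
qed

lemma coord_vec_tangent:
  assumes "smooth_manifold A" "(U, \<phi>) \<in> A" "p \<in> U"
  shows "coord_vec A U \<phi> p v \<in> tangent_space A p"
  unfolding coord_vec_def by (rule tangent_spaceI[OF coord_curve(1)[OF assms]])

lemma tangent_space_chart:
  assumes A: "smooth_manifold A" and U: "(U, \<phi>) \<in> A" "p \<in> U"
  shows "tangent_space A p = range (coord_vec A U \<phi> p)"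
proof (intro subset_antisym subsetI)
  fix X assume "X \<in> tangent_space A p"
  then obtain c where c: "curve_at A c p" "velocity A c = X" by (rule tangent_spaceE)
  obtain v where v: "((\<lambda>t. \<phi> (c t)) has_vector_derivative v) (at 0)" by (rule curve_at_chart[OF A c(1) U])
  show "X \<in> range (coord_vec A U \<phi> p)"
    using velocity_eq_coord_vec[OF A U c(1) v] c(2) by simp
qed (use coord_vec_tangent[OF A U] in blast)

lemma linear_coord_vec:
  assumes A: "smooth_manifold A" and U: "(U, \<phi>) \<in> A" "p \<in> U"
  shows "linear (coord_vec A U \<phi> p)"
proof -
  have "coord_vec A U \<phi> p (v + w) h = coord_vec A U \<phi> p v h + coord_vec A U \<phi> p w h \<and>
    coord_vec A U \<phi> p (r *\<^sub>R v) h = r * coord_vec A U \<phi> p v h" for v w r h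
  proof (cases "smooth_at A real_atlas h p")
    case True
    obtain D where D: "((\<lambda>y. h (inv_into U \<phi> y)) has_derivative D) (at (\<phi> p))"
      by (rule smooth_at_has_derivative[OF A True U])
    note lin = has_derivative_linear[OF D]
    show ?thesis unfolding coord_vec_eval[OF A U True D] by (simp add: linear_add[OF lin] linear_scale[OF lin])
  next
    case False
    show ?thesis by (simp add: tangent_vector_not_smooth[OF coord_vec_tangent[OF A U] False])
  qed
  then show ?thesis by (intro linearI ext) (simp_all add: scaleR_fun_def)
qed

lemma subspace_tangent_space:
  assumes A: "smooth_manifold A"
  shows "subspace (tangent_space A p)"
proof -
  obtain U \<phi> where U: "(U, \<phi>) \<in> A" "p \<in> U" using manifold_chart_at[OF A] by blast
  show ?thesis unfolding tangent_space_chart[OF A U]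
    by (rule linear_subspace_image[OF linear_coord_vec[OF A U] subspace_UNIV])
qed

lemma coord_vec_coordinate:
  assumes A: "smooth_manifold (A :: ('a::{t2_space,second_countable_topology}, 'e::banach) atlas)"
    and U: "(U, \<phi>) \<in> A" "p \<in> U" and l: "linear (l :: 'e \<Rightarrow> real)"
  shows "coord_vec A U \<phi> p v (\<lambda>x. l (\<phi> x)) = l v"
proof (rule coord_vec_eval[OF A U smooth_at_chart_coordinate[OF A U l]])
  have "(l has_derivative l) (at (\<phi> p))"
    by (rule bounded_linear_imp_has_derivative[OF
        linear_imp_bounded_linear[OF manifold_finite_dimensional[OF A] l]])
  then show "((\<lambda>y. l (\<phi> (inv_into U \<phi> y))) has_derivative l) (at (\<phi> p))"
    by (rule has_derivative_transform_within_open[OF _ manifold_chart(2)[OF A U(1)]])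
      (use U(2) in \<open>auto simp: chart_inverse[OF A U(1)]\<close>)
qed

text \<open>The total derivative is the sum of the partial ones: in a product chart
  \<open>D (v, w) = D (v, 0) + D (0, w)\<close>, and each summand is the velocity with the other
  variable frozen.\<close>

lemma velocity_product_rule:
  assumes A: "smooth_manifold A" and B: "smooth_manifold B" and C: "smooth_manifold C"
    and F: "smooth_at (prod_atlas A B) C F (g, h)"
    and c: "curve_at A c g" and d: "curve_at B d h"
  shows "velocity C (\<lambda>t. F (c t, d t)) =
    push C (\<lambda>x. F (x, h)) g (velocity A c) + push C (\<lambda>y. F (g, y)) h (velocity B d)"
proof
  fix k
  note P = smooth_manifold_prod[OF A B]
  note c0 = curve_at_0[OF c] curve_at_0[OF d]
  show "velocity C (\<lambda>t. F (c t, d t)) k =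
    (push C (\<lambda>x. F (x, h)) g (velocity A c) + push C (\<lambda>y. F (g, y)) h (velocity B d)) k"
  proof (cases "smooth_at C real_atlas k (F (g, h))")
    case True
    have K: "smooth_at (prod_atlas A B) real_atlas (\<lambda>z. k (F z)) (g, h)"
      by (rule smooth_at_compose[OF P C smooth_manifold_real F True])
    obtain U \<phi> where U: "(U, \<phi>) \<in> A" "g \<in> U" using manifold_chart_at[OF A] by blast
    obtain V \<psi> where V: "(V, \<psi>) \<in> B" "h \<in> V" using manifold_chart_at[OF B] by blast
    obtain v where v: "((\<lambda>t. \<phi> (c t)) has_vector_derivative v) (at 0)" by (rule curve_at_chart[OF A c U])
    obtain w where w: "((\<lambda>t. \<psi> (d t)) has_vector_derivative w) (at 0)" by (rule curve_at_chart[OF B d V])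
    note pc = prod_atlasI[OF U(1) V(1)]
    have gh: "(g, h) \<in> U \<times> V" using U V by simp
    obtain D where D: "((\<lambda>y. k (F (inv_into (U \<times> V) (map_prod \<phi> \<psi>) y))) has_derivative D)
        (at (map_prod \<phi> \<psi> (g, h)))"
      by (rule smooth_at_has_derivative[OF P K pc gh])
    have along: "((\<lambda>t. k (F (c' t, d' t))) has_real_derivative D (v', w')) (at 0)"
      if c': "c' 0 = g" "isCont c' 0" "((\<lambda>t. \<phi> (c' t)) has_vector_derivative v') (at 0)"
      and d': "d' 0 = h" "isCont d' 0" "((\<lambda>t. \<psi> (d' t)) has_vector_derivative w') (at 0)"
      for c' d' v' w'
    proof -
      have cont: "isCont (\<lambda>t. (c' t, d' t)) 0" using c'(2) d'(2) by (rule isCont_Pair)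
      have "((\<lambda>t. (\<phi> (c' t), \<psi> (d' t))) has_vector_derivative (v', w')) (at 0)"
        using c'(3) d'(3) by (rule has_vector_derivative_Pair)
      then have der: "((\<lambda>t. map_prod \<phi> \<psi> (c' t, d' t)) has_vector_derivative (v', w')) (at 0)"
        by simp
      show ?thesis unfolding has_real_derivative_iff_has_vector_derivative
        by (rule derivative_along_curve[OF P pc _ cont der])
          (simp_all only: c'(1) d'(1) gh D)
    qed
    have "velocity C (\<lambda>t. F (c t, d t)) k = D (v, w)"
      using along[OF c0(1) curve_at_isCont[OF c] v c0(2) curve_at_isCont[OF d] w] True
      by (intro velocity_eqI) (simp_all add: c0)
    moreover have "velocity A c (\<lambda>x. k (F (x, h))) = D (v, 0)"
    proof (rule velocity_eqI)
      show "smooth_at A real_atlas (\<lambda>x. k (F (x, h))) (c 0)" unfolding c0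
        by (rule smooth_at_compose[OF A P smooth_manifold_real
            smooth_at_Pair[OF A A B smooth_at_ident[OF A] smooth_at_const[OF A B]] K])
      show "((\<lambda>t. k (F (c t, h))) has_real_derivative D (v, 0)) (at 0)"
        by (rule along[OF c0(1) curve_at_isCont[OF c] v])
          (simp_all add: has_vector_derivative_const)
    qed
    moreover have "velocity B d (\<lambda>y. k (F (g, y))) = D (0, w)"
    proof (rule velocity_eqI)
      show "smooth_at B real_atlas (\<lambda>y. k (F (g, y))) (d 0)" unfolding c0
        by (rule smooth_at_compose[OF B P smooth_manifold_real
            smooth_at_Pair[OF B A B smooth_at_const[OF B A] smooth_at_ident[OF B]] K])
      show "((\<lambda>t. k (F (g, d t))) has_real_derivative D (0, w)) (at 0)"
        by (rule along[OF _ _ _ c0(2) curve_at_isCont[OF d] w])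
          (simp_all add: has_vector_derivative_const)
    qed
    moreover have "D (v, w) = D (v, 0) + D (0, w)"
      by (simp flip: linear_add[OF has_derivative_linear[OF D]])
    ultimately show ?thesis using True unfolding push_def by simp
  next
    case False
    then show ?thesis unfolding push_def using velocity_not_smooth[of C k "\<lambda>t. F (c t, d t)"]
      by (simp add: c0)
  qed
qed

text \<open>All coefficients in the smoothness proof have this shape: a derivative in the first
  variable, with the parameter \<open>x\<close> entering through the second variable and through the
  base point. In a product chart it is the smooth function \<open>K' y (w, 0)\<close> evaluated
  along \<open>(\<zeta> x, x)\<close>.\<close>

lemma coord_vec_parameter_smooth:
  assumes A: "smooth_manifold A" and B: "smooth_manifold B"
    and K: "smooth_at (prod_atlas A B) real_atlas K (\<zeta> x0, x0)" and \<zeta>: "smooth_at B A \<zeta> x0"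
    and V: "(V, \<psi>) \<in> A" "\<zeta> x0 \<in> V"
  shows "smooth_at B real_atlas (\<lambda>x. coord_vec A V \<psi> (\<zeta> x) w (\<lambda>k. K (k, x))) x0"
proof -
  note P = smooth_manifold_prod[OF A B]
  obtain U \<phi> where U: "(U, \<phi>) \<in> B" "x0 \<in> U" using manifold_chart_at[OF B] by blast
  note pc = prod_atlasI[OF V(1) U(1)]
  have z0: "(\<zeta> x0, x0) \<in> V \<times> U" using U V by simp
  obtain W where W: "open W" "(\<zeta> x0, x0) \<in> W" "W \<subseteq> V \<times> U"
    "smooth_on (map_prod \<psi> \<phi> ` W) (\<lambda>y. K (inv_into (V \<times> U) (map_prod \<psi> \<phi>) y))"
    by (rule smooth_at_real_charts[OF P K pc z0])
  note opW = chart_open_image[OF P pc W(1,3)]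
  obtain K' where K': "\<forall>y\<in>map_prod \<psi> \<phi> ` W.
      ((\<lambda>y. K (inv_into (V \<times> U) (map_prod \<psi> \<phi>) y)) has_derivative K' y) (at y)"
    "\<forall>v. smooth_on (map_prod \<psi> \<phi> ` W) (\<lambda>y. K' y v)"
    by (rule smooth_on_derivative[OF opW W(4)])
  have "smooth_on (map_prod \<psi> \<phi> ` W) (\<lambda>y. K' y (w, 0))" using K'(2) by blast
  from smooth_at_chart_comp[OF P pc z0 this W(1-3)]
  have "smooth_at (prod_atlas A B) real_atlas (\<lambda>z. K' (map_prod \<psi> \<phi> z) (w, 0)) (\<zeta> x0, x0)" .
  note s = this
  have pair: "smooth_at B (prod_atlas A B) (\<lambda>x. (\<zeta> x, x)) x0"
    by (rule smooth_at_Pair[OF B A B \<zeta> smooth_at_ident[OF B]])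
  from smooth_at_compose[OF B P smooth_manifold_real this s]
  have "smooth_at B real_atlas (\<lambda>x. K' (map_prod \<psi> \<phi> (\<zeta> x, x)) (w, 0)) x0" .
  moreover have "\<forall>\<^sub>F x in nhds x0. K' (map_prod \<psi> \<phi> (\<zeta> x, x)) (w, 0) =
      coord_vec A V \<psi> (\<zeta> x) w (\<lambda>k. K (k, x))"
  proof -
    have ev: "\<forall>\<^sub>F z in nhds (\<zeta> x0, x0). smooth_at (prod_atlas A B) real_atlas K z \<and> z \<in> W"
      using smooth_at_eventually[OF K] eventually_nhds_in_open[OF W(1,2)] by (rule eventually_conj)
    from smooth_at_tendsto[OF B P pair ev] show ?thesis
    proof eventually_elim
      case (elim x)
      then have x: "\<zeta> x \<in> V" "x \<in> U" using W(3) by auto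
      have s: "smooth_at A real_atlas (\<lambda>k. K (k, x)) (\<zeta> x)"
        by (rule smooth_at_compose[OF A P smooth_manifold_real
            smooth_at_Pair[OF A A B smooth_at_ident[OF A] smooth_at_const[OF A B]]])
          (use elim in blast)
      have D: "((\<lambda>y. K (inv_into (V \<times> U) (map_prod \<psi> \<phi>) y)) has_derivative K' (\<psi> (\<zeta> x), \<phi> x))
        (at (\<psi> (\<zeta> x), \<phi> x))"
        using K'(1)[rule_format, OF imageI[OF conjunct2[OF elim]]] by simp
      have "((\<lambda>y. (y, \<phi> x)) has_derivative (\<lambda>v. (v, 0))) (at (\<psi> (\<zeta> x)))"
        by (intro has_derivative_Pair has_derivative_ident has_derivative_const)
      from has_derivative_compose[OF this D]
      have d1: "((\<lambda>y. K (inv_into (V \<times> U) (map_prod \<psi> \<phi>) (y, \<phi> x))) has_derivative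
        (\<lambda>v. K' (\<psi> (\<zeta> x), \<phi> x) (v, 0))) (at (\<psi> (\<zeta> x)))" .
      have eq: "K (inv_into (V \<times> U) (map_prod \<psi> \<phi>) (y, \<phi> x)) = K (inv_into V \<psi> y, x)"
        if "y \<in> \<psi> ` V" for y
        by (subst inv_into_map_prod[OF chart_inj[OF A V(1)] chart_inj[OF B U(1)] that])
          (simp_all add: x chart_inverse[OF B U(1)])
      have "((\<lambda>y. K (inv_into V \<psi> y, x)) has_derivative
        (\<lambda>v. K' (\<psi> (\<zeta> x), \<phi> x) (v, 0))) (at (\<psi> (\<zeta> x)))"
        by (rule has_derivative_transform_within_open[OF d1 manifold_chart(2)[OF A V(1)] imageI[OF x(1)]])
          (rule eq)
      from coord_vec_eval[OF A V(1) x(1) s this] show ?case by simp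
    qed
  qed
  ultimately show ?thesis by (rule smooth_at_cong[OF B])
qed

section \<open>Fibres of submersions; multilinear expansion\<close>

text \<open>Coordinate functions separate the vectors of the model space, so its identification with
  the tangent space is injective.\<close>

lemma coord_vec_eq_0:
  assumes A: "smooth_manifold (A :: ('a::{t2_space,second_countable_topology}, 'e::banach) atlas)"
    and U: "(U, \<phi>) \<in> A" "p \<in> U" and v: "coord_vec A U \<phi> p v = 0"
  shows "v = 0"
proof -
  obtain B :: "'e set" and r where B: "finite B" "\<forall>b. bounded_linear (r b)"
    "\<forall>v. (\<Sum>b\<in>B. r b v *\<^sub>R b) = v"
    using finite_dimensional_coordinates[OF manifold_finite_dimensional[OF A]] by blast
  have "r b v = 0" for b
    using coord_vec_coordinate[OF A U bounded_linear.linear[OF B(2)[rule_format, of b]], of v] v by simp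
  then show ?thesis using B(3)[rule_format, of v] by simp
qed

text \<open>The section \<open>\<sigma>\<close> supplies what the level set lemma needs:
  differentiating \<open>f (\<sigma> y) = y\<close> in charts yields a bounded right inverse of the
  derivative of \<open>f\<close> at \<open>p\<close>.\<close>

lemma curve_in_fibre:
  fixes A :: "('a::{t2_space,second_countable_topology}, 'e::banach) atlas"
    and M :: "('b::{t2_space,second_countable_topology}, 'f::banach) atlas"
  assumes A: "smooth_manifold A" and M: "smooth_manifold M"
    and f: "smooth_at A M f p" and \<sigma>: "smooth_at M A \<sigma> (f p)" "\<sigma> (f p) = p" "\<And>y. f (\<sigma> y) = y"
    and u: "u \<in> tangent_space A p" "push M f p u = 0"
  obtains c where "curve_at A c p" "\<forall>\<^sub>F t in nhds 0. f (c t) = f p" "velocity A c = u"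
proof -
  obtain U \<phi> where U: "(U, \<phi>) \<in> A" "p \<in> U" using manifold_chart_at[OF A] by blast
  obtain V \<psi> where V: "(V, \<psi>) \<in> M" "f p \<in> V" using manifold_chart_at[OF M] by blast
  obtain W where W: "open W" "p \<in> W" "W \<subseteq> U" "f ` W \<subseteq> V"
    "smooth_on (\<phi> ` W) (\<lambda>y. \<psi> (f (inv_into U \<phi> y)))"
    using smooth_at_charts[OF A M f U V] by blast
  note opW = chart_open_image[OF A U(1) W(1,3)]
  have pW: "\<phi> p \<in> \<phi> ` W" using W(2) by blast
  obtain D where D: "((\<lambda>y. \<psi> (f (inv_into U \<phi> y))) has_derivative D) (at (\<phi> p))"
    by (rule smooth_on_has_derivative[OF opW W(5) pW])
  obtain v where v: "u = coord_vec A U \<phi> p v" using u(1) unfolding tangent_space_chart[OF A U] by blast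
  have "coord_vec M V \<psi> (f p) (D v) = 0"
  proof -
    note k = coord_curve[OF A U, of v]
    have "((\<lambda>t. \<psi> (f (inv_into U \<phi> (\<phi> p + t *\<^sub>R v)))) has_vector_derivative D v) (at 0)"
      by (rule derivative_along_curve[OF A U(1) _ curve_at_isCont[OF k(1)] k(2)])
        (simp_all only: curve_at_0[OF k(1)] U D)
    from velocity_eq_coord_vec[OF M V curve_at_compose[OF A M k(1) f] this]
    show ?thesis using velocity_compose[OF A M k(1) f] u(2) v unfolding coord_vec_def by simp
  qed
  then have Dv: "D v = 0" by (rule coord_vec_eq_0[OF M V])
  have \<sigma>U: "\<sigma> (f p) \<in> U" using U(2) \<sigma>(2) by simp
  obtain N where N: "open N" "f p \<in> N" "N \<subseteq> V" "\<sigma> ` N \<subseteq> U"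
    "smooth_on (\<psi> ` N) (\<lambda>y. \<phi> (\<sigma> (inv_into V \<psi> y)))"
    using smooth_at_charts[OF M A \<sigma>(1) V U(1) \<sigma>U] by blast
  note opN = chart_open_image[OF M V(1) N(1,3)]
  have pN: "\<psi> (f p) \<in> \<psi> ` N" using N(2) by blast
  obtain R where R: "((\<lambda>y. \<phi> (\<sigma> (inv_into V \<psi> y))) has_derivative R) (at (\<psi> (f p)))"
    by (rule smooth_on_has_derivative[OF opN N(5) pN])
  have "\<phi> (\<sigma> (inv_into V \<psi> (\<psi> (f p)))) = \<phi> p" by (simp add: chart_inverse[OF M V] \<sigma>(2))
  with D have D': "((\<lambda>y. \<psi> (f (inv_into U \<phi> y))) has_derivative D)
      (at (\<phi> (\<sigma> (inv_into V \<psi> (\<psi> (f p))))))" by simp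
  note DR = has_derivative_compose[OF R D']
  have "((\<lambda>y. y) has_derivative (\<lambda>z. D (R z))) (at (\<psi> (f p)))"
  proof (rule has_derivative_transform_within_open[OF DR opN pN])
    fix y assume "y \<in> \<psi> ` N"
    then obtain x where x: "x \<in> N" "y = \<psi> x" by blast
    then have "x \<in> V" "\<sigma> x \<in> U" using N(3,4) by auto
    then show "\<psi> (f (inv_into U \<phi> (\<phi> (\<sigma> (inv_into V \<psi> y))))) = y"
      by (simp add: x(2) chart_inverse[OF M V(1)] chart_inverse[OF A U(1)] \<sigma>(3))
  qed
  then have "(\<lambda>z. D (R z)) = (\<lambda>z. z)" by (rule has_derivative_unique[OF _ has_derivative_ident])
  then have DRz: "D (R z) = z" for z by (rule fun_cong)
  obtain c where c: "c 0 = \<phi> p" "(c has_vector_derivative v) (at 0)"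
    "\<forall>\<^sub>F t in nhds 0. \<psi> (f (inv_into U \<phi> (c t))) = \<psi> (f (inv_into U \<phi> (\<phi> p)))"
    by (rule curve_in_level_set[OF manifold_finite_dimensional[OF A] opW pW W(5) D
          has_derivative_bounded_linear[OF R] DRz Dv])
  have contc: "isCont c 0" using c(2) by (rule has_vector_derivative_continuous)
  then have "(c \<longlongrightarrow> \<phi> p) (nhds 0)" using c(1) isCont_def tendsto_at_iff_tendsto_nhds by metis
  from topological_tendstoD[OF this opW pW] have inW: "\<forall>\<^sub>F t in nhds 0. c t \<in> \<phi> ` W" .
  define k where "k t = inv_into U \<phi> (c t)" for t
  have k0: "k 0 = p" unfolding k_def c(1) by (rule chart_inverse[OF A U])
  have \<phi>k: "\<forall>\<^sub>F t in nhds 0. c t = \<phi> (k t)" using inW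
  proof eventually_elim
    case (elim t)
    then have "c t \<in> \<phi> ` U" using W(3) by blast
    then show ?case unfolding k_def by (simp add: f_inv_into_f)
  qed
  have der: "((\<lambda>t. \<phi> (k t)) has_vector_derivative v) (at 0)"
    unfolding has_vector_derivative_def
  proof (rule has_derivative_transform_eventually[OF c(2)[unfolded has_vector_derivative_def]])
    show "\<forall>\<^sub>F t in at 0. c t = \<phi> (k t)" unfolding eventually_at_filter
      using \<phi>k by eventually_elim simp
  qed (simp_all add: c(1) k0)
  have "isCont (inv_into U \<phi>) (\<phi> p)" by (rule chart_inverse_isCont[OF A U])
  then have contk: "isCont k 0" unfolding k_def by (intro isCont_o2[OF contc]) (simp add: c(1))
  have curve: "curve_at A k p" using der by (rule curve_atI[where c=k and p=p and v=v, OF U k0 contk])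
  have "\<forall>\<^sub>F t in nhds 0. f (k t) = f p" using c(3) inW
  proof eventually_elim
    case (elim t)
    then obtain x where x: "x \<in> W" "c t = \<phi> x" by blast
    then have "x \<in> U" "f x \<in> V" using W(3,4) by auto
    moreover have "\<psi> (f x) = \<psi> (f p)" using elim(1) x(2) chart_inverse[OF A U(1)] \<open>x \<in> U\<close> U(2) by simp
    ultimately have "f x = f p" using chart_inj[OF M V(1)] V(2) by (meson inj_onD)
    then show ?case unfolding k_def x(2) by (simp add: chart_inverse[OF A U(1)] \<open>x \<in> U\<close>)
  qed
  then show ?thesis using that[OF curve] velocity_eq_coord_vec[OF A U curve der] v by simp
qed

lemma diff_on_velocity:
  assumes A: "smooth_manifold A" and B: "smooth_manifold B"
    and F: "smooth_at A B F p" and eq: "\<forall>\<^sub>F x in nhds p. x \<in> S \<longrightarrow> F x = f x"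
    and c: "curve_at A c p" "\<forall>\<^sub>F t in nhds 0. c t \<in> S"
  shows "diff_on A B S f p (velocity A c) = velocity B (\<lambda>t. f (c t))"
proof -
  have "\<forall>\<^sub>F t in nhds 0. F (c t) = f (c t)"
    using curve_at_eventually[OF c(1) eq] c(2) by eventually_elim simp
  then have "velocity B (\<lambda>t. F (c t)) = velocity B (\<lambda>t. f (c t))" by (rule velocity_cong)
  then show ?thesis
    using diff_on_eq_push[OF A B F eq c refl] velocity_compose[OF A B c(1) F] by simp
qed

section \<open>Dual spaces and alternating multilinear functions\<close>

lemma dual_on_linear: "\<xi> \<in> dual_on V \<Longrightarrow> linear_on V \<xi>"
  and dual_on_outside: "\<lbrakk>\<xi> \<in> dual_on V; X \<notin> V\<rbrakk> \<Longrightarrow> \<xi> X = 0"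
  unfolding dual_on_def by blast+

lemma linear_on_add: "\<lbrakk>linear_on V f; x \<in> V; y \<in> V\<rbrakk> \<Longrightarrow> f (x + y) = f x + f y"
  and linear_on_scaleR: "\<lbrakk>linear_on V f; x \<in> V\<rbrakk> \<Longrightarrow> f (r *\<^sub>R x) = r *\<^sub>R f x"
  unfolding linear_on_def by blast+

lemma linear_on_zero: "\<lbrakk>linear_on V f; 0 \<in> V\<rbrakk> \<Longrightarrow> f 0 = 0"
  using linear_on_scaleR[of V f 0 0] by simp

lemma linear_on_minus: "\<lbrakk>linear_on V f; x \<in> V\<rbrakk> \<Longrightarrow> f (- x) = - f x"
  using linear_on_scaleR[of V f x "-1"] by simp

lemma linear_on_sum:
  assumes V: "subspace V" and f: "linear_on V f" and b: "\<And>i. i \<in> I \<Longrightarrow> b i \<in> V"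
  shows "f (\<Sum>i\<in>I. c i *\<^sub>R b i) = (\<Sum>i\<in>I. c i *\<^sub>R f (b i))"
  using b
proof (induction I rule: infinite_finite_induct)
  case (insert i I)
  have "(\<Sum>i\<in>I. c i *\<^sub>R b i) \<in> V" "c i *\<^sub>R b i \<in> V"
    using insert.prems V by (auto intro!: subspace_sum subspace_scale)
  then show ?case using insert f by (simp add: linear_on_add linear_on_scaleR)
qed (simp_all add: linear_on_zero[OF f subspace_0[OF V]])

lemma subspace_dual_on:
  assumes "subspace V"
  shows "subspace (dual_on V)"
  unfolding subspace_def dual_on_def linear_on_def by (auto simp: scaleR_fun_def algebra_simps)

lemma alt_multilinear_cong:
  assumes "subspace V" "\<And>xs. \<lbrakk>length xs = n; set xs \<subseteq> V\<rbrakk> \<Longrightarrow> \<Phi> xs = \<Psi> xs" and \<Phi>: "alt_multilinear V n \<Phi>"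
  shows "alt_multilinear V n \<Psi>"
  unfolding alt_multilinear_def
proof (intro allI impI conjI, goal_cases)
  case (1 xs i)
  have up: "\<Psi> (xs[i := x]) = \<Phi> (xs[i := x])" if "x \<in> V" for x
    using 1 that set_update_subset_insert[of xs i x] by (intro assms(2)[symmetric]) auto
  have "linear_on V (\<lambda>x. \<Phi> (xs[i := x]))" using \<Phi> 1 unfolding alt_multilinear_def by blast
  then show ?case
    using assms(1) unfolding linear_on_def by (simp add: up subspace_add subspace_scale)
next
  case (2 xs i j)
  then show ?case using \<Phi> assms(2)[of xs] unfolding alt_multilinear_def by metis
qed

lemma alt_multilinear_map:
  assumes \<Phi>: "alt_multilinear V' n \<Phi>" and L: "linear_on V L" "\<And>x. x \<in> V \<Longrightarrow> L x \<in> V'"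
  shows "alt_multilinear V n (\<lambda>xs. \<Phi> (map L xs))"
  unfolding alt_multilinear_def
proof (intro allI impI conjI, goal_cases)
  case (1 xs i)
  then have "length (map L xs) = n" "set (map L xs) \<subseteq> V'" using L(2) by auto
  then have "linear_on V' (\<lambda>x. \<Phi> ((map L xs)[i := x]))" using \<Phi> 1 unfolding alt_multilinear_def by blast
  then show ?case using L unfolding linear_on_def by (simp add: map_update)
next
  case (2 xs i j)
  then have "length (map L xs) = n" "set (map L xs) \<subseteq> V'" "map L xs ! i = map L xs ! j" using L(2) by auto
  then show ?case using \<Phi> 2 unfolding alt_multilinear_def by blast
qed

lemma alt_multilinear_sum:
  assumes V: "subspace V" and \<Phi>: "alt_multilinear V n \<Phi>"
    and xs: "set ps \<subseteq> V" "set qs \<subseteq> V" "length ps + Suc (length qs) = n"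
    and b: "\<And>i. i \<in> I \<Longrightarrow> b i \<in> V"
  shows "\<Phi> (ps @ (\<Sum>i\<in>I. c i *\<^sub>R b i) # qs) = (\<Sum>i\<in>I. c i * \<Phi> (ps @ b i # qs))"
proof -
  let ?xs = "ps @ 0 # qs"
  have "length ?xs = n" "set ?xs \<subseteq> V" "length ps < n" using xs subspace_0[OF V] by auto
  then have "linear_on V (\<lambda>x. \<Phi> (?xs[length ps := x]))" using \<Phi> unfolding alt_multilinear_def by blast
  from linear_on_sum[OF V this b] show ?thesis by simp
qed

text \<open>The index type is fixed to the model space, since a type cannot be quantified
  existentially; the indices that occur are the vectors of a basis.\<close>

definition smooth_combination :: "('a::topological_space, 'e::real_normed_vector) atlas \<Rightarrow> 'a \<Rightarrow>
    ('a \<Rightarrow> 'v) set \<Rightarrow> ('a \<Rightarrow> 'v::real_vector) \<Rightarrow> bool"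
  where "smooth_combination A p E f \<longleftrightarrow> (\<exists>(I :: 'e set) c b. finite I \<and>
    (\<forall>i\<in>I. smooth_at A real_atlas (c i) p \<and> b i \<in> E) \<and>
    (\<forall>\<^sub>F x in nhds p. f x = (\<Sum>i\<in>I. c i x *\<^sub>R b i x)))"

text \<open>Multilinearity turns the value on combinations into a polynomial in the smooth
  coefficients and in the values on the frame \<open>E\<close>, so smoothness has to be known only
  on the frame.\<close>

lemma smooth_multilinear_combination:
  fixes A :: "('a::{t2_space,second_countable_topology}, 'e::banach) atlas"
    and \<Psi> :: "'a \<Rightarrow> 'v::real_vector list \<Rightarrow> real"
  assumes A: "smooth_manifold A" and V: "\<And>x. subspace (V x)"
    and alt: "\<forall>\<^sub>F x in nhds p. alt_multilinear (V x) n (\<Psi> x)"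
    and E: "\<forall>\<^sub>F x in nhds p. \<forall>e\<in>E. e x \<in> V x"
    and base: "\<And>es. \<lbrakk>length es = n; set es \<subseteq> E\<rbrakk> \<Longrightarrow>
      smooth_at A real_atlas (\<lambda>x. \<Psi> x (map (\<lambda>e. e x) es)) p"
    and fs: "length fs = n" "\<And>f. f \<in> set fs \<Longrightarrow> smooth_combination A p E f"
      "\<And>f. f \<in> set fs \<Longrightarrow> \<forall>\<^sub>F x in nhds p. f x \<in> V x"
  shows "smooth_at A real_atlas (\<lambda>x. \<Psi> x (map (\<lambda>f. f x) fs)) p"
proof -
  \<comment> \<open>Arguments are replaced from the right: those in \<open>as\<close> are still to
    be expanded, those in \<open>es\<close> are frame members already.\<close>
  have "smooth_at A real_atlas (\<lambda>x. \<Psi> x (map (\<lambda>f. f x) (as @ es))) p"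
    if "length as + length es = n" "set as \<subseteq> set fs" "set es \<subseteq> E" for as es
    using that
  proof (induction as arbitrary: es rule: rev_induct)
    case Nil
    then show ?case using base[of es] by simp
  next
    case (snoc f as)
    then have "smooth_combination A p E f" using fs(2) by simp
    then obtain I :: "'e set" and c b where I: "finite I"
      "\<And>i. i \<in> I \<Longrightarrow> smooth_at A real_atlas (c i) p" "\<And>i. i \<in> I \<Longrightarrow> b i \<in> E"
      "\<forall>\<^sub>F x in nhds p. f x = (\<Sum>i\<in>I. c i x *\<^sub>R b i x)"
      unfolding smooth_combination_def by blast
    have "smooth_at A real_atlas (\<lambda>x. \<Psi> x (map (\<lambda>f. f x) (as @ b i # es))) p" if i: "i \<in> I" for i
      using snoc.IH[of "b i # es"] snoc.prems I(3)[OF i] by simp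
    then have s: "smooth_at A real_atlas (\<lambda>x. \<Sum>i\<in>I. c i x * \<Psi> x (map (\<lambda>f. f x) (as @ b i # es))) p"
      using I(2) by (intro smooth_at_real_sum[OF A] smooth_at_real_mult[OF A])
    have "\<forall>f\<in>set as. \<forall>\<^sub>F x in nhds p. f x \<in> V x" using snoc.prems(2) fs(3) by auto
    then have "\<forall>\<^sub>F x in nhds p. \<forall>f\<in>set as. f x \<in> V x" by (simp add: eventually_ball_finite)
    then have "\<forall>\<^sub>F x in nhds p. (\<Sum>i\<in>I. c i x * \<Psi> x (map (\<lambda>f. f x) (as @ b i # es))) =
        \<Psi> x (map (\<lambda>f. f x) ((as @ [f]) @ es))"
      using alt E I(4)
    proof eventually_elim
      case (elim x)
      have "\<Psi> x (map (\<lambda>f. f x) as @ (\<Sum>i\<in>I. c i x *\<^sub>R b i x) # map (\<lambda>f. f x) es) =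
          (\<Sum>i\<in>I. c i x * \<Psi> x (map (\<lambda>f. f x) as @ b i x # map (\<lambda>f. f x) es))"
        by (rule alt_multilinear_sum[OF V elim(2)]) (use elim(1,3) snoc.prems I(3) in auto)
      then show ?case by (simp add: elim(4))
    qed
    from smooth_at_cong[OF A s this] show ?case .
  qed
  from this[of fs "[]"] fs(1) show ?thesis by simp
qed

text \<open>The coefficients are written as values of the derivation on coordinate functions, the
  form in which their smoothness is accessible.\<close>

lemma tangent_vector_expansion:
  assumes A: "smooth_manifold (A :: ('a::{t2_space,second_countable_topology}, 'e::banach) atlas)"
    and V: "(V, \<psi>) \<in> A" "p \<in> V" and X: "X \<in> tangent_space A p"
    and B: "finite B" "\<forall>b. bounded_linear (r b)" "\<forall>v. (\<Sum>b\<in>B. r b v *\<^sub>R b) = v"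
  shows "X = (\<Sum>b\<in>B. X (\<lambda>x. r b (\<psi> x)) *\<^sub>R coord_vec A V \<psi> p b)"
proof -
  obtain v where v: "X = coord_vec A V \<psi> p v" using X unfolding tangent_space_chart[OF A V] by blast
  note lin = linear_coord_vec[OF A V]
  have "X (\<lambda>x. r b (\<psi> x)) = r b v" for b
    unfolding v by (rule coord_vec_coordinate[OF A V bounded_linear.linear[OF B(2)[rule_format]]])
  moreover have "coord_vec A V \<psi> p v = (\<Sum>b\<in>B. r b v *\<^sub>R coord_vec A V \<psi> p b)"
    using arg_cong[where f="coord_vec A V \<psi> p", OF B(3)[rule_format, of v]]
    by (simp add: linear_sum[OF lin] linear_scale[OF lin])
  ultimately show ?thesis using v by simp
qed

lemma coord_covec_cotangent:
  "coord_covec A \<phi> p l \<in> dual_on (tangent_space A p)" if "smooth_manifold A"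
  unfolding dual_on_def linear_on_def coord_covec_def
  using subspace_add[OF subspace_tangent_space[OF that]] subspace_scale[OF subspace_tangent_space[OF that]]
  by (simp add: scaleR_fun_def)

lemma sum_fun_apply: "(\<Sum>i\<in>I. f i) x = (\<Sum>i\<in>I. f i x)" for f :: "'i \<Rightarrow> 'a \<Rightarrow> real"
  by (induction I rule: infinite_finite_induct) simp_all

lemma covector_expansion:
  assumes A: "smooth_manifold (A :: ('a::{t2_space,second_countable_topology}, 'e::banach) atlas)"
    and V: "(V, \<psi>) \<in> A" "p \<in> V" and \<xi>: "\<xi> \<in> cotangent_space A p"
    and B: "finite B" "\<forall>b. bounded_linear (r b)" "\<forall>v. (\<Sum>b\<in>B. r b v *\<^sub>R b) = v"
  shows "\<xi> = (\<Sum>b\<in>B. \<xi> (coord_vec A V \<psi> p b) *\<^sub>R coord_covec A \<psi> p (r b))"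
proof
  fix X
  show "\<xi> X = (\<Sum>b\<in>B. \<xi> (coord_vec A V \<psi> p b) *\<^sub>R coord_covec A \<psi> p (r b)) X"
  proof (cases "X \<in> tangent_space A p")
    case True
    have "\<xi> X = \<xi> (\<Sum>b\<in>B. X (\<lambda>x. r b (\<psi> x)) *\<^sub>R coord_vec A V \<psi> p b)"
      using tangent_vector_expansion[OF A V True B] by simp
    also have "\<dots> = (\<Sum>b\<in>B. X (\<lambda>x. r b (\<psi> x)) *\<^sub>R \<xi> (coord_vec A V \<psi> p b))"
      by (rule linear_on_sum[OF subspace_tangent_space[OF A] dual_on_linear[OF \<xi>] coord_vec_tangent[OF A V]])
    finally show ?thesis using True
      by (simp add: sum_fun_apply coord_covec_def scaleR_fun_def o_def mult.commute)
  next
    case False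
    then show ?thesis using dual_on_outside[OF \<xi> False]
      by (simp add: sum_fun_apply coord_covec_def scaleR_fun_def)
  qed
qed

section \<open>Translations on a Lie groupoid\<close>

context lie_groupoid
begin

abbreviation "AG \<equiv> arr_atlas G"
abbreviation "MG \<equiv> obj_atlas G"

lemma src_smooth_at: "smooth_at AG MG (src G) g"
  and tgt_smooth_at: "smooth_at AG MG (tgt G) g"
  and unt_smooth_at: "smooth_at MG AG (unt G) x"
  and inverse_smooth_at: "smooth_at AG AG (inverse_arr G) g"
  using src_smooth tgt_smooth unt_smooth inverse_smooth unfolding smooth_map_def by blast+

lemma unt_src_smooth_at: "smooth_at AG AG (\<lambda>k. unt G (src G k)) g"
  and unt_tgt_smooth_at: "smooth_at AG AG (\<lambda>k. unt G (tgt G k)) g"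
  using smooth_at_compose[OF arr_manifold obj_manifold arr_manifold] src_smooth_at tgt_smooth_at unt_smooth_at
  by blast+

lemma inverse_unt: "inverse_arr G (unt G x) = unt G x"
  using mult_inverse_right[of "unt G x"] mult_unt_left[of "inverse_arr G (unt G x)"]
  by (simp add: tgt_inverse src_unt tgt_unt)

lemmas arr_prod_manifold = smooth_manifold_prod[OF arr_manifold arr_manifold]

lemmas subspace_TG = subspace_tangent_space[OF arr_manifold]
lemma algd_iff: "u \<in> algd G x \<longleftrightarrow> u \<in> TG G (unt G x) \<and> push MG (src G) (unt G x) u = 0"
  unfolding algd_def using diff_eq_push[OF arr_manifold obj_manifold src_smooth_at] by auto

lemma subspace_algd: "subspace (algd G x)"
  using subspace_TG[of "unt G x"] unfolding subspace_def
  by (auto simp: algd_iff push_add push_zero push_scaleR)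

text \<open>Membership in A says only that the differential of \<open>src\<close> vanishes, while
  translations are differentials of maps on source or target fibres and need curves inside a fibre.
  The units give the section of \<open>src\<close> that produces them.\<close>

lemma algd_curve:
  assumes "u \<in> algd G x"
  obtains c where "curve_at AG c (unt G x)" "\<forall>\<^sub>F t in nhds 0. src G (c t) = x" "velocity AG c = u"
proof (rule curve_in_fibre[OF arr_manifold obj_manifold src_smooth_at])
  show "smooth_at MG AG (unt G) (src G (unt G x))" by (rule unt_smooth_at)
  show "u \<in> TG G (unt G x)" "push MG (src G) (unt G x) u = 0" using assms algd_iff by blast+
qed (use that in \<open>simp_all add: src_unt\<close>)

text \<open>The projection of the tangent space at a unit onto A with kernel TM, so that
  \<open>cot_unit\<close> is its transpose.\<close>

definition unit_proj :: "'m \<Rightarrow> 'g tvec \<Rightarrow> 'g tvec"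
  where "unit_proj x X = X - push AG (\<lambda>k. unt G (src G k)) (unt G x) X"

lemma unit_proj_algd:
  assumes X: "X \<in> TG G (unt G x)"
  shows "unit_proj x X \<in> algd G x"
proof -
  let ?E = "push AG (\<lambda>k. unt G (src G k)) (unt G x)"
  have "?E X \<in> TG G (unt G x)"
    using push_tangent[OF arr_manifold arr_manifold unt_src_smooth_at X] by (simp add: src_unt)
  then have 1: "unit_proj x X \<in> TG G (unt G x)"
    unfolding unit_proj_def using X subspace_diff[OF subspace_TG] by blast
  have "push MG (src G) (unt G x) (?E X) = push MG (src G) (unt G (src G (unt G x))) (?E X)"
    by (simp add: src_unt)
  also have "\<dots> = push MG (\<lambda>k. src G (unt G (src G k))) (unt G x) X"
    by (rule push_compose[OF arr_manifold obj_manifold src_smooth_at])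
  finally have "push MG (src G) (unt G x) (?E X) = push MG (src G) (unt G x) X"
    by (simp add: src_unt)
  then have "push MG (src G) (unt G x) (unit_proj x X) = 0"
    unfolding unit_proj_def by (simp add: push_diff)
  then show ?thesis using 1 algd_iff by blast
qed

lemma unit_proj_add: "unit_proj x (X + Y) = unit_proj x X + unit_proj x Y"
  and unit_proj_scaleR: "unit_proj x (r *\<^sub>R X) = r *\<^sub>R unit_proj x X"
  by (simp_all add: unit_proj_def push_add push_scaleR scaleR_diff_right)

lemma cot_unit_eq:
  "cot_unit G x \<alpha> = (\<lambda>X. if X \<in> TG G (unt G x) then \<alpha> (unit_proj x X) else 0)"
proof -
  have "diff MG AG (unt G) x (diff AG MG (src G) (unt G x) X) = push AG (\<lambda>k. unt G (src G k)) (unt G x) X"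
    if X: "X \<in> TG G (unt G x)" for X
  proof -
    have d: "diff AG MG (src G) (unt G x) X = push MG (src G) (unt G x) X"
      by (rule diff_eq_push[OF arr_manifold obj_manifold src_smooth_at X])
    have "push MG (src G) (unt G x) X \<in> TM G x"
      using push_tangent[OF arr_manifold obj_manifold src_smooth_at X] by (simp add: src_unt)
    then have "diff MG AG (unt G) x (diff AG MG (src G) (unt G x) X) =
        push AG (unt G) x (push MG (src G) (unt G x) X)"
      unfolding d by (rule diff_eq_push[OF obj_manifold arr_manifold unt_smooth_at])
    also have "\<dots> = push AG (unt G) (src G (unt G x)) (push MG (src G) (unt G x) X)"
      by (simp add: src_unt)
    also have "\<dots> = push AG (\<lambda>k. unt G (src G k)) (unt G x) X"
      by (rule push_compose[OF obj_manifold arr_manifold unt_smooth_at])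
    finally show ?thesis .
  qed
  then show ?thesis unfolding cot_unit_def unit_proj_def by (intro ext) simp
qed

lemma cot_unit_cotangent:
  assumes "\<alpha> \<in> dual_algd G x"
  shows "cot_unit G x \<alpha> \<in> cotG G (unt G x)"
proof -
  note lin = dual_on_linear[OF assms]
  show ?thesis
    unfolding dual_on_def linear_on_def cot_unit_eq
    using subspace_add[OF subspace_TG] subspace_scale[OF subspace_TG]
    by (auto simp: unit_proj_add unit_proj_scaleR linear_on_add[OF lin] linear_on_scaleR[OF lin] unit_proj_algd)
qed

lemma cot_unit_add: "cot_unit G x (\<alpha> + \<beta>) = cot_unit G x \<alpha> + cot_unit G x \<beta>"
  and cot_unit_scaleR: "cot_unit G x (r *\<^sub>R \<alpha>) = r *\<^sub>R cot_unit G x \<alpha>"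
  unfolding cot_unit_eq by (auto simp: scaleR_fun_def)

end

text \<open>Common treatment of right translation (\<open>\<theta> = tgt\<close>, \<open>\<delta> k x = k x\<close>, \<open>\<epsilon> = 1\<close>) and left translation
  (\<open>\<theta> = src\<close>, \<open>\<delta> k x = x k\<^sup>-\<^sup>1\<close>, \<open>\<epsilon> = -1\<close>); \<open>k\<close> runs through the source fibre over \<open>\<theta> x\<close>.\<close>

locale translation = lie_groupoid G
  for G :: "('g::{t2_space,second_countable_topology}, 'm::{t2_space,second_countable_topology},
    'e::banach, 'b::banach) groupoid_data" +
  fixes \<theta> :: "'g \<Rightarrow> 'm" and \<delta> :: "'g \<Rightarrow> 'g \<Rightarrow> 'g" and T :: "'g \<Rightarrow> 'g tvec \<Rightarrow> 'g tvec" and \<epsilon> :: real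
  assumes \<theta>_smooth: "smooth_at AG MG \<theta> x"
    and \<delta>_smooth: "smooth_map_on (prod_atlas AG AG) AG {(k, x). src G k = \<theta> x} (\<lambda>(k, x). \<delta> k x)"
    and \<delta>_unit: "\<delta> (unt G (\<theta> x)) x = x"
    and T_velocity: "\<lbrakk>curve_at AG c (unt G (\<theta> x)); \<forall>\<^sub>F t in nhds 0. src G (c t) = \<theta> x\<rbrakk>
      \<Longrightarrow> T x (velocity AG c) = \<epsilon> *\<^sub>R velocity AG (\<lambda>t. \<delta> (c t) x)"
begin

text \<open>The translation is meaningful only where \<open>src G k = \<theta> x\<close>. Extending
  it in both variables together lets one \<open>D\<close> serve all \<open>x\<close> near a given
  point.\<close>

lemma extension:
  obtains D where "smooth_at (prod_atlas AG AG) AG D (unt G (\<theta> x), x)"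
    "\<forall>\<^sub>F z in nhds (unt G (\<theta> x), x). src G (fst z) = \<theta> (snd z) \<longrightarrow> D z = \<delta> (fst z) (snd z)"
proof -
  have "(unt G (\<theta> x), x) \<in> {(k, x). src G k = \<theta> x}" by (simp add: src_unt)
  then obtain D where "smooth_at (prod_atlas AG AG) AG D (unt G (\<theta> x), x)"
    "\<forall>\<^sub>F z in nhds (unt G (\<theta> x), x). z \<in> {(k, x). src G k = \<theta> x} \<longrightarrow> D z = (\<lambda>(k, x). \<delta> k x) z"
    using \<delta>_smooth unfolding smooth_map_on_def by blast
  then show ?thesis using that[of D] by (simp add: case_prod_beta)
qed

lemma slice_smooth: "smooth_at AG (prod_atlas AG AG) (\<lambda>k. (k, x)) g"
  by (rule smooth_at_Pair[OF arr_manifold arr_manifold arr_manifold smooth_at_ident[OF arr_manifold]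
        smooth_at_const[OF arr_manifold arr_manifold]])

lemma extension_unit:
  assumes "\<forall>\<^sub>F z in nhds (unt G (\<theta> x), x). src G (fst z) = \<theta> (snd z) \<longrightarrow> D z = \<delta> (fst z) (snd z)"
  shows "D (unt G (\<theta> x), x) = x"
  using eventually_nhds_x_imp_x[OF assms] by (simp add: src_unt \<delta>_unit)

lemma curve_translation:
  assumes D: "smooth_at (prod_atlas AG AG) AG D (unt G (\<theta> x), x)"
    and eq: "\<forall>\<^sub>F z in nhds (unt G (\<theta> x), x). src G (fst z) = \<theta> (snd z) \<longrightarrow> D z = \<delta> (fst z) (snd z)"
    and c: "curve_at AG c (unt G (\<theta> x))" "\<forall>\<^sub>F t in nhds 0. src G (c t) = \<theta> x"
  shows "curve_at AG (\<lambda>t. \<delta> (c t) x) x"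
    and "velocity AG (\<lambda>t. \<delta> (c t) x) = push AG (\<lambda>k. D (k, x)) (unt G (\<theta> x)) (velocity AG c)"
proof -
  have Dx: "smooth_at AG AG (\<lambda>k. D (k, x)) (unt G (\<theta> x))"
    by (rule smooth_at_compose[OF arr_manifold arr_prod_manifold arr_manifold slice_smooth D])
  have "\<forall>\<^sub>F k in nhds (unt G (\<theta> x)). src G k = \<theta> x \<longrightarrow> D (k, x) = \<delta> k x"
    using smooth_at_tendsto[OF arr_manifold arr_prod_manifold slice_smooth eq] by simp
  from curve_at_eventually[OF c(1) this] c(2)
  have ev: "\<forall>\<^sub>F t in nhds 0. D (c t, x) = \<delta> (c t) x" by eventually_elim simp
  show "curve_at AG (\<lambda>t. \<delta> (c t) x) x"
    using curve_at_cong[OF arr_manifold curve_at_compose[OF arr_manifold arr_manifold c(1) Dx] ev]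
      extension_unit[OF eq] by simp
  show "velocity AG (\<lambda>t. \<delta> (c t) x) = push AG (\<lambda>k. D (k, x)) (unt G (\<theta> x)) (velocity AG c)"
    using velocity_cong[OF ev, of AG] velocity_compose[OF arr_manifold arr_manifold c(1) Dx] by simp
qed

lemma curve_\<delta>:
  assumes "curve_at AG c (unt G (\<theta> x))" "\<forall>\<^sub>F t in nhds 0. src G (c t) = \<theta> x"
  shows "curve_at AG (\<lambda>t. \<delta> (c t) x) x"
  by (rule extension[of x]) (rule curve_translation(1)[OF _ _ assms])

text \<open>\<open>T x\<close> is known only on velocities of curves in the fibre; through
  \<open>D\<close> it becomes the restriction of a map that is linear on all derivations.\<close>

lemma T_push:
  assumes D: "smooth_at (prod_atlas AG AG) AG D (unt G (\<theta> x), x)"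
    and eq: "\<forall>\<^sub>F z in nhds (unt G (\<theta> x), x). src G (fst z) = \<theta> (snd z) \<longrightarrow> D z = \<delta> (fst z) (snd z)"
    and u: "u \<in> algd G (\<theta> x)"
  shows "T x u = \<epsilon> *\<^sub>R push AG (\<lambda>k. D (k, x)) (unt G (\<theta> x)) u"
proof -
  obtain c where c: "curve_at AG c (unt G (\<theta> x))" "\<forall>\<^sub>F t in nhds 0. src G (c t) = \<theta> x"
    and v: "velocity AG c = u"
    using u by (rule algd_curve)
  show ?thesis using T_velocity[OF c] curve_translation(2)[OF D eq c] by (simp add: v)
qed

lemma T_tangent:
  assumes u: "u \<in> algd G (\<theta> x)"
  shows "T x u \<in> TG G x"
proof -
  obtain c where c: "curve_at AG c (unt G (\<theta> x))" "\<forall>\<^sub>F t in nhds 0. src G (c t) = \<theta> x"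
    and v: "velocity AG c = u"
    using u by (rule algd_curve)
  show ?thesis using T_velocity[OF c] subspace_scale[OF subspace_TG tangent_spaceI[OF curve_\<delta>[OF c]]]
    by (simp add: v)
qed

lemma T_linear: "linear_on (algd G (\<theta> x)) (T x)"
proof -
  obtain D where D: "smooth_at (prod_atlas AG AG) AG D (unt G (\<theta> x), x)"
    "\<forall>\<^sub>F z in nhds (unt G (\<theta> x), x). src G (fst z) = \<theta> (snd z) \<longrightarrow> D z = \<delta> (fst z) (snd z)"
    by (rule extension)
  show ?thesis unfolding linear_on_def
    by (simp add: T_push[OF D] subspace_add[OF subspace_algd] subspace_scale[OF subspace_algd]
        push_add push_scaleR scaleR_add_right)
qed

definition cot :: "'g \<Rightarrow> 'g covec \<Rightarrow> 'g covec"
  where "cot x \<xi> = (\<lambda>u. if u \<in> algd G (\<theta> x) then \<xi> (T x u) else 0)"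

lemma cot_dual_algd:
  assumes "\<xi> \<in> cotG G x"
  shows "cot x \<xi> \<in> dual_algd G (\<theta> x)"
  using T_linear[of x] dual_on_linear[OF assms]
  unfolding dual_on_def linear_on_def cot_def
  by (simp add: subspace_add[OF subspace_algd] subspace_scale[OF subspace_algd] T_tangent)

lemma cot_add: "cot x (\<xi> + \<eta>) = cot x \<xi> + cot x \<eta>"
  and cot_scaleR: "cot x (r *\<^sub>R \<xi>) = r *\<^sub>R cot x \<xi>"
  unfolding cot_def by (auto simp: scaleR_fun_def)

definition gam :: "'g gam_arr \<Rightarrow> ('g, 'm) gam_obj"
  where "gam = (\<lambda>(x, Xs, \<xi>s). (\<theta> x, map (diff AG MG \<theta> x) Xs, map (cot x) \<xi>s))"

lemma diff_tangent: "X \<in> TG G x \<Longrightarrow> diff AG MG \<theta> x X \<in> TM G (\<theta> x)"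
  using diff_eq_push[OF arr_manifold obj_manifold \<theta>_smooth] push_tangent[OF arr_manifold obj_manifold \<theta>_smooth]
  by simp

lemma gam_objects: "a \<in> gam_arrows G p q \<Longrightarrow> gam a \<in> gam_objects G p q"
  unfolding gam_arrows_def gam_objects_def gam_def
  using diff_tangent cot_dual_algd by (auto 0 3)

text \<open>Together with \<open>covec_map\<close>, the effect on a single entry of passing from an
  arrow of \<Gamma> to the unit of its target or source.\<close>

definition vec_map :: "'g \<Rightarrow> 'g tvec \<Rightarrow> 'g tvec"
  where "vec_map x X = diff MG AG (unt G) (\<theta> x) (diff AG MG \<theta> x X)"

definition covec_map :: "'g \<Rightarrow> 'g covec \<Rightarrow> 'g covec"
  where "covec_map x \<xi> = cot_unit G (\<theta> x) (cot x \<xi>)"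

lemma vec_map_push:
  assumes X: "X \<in> TG G x"
  shows "vec_map x X = push AG (\<lambda>k. unt G (\<theta> k)) x X"
  using diff_eq_push[OF obj_manifold arr_manifold unt_smooth_at diff_tangent[OF X]]
    push_compose[OF obj_manifold arr_manifold unt_smooth_at, of \<theta> x X]
  unfolding vec_map_def diff_eq_push[OF arr_manifold obj_manifold \<theta>_smooth X] by simp

lemma unt_\<theta>_smooth: "smooth_at AG AG (\<lambda>k. unt G (\<theta> k)) x"
  by (rule smooth_at_compose[OF arr_manifold obj_manifold arr_manifold \<theta>_smooth unt_smooth_at])

lemma vec_map_tangent: "X \<in> TG G x \<Longrightarrow> vec_map x X \<in> TG G (unt G (\<theta> x))"
  using push_tangent[OF arr_manifold arr_manifold unt_\<theta>_smooth] vec_map_push by simp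

lemma vec_map_linear: "linear_on (TG G x) (vec_map x)"
  unfolding linear_on_def
  by (simp add: vec_map_push push_add push_scaleR subspace_add[OF subspace_TG] subspace_scale[OF subspace_TG])

lemma covec_map_cotangent: "\<xi> \<in> cotG G x \<Longrightarrow> covec_map x \<xi> \<in> cotG G (unt G (\<theta> x))"
  unfolding covec_map_def by (intro cot_unit_cotangent cot_dual_algd)

lemma covec_map_linear: "linear_on (cotG G x) (covec_map x)"
  unfolding linear_on_def covec_map_def by (simp add: cot_add cot_scaleR cot_unit_add cot_unit_scaleR)

definition pull :: "nat \<Rightarrow> nat \<Rightarrow> ('g gam_arr \<Rightarrow> real) \<Rightarrow> 'g gam_arr \<Rightarrow> real"
  where "pull p q F = (\<lambda>a. if a \<in> gam_arrows G p q then F (gam_unit G (gam a)) else 0)"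

lemma pull_eq:
  assumes "length Xs = q" "set Xs \<subseteq> TG G x" "length \<xi>s = p" "set \<xi>s \<subseteq> cotG G x"
  shows "pull p q F (x, Xs, \<xi>s) = F (unt G (\<theta> x), map (vec_map x) Xs, map (covec_map x) \<xi>s)"
proof -
  have 1: "map (diff MG AG (unt G) (\<theta> x)) (map (diff AG MG \<theta> x) Xs) = map (vec_map x) Xs"
    by (simp add: vec_map_def)
  have 2: "map (cot_unit G (\<theta> x)) (map (cot x) \<xi>s) = map (covec_map x) \<xi>s"
    by (simp add: covec_map_def)
  show ?thesis
    unfolding pull_def gam_def gam_unit_def gam_arrows_def prod.case 1 2 using assms by simp
qed

text \<open>The coefficient is the derivative, along a coordinate vector at \<open>x\<close>, of the
  fixed function \<open>l o \<psi> o unt G o \<theta>\<close>. So the parameter lemma applies with a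
  function that ignores its second argument.\<close>

lemma vec_coefficient_smooth:
  assumes U: "(U, \<phi>) \<in> AG" "x0 \<in> U" and V: "(V, \<psi>) \<in> AG" "unt G (\<theta> x0) \<in> V"
    and l: "linear l"
  shows "smooth_at AG real_atlas (\<lambda>x. vec_map x (coord_vec AG U \<phi> x v) (\<lambda>k. l (\<psi> k))) x0"
proof -
  have h: "smooth_at AG real_atlas (\<lambda>k. l (\<psi> (unt G (\<theta> k)))) x0"
    by (rule smooth_at_compose[OF arr_manifold arr_manifold smooth_manifold_real unt_\<theta>_smooth
          smooth_at_chart_coordinate[OF arr_manifold V l]])
  have fst0: "smooth_at (prod_atlas AG AG) AG fst (x0, x0)"
    by (rule smooth_at_fst[OF arr_manifold arr_manifold])
  have "smooth_at (prod_atlas AG AG) real_atlas (\<lambda>z. l (\<psi> (unt G (\<theta> (fst z))))) (x0, x0)"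
    by (rule smooth_at_compose[OF arr_prod_manifold arr_manifold smooth_manifold_real fst0])
      (simp add: h)
  from coord_vec_parameter_smooth[OF arr_manifold arr_manifold this smooth_at_ident[OF arr_manifold] U]
  have s: "smooth_at AG real_atlas (\<lambda>x. coord_vec AG U \<phi> x v (\<lambda>k. l (\<psi> (unt G (\<theta> k))))) x0" by simp
  have "\<forall>\<^sub>F x in nhds x0. x \<in> U"
    by (rule eventually_nhds_in_open[OF manifold_chart(1)[OF arr_manifold U(1)] U(2)])
  moreover have "\<forall>\<^sub>F x in nhds x0. unt G (\<theta> x) \<in> V"
    by (rule smooth_at_tendsto[OF arr_manifold arr_manifold unt_\<theta>_smooth
          eventually_nhds_in_open[OF manifold_chart(1)[OF arr_manifold V(1)] V(2)]])
  ultimately have "\<forall>\<^sub>F x in nhds x0. coord_vec AG U \<phi> x v (\<lambda>k. l (\<psi> (unt G (\<theta> k)))) =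
      vec_map x (coord_vec AG U \<phi> x v) (\<lambda>k. l (\<psi> k))"
  proof eventually_elim
    case (elim x)
    then show ?case
      unfolding vec_map_push[OF coord_vec_tangent[OF arr_manifold U(1) elim(1)]] push_def
      by (simp add: smooth_at_chart_coordinate[OF arr_manifold V(1) elim(2) l])
  qed
  from smooth_at_cong[OF arr_manifold s this] show ?thesis .
qed

text \<open>The coefficient unfolds to \<open>\<epsilon>\<close> times the \<open>unit_proj\<close>
  of a coordinate vector at the unit, applied to \<open>l (\<phi> (D (k, x)))\<close> as a function
  of \<open>k\<close>. As \<open>unit_proj\<close> subtracts the push along
  \<open>unt o src\<close>, this is a difference of two partial derivatives.\<close>

lemma covec_coefficient_smooth:
  assumes U: "(U, \<phi>) \<in> AG" "x0 \<in> U" and V: "(V, \<psi>) \<in> AG" "unt G (\<theta> x0) \<in> V"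
    and l: "linear l"
  shows "smooth_at AG real_atlas
    (\<lambda>x. covec_map x (coord_covec AG \<phi> x l) (coord_vec AG V \<psi> (unt G (\<theta> x)) w)) x0"
proof -
  obtain D where D: "smooth_at (prod_atlas AG AG) AG D (unt G (\<theta> x0), x0)"
    "\<forall>\<^sub>F z in nhds (unt G (\<theta> x0), x0). src G (fst z) = \<theta> (snd z) \<longrightarrow> D z = \<delta> (fst z) (snd z)"
    by (rule extension)
  define K where "K z = l (\<phi> (D z))" for z
  \<comment> \<open>Composing with \<open>S\<close> realises the push along \<open>unt o src\<close>
    in the first variable, that is, the term that \<open>unit_proj\<close> subtracts.\<close>
  define S where "S = (\<lambda>z. (unt G (src G (fst z)), snd z) :: 'g \<times> 'g)"
  have lU: "smooth_at AG real_atlas (\<lambda>k. l (\<phi> k)) (D (unt G (\<theta> x0), x0))"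
    unfolding extension_unit[OF D(2)] by (rule smooth_at_chart_coordinate[OF arr_manifold U l])
  have K: "smooth_at (prod_atlas AG AG) real_atlas K (unt G (\<theta> x0), x0)"
    unfolding K_def by (rule smooth_at_compose[OF arr_prod_manifold arr_manifold smooth_manifold_real D(1) lU])
  have S: "smooth_at (prod_atlas AG AG) (prod_atlas AG AG) S z" for z
    unfolding S_def
    by (rule smooth_at_Pair[OF arr_prod_manifold arr_manifold arr_manifold
          smooth_at_compose[OF arr_prod_manifold arr_manifold arr_manifold smooth_at_fst[OF arr_manifold arr_manifold]
            unt_src_smooth_at] smooth_at_snd[OF arr_manifold arr_manifold]])
  have "S (unt G (\<theta> x0), x0) = (unt G (\<theta> x0), x0)" by (simp add: S_def src_unt)
  then have KS: "smooth_at (prod_atlas AG AG) real_atlas (\<lambda>z. K (S z)) (unt G (\<theta> x0), x0)"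
    using K by (intro smooth_at_compose[OF arr_prod_manifold arr_prod_manifold smooth_manifold_real S]) simp
  let ?z = "\<lambda>x. unt G (\<theta> x)"
  have s1: "smooth_at AG real_atlas (\<lambda>x. coord_vec AG V \<psi> (?z x) w (\<lambda>k. K (k, x))) x0"
    by (rule coord_vec_parameter_smooth[OF arr_manifold arr_manifold K unt_\<theta>_smooth V])
  have s2: "smooth_at AG real_atlas (\<lambda>x. coord_vec AG V \<psi> (?z x) w (\<lambda>k. K (S (k, x)))) x0"
    by (rule coord_vec_parameter_smooth[OF arr_manifold arr_manifold KS unt_\<theta>_smooth V])
  have s: "smooth_at AG real_atlas (\<lambda>x. \<epsilon> * (coord_vec AG V \<psi> (?z x) w (\<lambda>k. K (k, x)) +
      (-1) * coord_vec AG V \<psi> (?z x) w (\<lambda>k. K (S (k, x))))) x0"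
    by (rule smooth_at_real_mult[OF arr_manifold smooth_at_real_const[OF arr_manifold]
          smooth_at_real_add[OF arr_manifold s1
            smooth_at_real_mult[OF arr_manifold smooth_at_real_const[OF arr_manifold] s2]]])
  have pair: "smooth_at AG (prod_atlas AG AG) (\<lambda>x. (?z x, x)) x0"
    by (rule smooth_at_Pair[OF arr_manifold arr_manifold arr_manifold unt_\<theta>_smooth smooth_at_ident[OF arr_manifold]])
  \<comment> \<open>\<open>D\<close> must extend \<open>\<delta>\<close> near the pair over every
    \<open>x\<close> close to \<open>x0\<close>, not only near the one over \<open>x0\<close>,
    because \<open>T_push\<close> is applied at each such \<open>x\<close>.\<close>
  have "\<forall>\<^sub>F z in nhds (?z x0, x0). \<forall>\<^sub>F z in nhds z. src G (fst z) = \<theta> (snd z) \<longrightarrow> D z = \<delta> (fst z) (snd z)"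
    using D(2) by (simp add: eventually_eventually)
  from smooth_at_tendsto[OF arr_manifold arr_prod_manifold pair this]
    smooth_at_tendsto[OF arr_manifold arr_prod_manifold pair smooth_at_eventually[OF D(1)]]
    eventually_nhds_in_open[OF manifold_chart(1)[OF arr_manifold U(1)] U(2)]
    smooth_at_tendsto[OF arr_manifold arr_manifold unt_\<theta>_smooth
          eventually_nhds_in_open[OF manifold_chart(1)[OF arr_manifold V(1)] V(2)]]
  have "\<forall>\<^sub>F x in nhds x0. \<epsilon> * (coord_vec AG V \<psi> (?z x) w (\<lambda>k. K (k, x)) +
      (-1) * coord_vec AG V \<psi> (?z x) w (\<lambda>k. K (S (k, x)))) =
      covec_map x (coord_covec AG \<phi> x l) (coord_vec AG V \<psi> (?z x) w)"
  proof eventually_elim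
    case (elim x)
    let ?e = "coord_vec AG V \<psi> (?z x) w"
    have e: "?e \<in> TG G (?z x)" by (rule coord_vec_tangent[OF arr_manifold V(1) elim(4)])
    note u = unit_proj_algd[OF e]
    have lx: "smooth_at AG real_atlas (\<lambda>k. l (\<phi> k)) x"
      by (rule smooth_at_chart_coordinate[OF arr_manifold U(1) elim(3) l])
    have Dx: "D (?z x, x) = x" by (rule extension_unit[OF elim(1)])
    have Kx: "smooth_at AG real_atlas (\<lambda>k. K (k, x)) (?z x)"
      unfolding K_def
      by (rule smooth_at_compose[OF arr_manifold arr_manifold smooth_manifold_real
            smooth_at_compose[OF arr_manifold arr_prod_manifold arr_manifold slice_smooth elim(2)]])
        (simp add: Dx lx)
    have "covec_map x (coord_covec AG \<phi> x l) ?e = coord_covec AG \<phi> x l (T x (unit_proj (\<theta> x) ?e))"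
      unfolding covec_map_def cot_unit_eq cot_def using e u by simp
    also have "\<dots> = T x (unit_proj (\<theta> x) ?e) (\<lambda>k. l (\<phi> k))"
      unfolding coord_covec_def using T_tangent[OF u] by (simp add: o_def)
    also have "\<dots> = \<epsilon> * unit_proj (\<theta> x) ?e (\<lambda>k. K (k, x))"
      unfolding T_push[OF elim(2,1) u] by (simp add: scaleR_fun_def push_def Dx lx K_def)
    also have "unit_proj (\<theta> x) ?e (\<lambda>k. K (k, x)) = ?e (\<lambda>k. K (k, x)) + (-1) * ?e (\<lambda>k. K (S (k, x)))"
      unfolding unit_proj_def push_def S_def by (simp add: src_unt Kx)
    finally show ?case by simp
  qed
  from smooth_at_cong[OF arr_manifold s this] show ?thesis .
qed

end

section \<open>Criteria for being a tensor\<close>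

context lie_groupoid
begin

lemma tensor_outside: "\<lbrakk>F \<in> tensors G p q; a \<notin> gam_arrows G p q\<rbrakk> \<Longrightarrow> F a = 0"
  unfolding tensors_def by blast

lemma tensor_alt_vec:
  "\<lbrakk>F \<in> tensors G p q; length \<xi>s = p; set \<xi>s \<subseteq> cotG G g\<rbrakk> \<Longrightarrow>
    alt_multilinear (TG G g) q (\<lambda>Xs. F (g, Xs, \<xi>s))"
  unfolding tensors_def by blast

lemma tensor_alt_covec:
  "\<lbrakk>F \<in> tensors G p q; length Xs = q; set Xs \<subseteq> TG G g\<rbrakk> \<Longrightarrow>
    alt_multilinear (cotG G g) p (\<lambda>\<xi>s. F (g, Xs, \<xi>s))"
  unfolding tensors_def by blast

lemma tensor_smooth:
  assumes "F \<in> tensors G p q" and V: "(V, \<psi>) \<in> AG" "z \<in> V"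
    and "length vs = q" "length ls = p" "\<forall>l\<in>set ls. linear l"
  shows "smooth_at AG real_atlas
    (\<lambda>x. F (x, map (coord_vec AG V \<psi> x) vs, map (coord_covec AG \<psi> x) ls)) z"
proof -
  have "\<forall>(U, \<phi>)\<in>AG. \<forall>vs ls. length vs = q \<and> length ls = p \<and> (\<forall>l\<in>set ls. linear l) \<longrightarrow>
      smooth_on (\<phi> ` U) (\<lambda>y. let x = inv_into U \<phi> y in
        F (x, map (coord_vec AG U \<phi> x) vs, map (coord_covec AG \<phi> x) ls))"
    using assms(1) unfolding tensors_def by blast
  from bspec[OF this V(1)] assms(4-)
  have "smooth_on (\<psi> ` V) (\<lambda>y. let x = inv_into V \<psi> y in
        F (x, map (coord_vec AG V \<psi> x) vs, map (coord_covec AG \<psi> x) ls))"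
    unfolding prod.case by blast
  then show ?thesis
    using smooth_on_chart_iff[OF arr_manifold V(1),
        of "\<lambda>x. F (x, map (coord_vec AG V \<psi> x) vs, map (coord_covec AG \<psi> x) ls)"] V(2)
    unfolding Let_def by blast
qed

lemma tensorsI:
  assumes "\<And>a. a \<notin> gam_arrows G p q \<Longrightarrow> F a = 0"
    and "\<And>g \<xi>s. \<lbrakk>length \<xi>s = p; set \<xi>s \<subseteq> cotG G g\<rbrakk> \<Longrightarrow> alt_multilinear (TG G g) q (\<lambda>Xs. F (g, Xs, \<xi>s))"
    and "\<And>g Xs. \<lbrakk>length Xs = q; set Xs \<subseteq> TG G g\<rbrakk> \<Longrightarrow> alt_multilinear (cotG G g) p (\<lambda>\<xi>s. F (g, Xs, \<xi>s))"
    and sm: "\<And>U \<phi> vs ls x. \<lbrakk>(U, \<phi>) \<in> AG; x \<in> U; length vs = q; length ls = p; \<forall>l\<in>set ls. linear l\<rbrakk> \<Longrightarrow>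
      smooth_at AG real_atlas (\<lambda>x. F (x, map (coord_vec AG U \<phi> x) vs, map (coord_covec AG \<phi> x) ls)) x"
  shows "F \<in> tensors G p q"
proof -
  have "smooth_on (\<phi> ` U) (\<lambda>y. let x = inv_into U \<phi> y in
        F (x, map (coord_vec AG U \<phi> x) vs, map (coord_covec AG \<phi> x) ls))"
    if a: "(U, \<phi>) \<in> AG" "length vs = q" "length ls = p" "\<forall>l\<in>set ls. linear l" for U \<phi> vs ls
  proof -
    have "\<forall>x\<in>U. smooth_at AG real_atlas
        (\<lambda>x. F (x, map (coord_vec AG U \<phi> x) vs, map (coord_covec AG \<phi> x) ls)) x"
      using sm[OF a(1) _ a(2-)] by blast
    then show ?thesis unfolding Let_def
      by (rule smooth_on_chart_iff[OF arr_manifold a(1),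
        of "\<lambda>x. F (x, map (coord_vec AG U \<phi> x) vs, map (coord_covec AG \<phi> x) ls)", THEN iffD2])
  qed
  then show ?thesis using assms(1-3) unfolding tensors_def by blast
qed

end

section \<open>The pulled back tensors are smooth\<close>

context translation
begin

lemma pull_smooth:
  assumes F: "F \<in> tensors G p q" and U: "(U, \<phi>) \<in> AG" "x0 \<in> U"
    and len: "length vs = q" "length ls = p" "\<forall>l\<in>set ls. linear l"
  shows "smooth_at AG real_atlas
    (\<lambda>x. pull p q F (x, map (coord_vec AG U \<phi> x) vs, map (coord_covec AG \<phi> x) ls)) x0"
proof -
  let ?z = "\<lambda>x. unt G (\<theta> x)"
  obtain V \<psi> where V: "(V, \<psi>) \<in> AG" "?z x0 \<in> V" using manifold_chart_at[OF arr_manifold] by blast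
  obtain B :: "'e set" and r where B: "finite B" "\<forall>b. bounded_linear (r b)"
    "\<forall>v. (\<Sum>b\<in>B. r b v *\<^sub>R b) = v"
    using finite_dimensional_coordinates[OF manifold_finite_dimensional[OF arr_manifold]] by blast
  have rlin: "linear (r b)" for b using B(2) bounded_linear.linear by blast
  define e where "e = (\<lambda>b x. coord_vec AG V \<psi> (?z x) b)"
  define E where "E = (\<lambda>l x. coord_covec AG \<psi> (?z x) l)"
  \<comment> \<open>This holds at every \<open>x\<close>, even when the unit lies outside
    \<open>V\<close>, since evaluating a derivation on a fixed function is always linear. The frame
    vectors \<open>e b x\<close> are known to be tangent only where the unit lies in
    \<open>V\<close>.\<close>
  have Ecot: "E l x \<in> cotG G (?z x)" for l x unfolding E_def by (rule coord_covec_cotangent[OF arr_manifold])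
  have evU: "\<forall>\<^sub>F x in nhds x0. x \<in> U"
    by (rule eventually_nhds_in_open[OF manifold_chart(1)[OF arr_manifold U(1)] U(2)])
  have evV: "\<forall>\<^sub>F x in nhds x0. ?z x \<in> V"
    by (rule smooth_at_tendsto[OF arr_manifold arr_manifold unt_\<theta>_smooth
          eventually_nhds_in_open[OF manifold_chart(1)[OF arr_manifold V(1)] V(2)]])
  have UT: "coord_vec AG U \<phi> x v \<in> TG G x" if "x \<in> U" for x v
    by (rule coord_vec_tangent[OF arr_manifold U(1) that])
  define fs where "fs = map (\<lambda>v x. vec_map x (coord_vec AG U \<phi> x v)) vs"
  define gs where "gs = map (\<lambda>l x. covec_map x (coord_covec AG \<phi> x l)) ls"
  have fsT: "\<forall>\<^sub>F x in nhds x0. f x \<in> TG G (?z x)" if "f \<in> set fs" for f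
    using evU
  proof eventually_elim
    case (elim x)
    then show ?case using that vec_map_tangent[OF UT[OF elim]] unfolding fs_def by auto
  qed
  have gsT: "g x \<in> cotG G (?z x)" if "g \<in> set gs" for g x
    using that covec_map_cotangent[OF coord_covec_cotangent[OF arr_manifold]] unfolding gs_def by auto
  have fsC: "smooth_combination AG x0 (range e) f" if f: "f \<in> set fs" for f
  proof -
    obtain v where v: "f = (\<lambda>x. vec_map x (coord_vec AG U \<phi> x v))" using f unfolding fs_def by auto
    have "\<forall>\<^sub>F x in nhds x0. f x = (\<Sum>b\<in>B. f x (\<lambda>k. r b (\<psi> k)) *\<^sub>R e b x)"
      using evU evV
    proof eventually_elim
      case (elim x)
      have "f x \<in> TG G (?z x)" unfolding v by (rule vec_map_tangent[OF UT[OF elim(1)]])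
      then show ?case unfolding e_def by (rule tangent_vector_expansion[OF arr_manifold V(1) elim(2) _ B])
    qed
    moreover have "smooth_at AG real_atlas (\<lambda>x. f x (\<lambda>k. r b (\<psi> k))) x0" for b
      unfolding v by (rule vec_coefficient_smooth[OF U V rlin])
    ultimately show ?thesis unfolding smooth_combination_def
      by (intro exI[of _ B] exI[of _ "\<lambda>b x. f x (\<lambda>k. r b (\<psi> k))"] exI[of _ e]) (simp add: B(1))
  qed
  have gsC: "smooth_combination AG x0 (E ` Collect linear) g" if g: "g \<in> set gs" for g
  proof -
    obtain l where l: "linear l" "g = (\<lambda>x. covec_map x (coord_covec AG \<phi> x l))"
      using g len(3) unfolding gs_def by auto
    have "\<forall>\<^sub>F x in nhds x0. g x = (\<Sum>b\<in>B. g x (coord_vec AG V \<psi> (?z x) b) *\<^sub>R E (r b) x)"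
      using evV
    proof eventually_elim
      case (elim x)
      show ?case unfolding E_def by (rule covector_expansion[OF arr_manifold V(1) elim gsT[OF g] B])
    qed
    moreover have "smooth_at AG real_atlas (\<lambda>x. g x (coord_vec AG V \<psi> (?z x) b)) x0" for b
      unfolding l(2) by (rule covec_coefficient_smooth[OF U V l(1)])
    ultimately show ?thesis unfolding smooth_combination_def
      by (intro exI[of _ B] exI[of _ "\<lambda>b x. g x (coord_vec AG V \<psi> (?z x) b)"] exI[of _ "\<lambda>b. E (r b)"])
        (simp add: B(1) rlin)
  qed
  \<comment> \<open>On the frame, \<open>F\<close> along the units is a chart component of
    \<open>F\<close> composed with the smooth map \<open>unt o \<theta>\<close>.\<close>
  have base: "smooth_at AG real_atlas (\<lambda>x. F (?z x, map (\<lambda>v. e v x) ws, map (\<lambda>l. E l x) ks)) x0"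
    if "length ws = q" "length ks = p" "\<forall>l\<in>set ks. linear l" for ws ks
    unfolding e_def E_def
    by (rule smooth_at_compose[OF arr_manifold arr_manifold smooth_manifold_real unt_\<theta>_smooth
          tensor_smooth[OF F V that]])
  \<comment> \<open>Multilinear expansion takes two rounds: here the vector slots, with frame
    covectors in the other slots; then the covector slots, with the vectors already general.\<close>
  have half: "smooth_at AG real_atlas (\<lambda>x. F (?z x, map (\<lambda>f. f x) fs, map (\<lambda>l. E l x) ks)) x0"
    if ks: "length ks = p" "\<forall>l\<in>set ks. linear l" for ks
  proof (rule smooth_multilinear_combination[where E="range e" and n=q and V="\<lambda>x. TG G (?z x)",
        OF arr_manifold subspace_TG])
    show "\<forall>\<^sub>F x in nhds x0. alt_multilinear (TG G (?z x)) q (\<lambda>Xs. F (?z x, Xs, map (\<lambda>l. E l x) ks))"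
      using ks(1) Ecot by (intro always_eventually allI tensor_alt_vec[OF F]) auto
    show "\<forall>\<^sub>F x in nhds x0. \<forall>f\<in>range e. f x \<in> TG G (?z x)"
      using evV by eventually_elim (auto simp: e_def intro: coord_vec_tangent[OF arr_manifold V(1)])
    show "smooth_at AG real_atlas (\<lambda>x. F (?z x, map (\<lambda>f. f x) es, map (\<lambda>l. E l x) ks)) x0"
      if es: "length es = q" "set es \<subseteq> range e" for es
    proof -
      have "es \<in> lists (e ` UNIV)" using es(2) by auto
      then obtain ws where ws: "es = map e ws" unfolding lists_image by blast
      show ?thesis using base[of ws ks] es(1) ks by (simp add: ws o_def)
    qed
    show "length fs = q" using len(1) by (simp add: fs_def)
  qed (rule fsC fsT, assumption)+
  have full: "smooth_at AG real_atlas (\<lambda>x. F (?z x, map (\<lambda>f. f x) fs, map (\<lambda>g. g x) gs)) x0"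
  proof (rule smooth_multilinear_combination[where E="E ` Collect linear" and n=p and V="\<lambda>x. cotG G (?z x)",
        OF arr_manifold subspace_dual_on[OF subspace_TG]])
    have "\<forall>\<^sub>F x in nhds x0. \<forall>f\<in>set fs. f x \<in> TG G (?z x)" using fsT by (simp add: eventually_ball_finite)
    then show "\<forall>\<^sub>F x in nhds x0. alt_multilinear (cotG G (?z x)) p (\<lambda>\<xi>s. F (?z x, map (\<lambda>f. f x) fs, \<xi>s))"
    proof eventually_elim
      case (elim x)
      then show ?case using len(1) by (intro tensor_alt_covec[OF F]) (auto simp: fs_def)
    qed
    show "\<forall>\<^sub>F x in nhds x0. \<forall>f\<in>E ` Collect linear. f x \<in> cotG G (?z x)"
      using Ecot by (intro always_eventually) auto
    show "smooth_at AG real_atlas (\<lambda>x. F (?z x, map (\<lambda>f. f x) fs, map (\<lambda>g. g x) es)) x0"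
      if es: "length es = p" "set es \<subseteq> E ` Collect linear" for es
    proof -
      have "es \<in> lists (E ` Collect linear)" using es(2) by auto
      then obtain ks where ks: "es = map E ks" "ks \<in> lists (Collect linear)" unfolding lists_image by blast
      show ?thesis using half[of ks] es(1) ks by (simp add: o_def in_lists_conv_set)
    qed
    show "length gs = p" using len(2) by (simp add: gs_def)
    show "\<forall>\<^sub>F x in nhds x0. g x \<in> cotG G (?z x)" if "g \<in> set gs" for g
      using gsT[OF that] by (rule always_eventually[OF allI])
  qed (rule gsC)
  have "\<forall>\<^sub>F x in nhds x0. F (?z x, map (\<lambda>f. f x) fs, map (\<lambda>g. g x) gs) =
      pull p q F (x, map (coord_vec AG U \<phi> x) vs, map (coord_covec AG \<phi> x) ls)"
    using evU
  proof eventually_elim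
    case (elim x)
    have "pull p q F (x, map (coord_vec AG U \<phi> x) vs, map (coord_covec AG \<phi> x) ls) =
      F (?z x, map (vec_map x) (map (coord_vec AG U \<phi> x) vs), map (covec_map x) (map (coord_covec AG \<phi> x) ls))"
      using len UT[OF elim] coord_covec_cotangent[OF arr_manifold] by (intro pull_eq) auto
    then show ?case by (simp add: fs_def gs_def o_def)
  qed
  from smooth_at_cong[OF arr_manifold full this] show ?thesis .
qed

lemma pull_tensor:
  assumes F: "F \<in> tensors G p q"
  shows "pull p q F \<in> tensors G p q"
proof (rule tensorsI)
  show "pull p q F a = 0" if "a \<notin> gam_arrows G p q" for a using that by (simp add: pull_def)
  show "alt_multilinear (TG G g) q (\<lambda>Xs. pull p q F (g, Xs, \<xi>s))"
    if \<xi>s: "length \<xi>s = p" "set \<xi>s \<subseteq> cotG G g" for g \<xi>s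
  proof (rule alt_multilinear_cong[OF subspace_TG])
    have "alt_multilinear (TG G (unt G (\<theta> g))) q (\<lambda>Xs. F (unt G (\<theta> g), Xs, map (covec_map g) \<xi>s))"
      using \<xi>s covec_map_cotangent by (intro tensor_alt_vec[OF F]) auto
    from alt_multilinear_map[OF this vec_map_linear vec_map_tangent]
    show "alt_multilinear (TG G g) q (\<lambda>Xs. F (unt G (\<theta> g), map (vec_map g) Xs, map (covec_map g) \<xi>s))" .
    show "F (unt G (\<theta> g), map (vec_map g) Xs, map (covec_map g) \<xi>s) = pull p q F (g, Xs, \<xi>s)"
      if "length Xs = q" "set Xs \<subseteq> TG G g" for Xs
      by (rule pull_eq[OF that \<xi>s, symmetric])
  qed
  show "alt_multilinear (cotG G g) p (\<lambda>\<xi>s. pull p q F (g, Xs, \<xi>s))"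
    if Xs: "length Xs = q" "set Xs \<subseteq> TG G g" for g Xs
  proof (rule alt_multilinear_cong[OF subspace_dual_on[OF subspace_TG]])
    have "alt_multilinear (cotG G (unt G (\<theta> g))) p (\<lambda>\<xi>s. F (unt G (\<theta> g), map (vec_map g) Xs, \<xi>s))"
      using Xs vec_map_tangent by (intro tensor_alt_covec[OF F]) auto
    from alt_multilinear_map[OF this covec_map_linear covec_map_cotangent]
    show "alt_multilinear (cotG G g) p (\<lambda>\<xi>s. F (unt G (\<theta> g), map (vec_map g) Xs, map (covec_map g) \<xi>s))" .
    show "F (unt G (\<theta> g), map (vec_map g) Xs, map (covec_map g) \<xi>s) = pull p q F (g, Xs, \<xi>s)"
      if "length \<xi>s = p" "set \<xi>s \<subseteq> cotG G g" for \<xi>s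
      by (rule pull_eq[OF Xs that, symmetric])
  qed
qed (rule pull_smooth[OF F])

end

section \<open>Products of curves and the two translations\<close>

lemma curve_at_Pair:
  assumes A: "smooth_manifold A" and B: "smooth_manifold B" and c: "curve_at A c g" and d: "curve_at B d h"
  shows "curve_at (prod_atlas A B) (\<lambda>t. (c t, d t)) (g, h)"
proof -
  obtain U \<phi> where U: "(U, \<phi>) \<in> A" "g \<in> U" using manifold_chart_at[OF A] by blast
  obtain V \<psi> where V: "(V, \<psi>) \<in> B" "h \<in> V" using manifold_chart_at[OF B] by blast
  obtain v where v: "((\<lambda>t. \<phi> (c t)) has_vector_derivative v) (at 0)" by (rule curve_at_chart[OF A c U])
  obtain w where w: "((\<lambda>t. \<psi> (d t)) has_vector_derivative w) (at 0)" by (rule curve_at_chart[OF B d V])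
  show ?thesis
  proof (rule curve_atI[where v="(v, w)", OF prod_atlasI[OF U(1) V(1)]])
    show "((\<lambda>t. map_prod \<phi> \<psi> (c t, d t)) has_vector_derivative (v, w)) (at 0)"
      using has_vector_derivative_Pair[OF v w] by simp
    show "isCont (\<lambda>t. (c t, d t)) 0"
      using curve_at_isCont[OF c] curve_at_isCont[OF d] by (rule isCont_Pair)
  qed (use U V curve_at_0[OF c] curve_at_0[OF d] in auto)
qed

context lie_groupoid
begin

lemma mult_extension:
  assumes "src G g = tgt G h"
  obtains D where "smooth_at (prod_atlas AG AG) AG D (g, h)"
    "\<forall>\<^sub>F z in nhds (g, h). z \<in> composable G \<longrightarrow> D z = mult G (fst z) (snd z)"
proof -
  have "(g, h) \<in> composable G" using assms by (simp add: composable_def)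
  then show ?thesis using mult_smooth that unfolding smooth_map_on_def by (auto simp: case_prod_beta)
qed

text \<open>Each partial differential depends on the extension \<open>D\<close>; their sum, on
  velocities of composable curves, is the differential of the multiplication.\<close>

lemma mult_curve:
  assumes D: "smooth_at (prod_atlas AG AG) AG D (g, h)"
    "\<forall>\<^sub>F z in nhds (g, h). z \<in> composable G \<longrightarrow> D z = mult G (fst z) (snd z)"
    and c: "curve_at AG c g" and d: "curve_at AG d h"
    and cd: "\<forall>\<^sub>F t in nhds 0. (c t, d t) \<in> composable G"
  shows "curve_at AG (\<lambda>t. mult G (c t) (d t)) (mult G g h)"
    and "velocity AG (\<lambda>t. mult G (c t) (d t)) =
      push AG (\<lambda>k. D (k, h)) g (velocity AG c) + push AG (\<lambda>k. D (g, k)) h (velocity AG d)"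
proof -
  note p = curve_at_Pair[OF arr_manifold arr_manifold c d]
  have ev: "\<forall>\<^sub>F t in nhds 0. D (c t, d t) = mult G (c t) (d t)"
    using curve_at_eventually[OF p D(2)] cd by eventually_elim simp
  have "D (g, h) = mult G g h"
    using eventually_nhds_x_imp_x[OF ev] curve_at_0[OF c] curve_at_0[OF d] by simp
  then show "curve_at AG (\<lambda>t. mult G (c t) (d t)) (mult G g h)"
    using curve_at_cong[OF arr_manifold curve_at_compose[OF arr_prod_manifold arr_manifold p D(1)] ev] by simp
  show "velocity AG (\<lambda>t. mult G (c t) (d t)) =
      push AG (\<lambda>k. D (k, h)) g (velocity AG c) + push AG (\<lambda>k. D (g, k)) h (velocity AG d)"
    using velocity_cong[OF ev, of AG] velocity_product_rule[OF arr_manifold arr_manifold arr_manifold D(1) c d]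
    by simp
qed

lemma curve_at_mult:
  assumes c: "curve_at AG c g" and d: "curve_at AG d h"
    and cd: "\<forall>\<^sub>F t in nhds 0. (c t, d t) \<in> composable G"
  shows "src G g = tgt G h" and "curve_at AG (\<lambda>t. mult G (c t) (d t)) (mult G g h)"
proof -
  show st: "src G g = tgt G h"
    using eventually_nhds_x_imp_x[OF cd] curve_at_0[OF c] curve_at_0[OF d] by (simp add: composable_def)
  show "curve_at AG (\<lambda>t. mult G (c t) (d t)) (mult G g h)"
    by (rule mult_extension[OF st]) (rule mult_curve(1)[OF _ _ c d cd])
qed

lemma right_translation: "translation G (tgt G) (\<lambda>k x. mult G k x) (right_inv G) 1"
proof (intro translation.intro translation_axioms.intro)
  show "lie_groupoid G" by (rule lie_groupoid_axioms)
  show "smooth_at AG MG (tgt G) x" for x by (rule tgt_smooth_at)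
  show "smooth_map_on (prod_atlas AG AG) AG {(k, x). src G k = tgt G x} (\<lambda>(k, x). mult G k x)"
    using mult_smooth unfolding composable_def .
  show "mult G (unt G (tgt G x)) x = x" for x by (rule mult_unt_left)
  show "right_inv G x (velocity AG c) = 1 *\<^sub>R velocity AG (\<lambda>t. mult G (c t) x)"
    if c: "curve_at AG c (unt G (tgt G x))" "\<forall>\<^sub>F t in nhds 0. src G (c t) = tgt G x" for c x
  proof -
    obtain D where D: "smooth_at (prod_atlas AG AG) AG D (unt G (tgt G x), x)"
      "\<forall>\<^sub>F z in nhds (unt G (tgt G x), x). z \<in> composable G \<longrightarrow> D z = mult G (fst z) (snd z)"
      by (rule mult_extension[of "unt G (tgt G x)" x]) (simp add: src_unt)
    have slice: "smooth_at AG (prod_atlas AG AG) (\<lambda>k. (k, x)) g" for g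
      by (rule smooth_at_Pair[OF arr_manifold arr_manifold arr_manifold smooth_at_ident[OF arr_manifold]
            smooth_at_const[OF arr_manifold arr_manifold]])
    have s: "smooth_at AG AG (\<lambda>k. D (k, x)) (unt G (tgt G x))"
      by (rule smooth_at_compose[OF arr_manifold arr_prod_manifold arr_manifold slice D(1)])
    have "\<forall>\<^sub>F k in nhds (unt G (tgt G x)). k \<in> {k. src G k = tgt G x} \<longrightarrow> D (k, x) = mult G k x"
      using smooth_at_tendsto[OF arr_manifold arr_prod_manifold slice D(2)]
      by (simp add: composable_def)
    from diff_on_velocity[OF arr_manifold arr_manifold s this c(1)] c(2)
    show ?thesis unfolding right_inv_def by simp
  qed
qed

lemma left_translation: "translation G (src G) (\<lambda>k x. mult G x (inverse_arr G k)) (left_inv G) (-1)"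
proof (intro translation.intro translation_axioms.intro)
  show "lie_groupoid G" by (rule lie_groupoid_axioms)
  show "smooth_at AG MG (src G) x" for x by (rule src_smooth_at)
  \<comment> \<open>\<open>P\<close> sends pairs with equal sources to composable pairs, so the
    smoothness of the product carries over to \<open>x k^-1\<close>. The inverse in
    \<open>left_inv\<close> is absorbed into the translation, and its minus sign becomes the factor
    -1.\<close>
  define P where "P = (\<lambda>z. (snd z, inverse_arr G (fst z)) :: 'g \<times> 'g)"
  have P: "smooth_at (prod_atlas AG AG) (prod_atlas AG AG) P z" for z
    unfolding P_def
    by (rule smooth_at_Pair[OF arr_prod_manifold arr_manifold arr_manifold
          smooth_at_snd[OF arr_manifold arr_manifold]
          smooth_at_compose[OF arr_prod_manifold arr_manifold arr_manifold
            smooth_at_fst[OF arr_manifold arr_manifold] inverse_smooth_at]])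
  show "smooth_map_on (prod_atlas AG AG) AG {(k, x). src G k = src G x}
      (\<lambda>(k, x). mult G x (inverse_arr G k))"
    unfolding smooth_map_on_def
  proof
    fix z assume "z \<in> {(k, x). src G k = src G x}"
    then have "src G (fst (P z)) = tgt G (snd (P z))" by (auto simp: P_def tgt_inverse)
    then obtain D where D: "smooth_at (prod_atlas AG AG) AG D (P z)"
      "\<forall>\<^sub>F z in nhds (P z). z \<in> composable G \<longrightarrow> D z = mult G (fst z) (snd z)"
      using mult_extension[of "fst (P z)" "snd (P z)"] by auto
    have "smooth_at (prod_atlas AG AG) AG (\<lambda>z. D (P z)) z"
      by (rule smooth_at_compose[OF arr_prod_manifold arr_prod_manifold arr_manifold P D(1)])
    moreover have "\<forall>\<^sub>F z in nhds z. z \<in> {(k, x). src G k = src G x} \<longrightarrow>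
        D (P z) = (\<lambda>(k, x). mult G x (inverse_arr G k)) z"
      using smooth_at_tendsto[OF arr_prod_manifold arr_prod_manifold P D(2)]
      by eventually_elim (auto simp: P_def composable_def tgt_inverse)
    ultimately show "\<exists>f'. smooth_at (prod_atlas AG AG) AG f' z \<and> (\<forall>\<^sub>F z in nhds z.
        z \<in> {(k, x). src G k = src G x} \<longrightarrow> f' z = (\<lambda>(k, x). mult G x (inverse_arr G k)) z)"
      by (intro exI[of _ "\<lambda>z. D (P z)"] conjI)
  qed
  show "mult G x (inverse_arr G (unt G (src G x))) = x" for x
    by (simp add: inverse_unt mult_unt_right)
  show "left_inv G x (velocity AG c) = (-1) *\<^sub>R velocity AG (\<lambda>t. mult G x (inverse_arr G (c t)))"
    if c: "curve_at AG c (unt G (src G x))" "\<forall>\<^sub>F t in nhds 0. src G (c t) = src G x" for c x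
  proof -
    let ?u = "unt G (src G x)"
    obtain D where D: "smooth_at (prod_atlas AG AG) AG D (x, ?u)"
      "\<forall>\<^sub>F z in nhds (x, ?u). z \<in> composable G \<longrightarrow> D z = mult G (fst z) (snd z)"
      by (rule mult_extension[of x ?u]) (simp add: tgt_unt)
    have slice: "smooth_at AG (prod_atlas AG AG) (\<lambda>k. (x, k)) g" for g
      by (rule smooth_at_Pair[OF arr_manifold arr_manifold arr_manifold
            smooth_at_const[OF arr_manifold arr_manifold] smooth_at_ident[OF arr_manifold]])
    have s: "smooth_at AG AG (\<lambda>k. D (x, k)) ?u"
      by (rule smooth_at_compose[OF arr_manifold arr_prod_manifold arr_manifold slice D(1)])
    have ev: "\<forall>\<^sub>F k in nhds ?u. k \<in> {k. tgt G k = src G x} \<longrightarrow> D (x, k) = mult G x k"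
      using smooth_at_tendsto[OF arr_manifold arr_prod_manifold slice D(2)]
      by (simp add: composable_def eq_commute)
    have k: "curve_at AG (\<lambda>t. inverse_arr G (c t)) ?u"
      using curve_at_compose[OF arr_manifold arr_manifold c(1) inverse_smooth_at] by (simp add: inverse_unt)
    have kf: "\<forall>\<^sub>F t in nhds 0. inverse_arr G (c t) \<in> {k. tgt G k = src G x}"
      using c(2) by (simp add: tgt_inverse)
    have "diff AG AG (inverse_arr G) ?u (velocity AG c) = velocity AG (\<lambda>t. inverse_arr G (c t))"
      using diff_eq_push[OF arr_manifold arr_manifold inverse_smooth_at tangent_spaceI[OF c(1)]]
        velocity_compose[OF arr_manifold arr_manifold c(1) inverse_smooth_at] by simp
    then show ?thesis
      unfolding left_inv_def using diff_on_velocity[OF arr_manifold arr_manifold s ev k kf] by simp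
  qed
qed

end

section \<open>The tangent and cotangent groupoids at products and units\<close>

lemma alt_multilinear_add:
  assumes "alt_multilinear V n \<Phi>" "alt_multilinear V n \<Psi>"
  shows "alt_multilinear V n (\<lambda>xs. \<Phi> xs + \<Psi> xs)"
  using assms unfolding alt_multilinear_def linear_on_def by (simp add: algebra_simps)

lemma alt_multilinear_scale:
  assumes "alt_multilinear V n \<Phi>"
  shows "alt_multilinear V n (\<lambda>xs. r * \<Phi> xs)"
  using assms unfolding alt_multilinear_def linear_on_def by (simp add: algebra_simps)

lemma alt_multilinear_zero: "alt_multilinear V n (\<lambda>_. 0)"
  unfolding alt_multilinear_def linear_on_def by simp

context lie_groupoid
begin

lemma tensors_add:
  assumes F: "F \<in> tensors G p q" and F': "F' \<in> tensors G p q"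
  shows "F + F' \<in> tensors G p q"
proof (rule tensorsI, goal_cases)
  case (1 a)
  then show ?case by (simp add: tensor_outside[OF F] tensor_outside[OF F'])
next
  case (2 g \<xi>s)
  then show ?case
    using alt_multilinear_add[OF tensor_alt_vec[OF F] tensor_alt_vec[OF F']] by simp
next
  case (3 g Xs)
  then show ?case
    using alt_multilinear_add[OF tensor_alt_covec[OF F] tensor_alt_covec[OF F']] by simp
next
  case (4 U \<phi> vs ls x)
  then show ?case
    using smooth_at_real_add[OF arr_manifold tensor_smooth[OF F 4] tensor_smooth[OF F' 4]] by simp
qed

lemma tensors_scaleR:
  assumes F: "F \<in> tensors G p q"
  shows "r *\<^sub>R F \<in> tensors G p q"
proof (rule tensorsI, goal_cases)
  case (1 a)
  then show ?case by (simp add: tensor_outside[OF F] scaleR_fun_def)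
next
  case (2 g \<xi>s)
  then show ?case using alt_multilinear_scale[OF tensor_alt_vec[OF F]] by (simp add: scaleR_fun_def)
next
  case (3 g Xs)
  then show ?case using alt_multilinear_scale[OF tensor_alt_covec[OF F]] by (simp add: scaleR_fun_def)
next
  case (4 U \<phi> vs ls x)
  then show ?case
    using smooth_at_real_mult[OF arr_manifold smooth_at_real_const[OF arr_manifold] tensor_smooth[OF F 4]]
    by (simp add: scaleR_fun_def)
qed

lemma tensors_zero: "0 \<in> tensors G p q"
  by (rule tensorsI) (simp_all add: alt_multilinear_zero smooth_at_real_const[OF arr_manifold])

lemma subspace_tensors: "subspace (tensors G p q)"
  unfolding subspace_def using tensors_zero tensors_add tensors_scaleR by blast

interpretation right: translation G "tgt G" "\<lambda>k x. mult G k x" "right_inv G" 1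
  by (rule right_translation)

interpretation left: translation G "src G" "\<lambda>k x. mult G x (inverse_arr G k)" "left_inv G" "-1"
  by (rule left_translation)

lemma cot_tgt_eq: "right.cot = cot_tgt G" and cot_src_eq: "left.cot = cot_src G"
  unfolding right.cot_def cot_tgt_def left.cot_def cot_src_def by (rule refl)+

lemma gam_tgt_eq: "right.gam = gam_tgt G" and gam_src_eq: "left.gam = gam_src G"
  unfolding right.gam_def gam_tgt_def left.gam_def gam_src_def cot_tgt_eq cot_src_eq by (rule refl)+

lemmas gam_tgt_objects = right.gam_objects[unfolded gam_tgt_eq]
lemmas gam_src_objects = left.gam_objects[unfolded gam_src_eq]

text \<open>The target of an arrow of \<Gamma> is an object of \<Gamma>, so the zero branch of
  \<open>unit_component\<close> is never reached on arrows.\<close>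

lemma right_tensor_eq: "right_tensor G p q (unit_component G p q F) = right.pull p q F"
  unfolding right_tensor_def unit_component_def right.pull_def gam_tgt_eq
  using gam_tgt_objects by auto

lemma left_tensor_eq: "left_tensor G p q (unit_component G p q F) = left.pull p q F"
  unfolding left_tensor_def unit_component_def left.pull_def gam_src_eq
  using gam_src_objects by auto

section \<open>Source and target of products\<close>

lemma diff_velocity:
  assumes "smooth_at AG MG f g" "curve_at AG c g"
  shows "diff AG MG f g (velocity AG c) = velocity MG (\<lambda>t. f (c t))"
  using diff_eq_push[OF arr_manifold obj_manifold assms(1) tangent_spaceI[OF assms(2)]]
    velocity_compose[OF arr_manifold obj_manifold assms(2,1)] by simp

lemma tangent_multE:
  assumes "tangent_mult G g h X Y Z"
  obtains c d where "curve_at AG c g" "curve_at AG d h" "\<forall>\<^sub>F t in nhds 0. (c t, d t) \<in> composable G"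
    "velocity AG c = X" "velocity AG d = Y" "velocity AG (\<lambda>t. mult G (c t) (d t)) = Z"
  using assms unfolding tangent_mult_def by blast

text \<open>Differentiate \<open>t(gh) = t(g)\<close> and \<open>s(gh) = s(h)\<close> along
  composable curves.\<close>

lemma tangent_mult_src_tgt:
  assumes "tangent_mult G g h X Y Z"
  shows "diff AG MG (tgt G) (mult G g h) Z = diff AG MG (tgt G) g X"
    and "diff AG MG (src G) (mult G g h) Z = diff AG MG (src G) h Y"
proof -
  obtain c d where c: "curve_at AG c g" and d: "curve_at AG d h"
    and cd: "\<forall>\<^sub>F t in nhds 0. (c t, d t) \<in> composable G"
    and v: "velocity AG c = X" "velocity AG d = Y" "velocity AG (\<lambda>t. mult G (c t) (d t)) = Z"
    using assms by (rule tangent_multE)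
  note m = curve_at_mult(2)[OF c d cd]
  have 1: "\<forall>\<^sub>F t in nhds 0. tgt G (mult G (c t) (d t)) = tgt G (c t)"
    using cd by eventually_elim (simp add: composable_def tgt_mult)
  have 2: "\<forall>\<^sub>F t in nhds 0. src G (mult G (c t) (d t)) = src G (d t)"
    using cd by eventually_elim (simp add: composable_def src_mult)
  show "diff AG MG (tgt G) (mult G g h) Z = diff AG MG (tgt G) g X"
    using velocity_cong[OF 1, of MG] diff_velocity[OF tgt_smooth_at m] diff_velocity[OF tgt_smooth_at c] v
    by simp
  show "diff AG MG (src G) (mult G g h) Z = diff AG MG (src G) h Y"
    using velocity_cong[OF 2, of MG] diff_velocity[OF src_smooth_at m] diff_velocity[OF src_smooth_at d] v
    by simp
qed

text \<open>Differentiate \<open>(k g) h = k (g h)\<close> in \<open>k\<close> at the unit. Such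
  triples, with a zero vector as right factor, detect the target of a product of covectors.\<close>

lemma tangent_mult_right:
  assumes gh: "src G g = tgt G h" and u: "u \<in> algd G (tgt G g)"
  shows "tangent_mult G g h (right_inv G g u) 0 (right_inv G (mult G g h) u)"
proof -
  obtain c where c: "curve_at AG c (unt G (tgt G g))" "\<forall>\<^sub>F t in nhds 0. src G (c t) = tgt G g"
    and v: "velocity AG c = u"
    using u by (rule algd_curve)
  have t: "tgt G (mult G g h) = tgt G g" by (simp add: tgt_mult gh)
  have 1: "right_inv G g u = velocity AG (\<lambda>t. mult G (c t) g)"
    using right.T_velocity[OF c] by (simp add: v)
  have "right_inv G (mult G g h) u = velocity AG (\<lambda>t. mult G (c t) (mult G g h))"
    using right.T_velocity[of c "mult G g h"] c by (simp add: t v)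
  also have "\<dots> = velocity AG (\<lambda>t. mult G (mult G (c t) g) h)"
  proof (rule velocity_cong)
    show "\<forall>\<^sub>F t in nhds 0. mult G (c t) (mult G g h) = mult G (mult G (c t) g) h"
      using c(2) by eventually_elim (simp add: mult_assoc gh)
  qed
  finally have 2: "right_inv G (mult G g h) u = velocity AG (\<lambda>t. mult G (mult G (c t) g) h)" .
  have "\<forall>\<^sub>F t in nhds 0. (mult G (c t) g, h) \<in> composable G"
    using c(2) by eventually_elim (simp add: composable_def src_mult gh)
  then show ?thesis
    unfolding tangent_mult_def 1 2
    using right.curve_\<delta>[OF c] curve_at_const[OF arr_manifold, of h] velocity_const[OF arr_manifold, of h]
    by blast
qed

text \<open>The mirror image, from \<open>(g h) k^-1 = g (h k^-1)\<close>. The signs arise because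
  \<open>left_inv\<close> is minus the velocity of \<open>h k^-1\<close>.\<close>

lemma tangent_mult_left:
  assumes gh: "src G g = tgt G h" and u: "u \<in> algd G (src G h)"
  shows "tangent_mult G g h 0 (- left_inv G h u) (- left_inv G (mult G g h) u)"
proof -
  obtain c where c: "curve_at AG c (unt G (src G h))" "\<forall>\<^sub>F t in nhds 0. src G (c t) = src G h"
    and v: "velocity AG c = u"
    using u by (rule algd_curve)
  have t: "src G (mult G g h) = src G h" by (simp add: src_mult gh)
  have 1: "- left_inv G h u = velocity AG (\<lambda>t. mult G h (inverse_arr G (c t)))"
    using left.T_velocity[OF c] by (simp add: v)
  have "- left_inv G (mult G g h) u = velocity AG (\<lambda>t. mult G (mult G g h) (inverse_arr G (c t)))"
    using left.T_velocity[of c "mult G g h"] c by (simp add: t v)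
  also have "\<dots> = velocity AG (\<lambda>t. mult G g (mult G h (inverse_arr G (c t))))"
  proof (rule velocity_cong)
    show "\<forall>\<^sub>F t in nhds 0. mult G (mult G g h) (inverse_arr G (c t)) = mult G g (mult G h (inverse_arr G (c t)))"
      using c(2) by eventually_elim (simp add: mult_assoc gh tgt_inverse)
  qed
  finally have 2: "- left_inv G (mult G g h) u = velocity AG (\<lambda>t. mult G g (mult G h (inverse_arr G (c t))))" .
  have "\<forall>\<^sub>F t in nhds 0. (g, mult G h (inverse_arr G (c t))) \<in> composable G"
    using c(2) by eventually_elim (simp add: composable_def tgt_mult gh tgt_inverse)
  then show ?thesis
    unfolding tangent_mult_def 1 2
    using left.curve_\<delta>[OF c] curve_at_const[OF arr_manifold, of g] velocity_const[OF arr_manifold, of g]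
    by blast
qed

text \<open>Evaluate the product of covectors on the triples of the two preceding lemmas: the
  covector paired with the zero vector drops out, and what remains is the value of
  \<open>cot_tgt\<close> or \<open>cot_src\<close>.\<close>

lemma cot_mult_src_tgt:
  assumes gh: "src G g = tgt G h" and m: "cot_mult G g h \<xi> \<eta> \<zeta>"
  shows "cot_tgt G (mult G g h) \<zeta> = cot_tgt G g \<xi>" and "cot_src G (mult G g h) \<zeta> = cot_src G h \<eta>"
proof -
  have c: "\<xi> \<in> cotG G g" "\<eta> \<in> cotG G h" "\<zeta> \<in> cotG G (mult G g h)"
    and eq: "\<And>X Y Z. tangent_mult G g h X Y Z \<Longrightarrow> \<zeta> Z = \<xi> X + \<eta> Y"
    using m unfolding cot_mult_def by blast+
  have 0: "\<xi> 0 = 0" "\<eta> 0 = 0"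
    using linear_on_zero[OF dual_on_linear[OF c(1)] subspace_0[OF subspace_TG]]
      linear_on_zero[OF dual_on_linear[OF c(2)] subspace_0[OF subspace_TG]] by auto
  have ts: "tgt G (mult G g h) = tgt G g" "src G (mult G g h) = src G h"
    by (simp_all add: tgt_mult src_mult gh)
  show "cot_tgt G (mult G g h) \<zeta> = cot_tgt G g \<xi>"
    unfolding cot_tgt_def ts using eq[OF tangent_mult_right[OF gh]] 0 by (intro ext) simp
  have "\<zeta> (left_inv G (mult G g h) u) = \<eta> (left_inv G h u)" if u: "u \<in> algd G (src G h)" for u
  proof -
    have "left_inv G (mult G g h) u \<in> TG G (mult G g h)" using left.T_tangent[of u "mult G g h"] u ts by simp
    moreover have "left_inv G h u \<in> TG G h" using left.T_tangent[OF u] .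
    ultimately show ?thesis
      using eq[OF tangent_mult_left[OF gh u]] 0 linear_on_minus[OF dual_on_linear[OF c(3)]]
        linear_on_minus[OF dual_on_linear[OF c(2)]] by simp
  qed
  then show "cot_src G (mult G g h) \<zeta> = cot_src G h \<eta>"
    unfolding cot_src_def ts by (intro ext) simp
qed

lemma gam_mult_src_tgt:
  assumes "gam_mult G p q a b c"
  shows "gam_tgt G c = gam_tgt G a" "gam_src G c = gam_src G b" "gam_src G a = gam_tgt G b"
    and "a \<in> gam_arrows G p q" "b \<in> gam_arrows G p q" "c \<in> gam_arrows G p q"
proof -
  obtain g Xs \<xi>s h Ys \<eta>s k Zs \<zeta>s where abc: "a = (g, Xs, \<xi>s)" "b = (h, Ys, \<eta>s)" "c = (k, Zs, \<zeta>s)"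
    using prod_cases3 by metis
  note m = assms[unfolded abc gam_mult.simps]
  show arr: "a \<in> gam_arrows G p q" "b \<in> gam_arrows G p q" "c \<in> gam_arrows G p q"
    and st: "gam_src G a = gam_tgt G b" using m abc by blast+
  have gh: "src G g = tgt G h" using st unfolding abc gam_src_def gam_tgt_def by simp
  have k: "k = mult G g h" using m by blast
  have len: "length Xs = q" "length Ys = q" "length Zs = q" "length \<xi>s = p" "length \<eta>s = p" "length \<zeta>s = p"
    using arr unfolding abc gam_arrows_def by auto
  have t: "tangent_mult G g h (Xs ! i) (Ys ! i) (Zs ! i)" if "i < q" for i using m that by blast
  have ct: "cot_mult G g h (\<xi>s ! j) (\<eta>s ! j) (\<zeta>s ! j)" if "j < p" for j using m that by blast
  have "map (diff AG MG (tgt G) k) Zs = map (diff AG MG (tgt G) g) Xs"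
    "map (diff AG MG (src G) k) Zs = map (diff AG MG (src G) h) Ys"
    by (rule nth_equalityI; simp add: len k tangent_mult_src_tgt[OF t])+
  moreover have "map (cot_tgt G k) \<zeta>s = map (cot_tgt G g) \<xi>s" "map (cot_src G k) \<zeta>s = map (cot_src G h) \<eta>s"
    by (rule nth_equalityI; simp add: len k cot_mult_src_tgt[OF gh ct])+
  ultimately show "gam_tgt G c = gam_tgt G a" "gam_src G c = gam_src G b"
    unfolding abc gam_src_def gam_tgt_def by (simp_all add: k src_mult tgt_mult gh)
qed

section \<open>Products and translations at units\<close>

abbreviation unit_vec :: "'m \<Rightarrow> 'g tvec \<Rightarrow> 'g tvec"
  where "unit_vec x \<equiv> push AG (\<lambda>k. unt G (src G k)) (unt G x)"

text \<open>The differential of the multiplication at a pair of equal units is determined by its values on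
  \<open>(X, 1\<^bsub>v\<^esub>)\<close>, \<open>(1\<^bsub>v\<^esub>, Y)\<close> and \<open>(1\<^bsub>v\<^esub>, 1\<^bsub>v\<^esub>)\<close>, where \<open>v = d src X = d tgt Y\<close>.\<close>

lemma tangent_mult_unit:
  assumes "tangent_mult G (unt G x) (unt G x) X Y Z"
  shows "Z = X + Y - unit_vec x X"
proof -
  obtain c d where c: "curve_at AG c (unt G x)" and d: "curve_at AG d (unt G x)"
    and cd: "\<forall>\<^sub>F t in nhds 0. (c t, d t) \<in> composable G"
    and v: "velocity AG c = X" "velocity AG d = Y" "velocity AG (\<lambda>t. mult G (c t) (d t)) = Z"
    using assms by (rule tangent_multE)
  obtain D where D: "smooth_at (prod_atlas AG AG) AG D (unt G x, unt G x)"
    "\<forall>\<^sub>F z in nhds (unt G x, unt G x). z \<in> composable G \<longrightarrow> D z = mult G (fst z) (snd z)"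
    by (rule mult_extension[of "unt G x" "unt G x"]) (simp add: src_unt tgt_unt)
  define P where "P = push AG (\<lambda>k. D (k, unt G x)) (unt G x)"
  define Q where "Q = push AG (\<lambda>k. D (unt G x, k)) (unt G x)"
  note dm = mult_curve(2)[OF D, folded P_def Q_def]
  define e where "e t = unt G (src G (c t))" for t
  have e: "curve_at AG e (unt G x)"
    using curve_at_compose[OF arr_manifold arr_manifold c unt_src_smooth_at] unfolding e_def by (simp add: src_unt)
  have ve: "velocity AG e = unit_vec x X"
    using velocity_compose[OF arr_manifold arr_manifold c unt_src_smooth_at] v unfolding e_def by simp
  have "velocity AG (\<lambda>t. mult G (c t) (e t)) = P X + Q (unit_vec x X)"
    using dm[OF c e] ve v by (simp add: e_def composable_def tgt_unt)
  then have 1: "X = P X + Q (unit_vec x X)" by (simp add: e_def mult_unt_right v(1))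
  have ed: "\<forall>\<^sub>F t in nhds 0. (e t, d t) \<in> composable G"
    using cd by eventually_elim (simp add: e_def composable_def src_unt)
  have "\<forall>\<^sub>F t in nhds 0. mult G (e t) (d t) = d t"
    using cd
  proof eventually_elim
    case (elim t)
    then have "src G (c t) = tgt G (d t)" by (simp add: composable_def)
    then show ?case by (simp add: e_def mult_unt_left)
  qed
  from velocity_cong[OF this, of AG] have 2: "Y = P (unit_vec x X) + Q Y"
    using dm[OF e d ed] ve v by simp
  have "mult G (e t) (e t) = e t" for t
    using mult_unt_left[of "e t"] by (simp add: e_def tgt_unt)
  moreover have "velocity AG (\<lambda>t. mult G (e t) (e t)) = P (unit_vec x X) + Q (unit_vec x X)"
    using dm[OF e e] ve by (simp add: e_def composable_def src_unt tgt_unt)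
  ultimately have 3: "unit_vec x X = P (unit_vec x X) + Q (unit_vec x X)" by (simp add: ve)
  have "Z = P X + Q Y" using dm[OF c d cd] v by simp
  \<comment> \<open>Regrouped so that each bracket is one of the three known products; this removes
    \<open>P\<close> and \<open>Q\<close>, which depend on the extension.\<close>
  also have "\<dots> = (P X + Q (unit_vec x X)) + (P (unit_vec x X) + Q Y) -
      (P (unit_vec x X) + Q (unit_vec x X))" by simp
  also have "\<dots> = X + Y - unit_vec x X" by (simp only: 1[symmetric] 2[symmetric] 3[symmetric])
  finally show ?thesis .
qed

lemma unit_vec_idem: "unit_vec x (unit_vec x X) = unit_vec x X"
  using push_compose[OF arr_manifold arr_manifold unt_src_smooth_at, of "\<lambda>k. unt G (src G k)" "unt G x" X]
  by (simp add: src_unt)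

lemma unit_vec_algd:
  assumes "u \<in> algd G x"
  shows "unit_vec x u = 0"
  using push_compose[OF obj_manifold arr_manifold unt_smooth_at, of "src G" "unt G x" u] assms
  by (simp add: algd_iff push_zero)

text \<open>At a unit the product of tangent vectors adds the A-components, since
  \<open>unit_proj\<close> kills the image of \<open>unit_vec\<close>. This is what makes
  \<open>cot_unit\<close> multiply with itself to itself.\<close>

lemma unit_proj_tangent_mult:
  assumes "tangent_mult G (unt G x) (unt G x) X Y Z"
  shows "unit_proj x Z = unit_proj x X + unit_proj x Y"
  unfolding unit_proj_def tangent_mult_unit[OF assms]
  by (simp add: push_add push_diff unit_vec_idem)

text \<open>Right translation by a unit fixes every curve in the source fibre, so
  \<open>right_inv\<close> is the identity on A there, and so is \<open>unit_proj\<close>.\<close>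

lemma cot_tgt_cot_unit:
  assumes "\<alpha> \<in> dual_algd G x"
  shows "cot_tgt G (unt G x) (cot_unit G x \<alpha>) = \<alpha>"
proof
  fix u
  show "cot_tgt G (unt G x) (cot_unit G x \<alpha>) u = \<alpha> u"
  proof (cases "u \<in> algd G x")
    case True
    then obtain c where c: "curve_at AG c (unt G x)" "\<forall>\<^sub>F t in nhds 0. src G (c t) = x" "velocity AG c = u"
      by (rule algd_curve)
    have "\<forall>\<^sub>F t in nhds 0. mult G (c t) (unt G x) = c t"
      using c(2)
    proof eventually_elim
      case (elim t)
      then show ?case using mult_unt_right[of "c t"] by simp
    qed
    from velocity_cong[OF this, of AG] have "right_inv G (unt G x) u = u"
      using right.T_velocity[of c "unt G x"] c by (simp add: tgt_unt)
    moreover have "unit_proj x u = u" unfolding unit_proj_def by (simp add: unit_vec_algd[OF True])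
    ultimately show ?thesis using True algd_iff
      unfolding cot_tgt_def cot_unit_eq by (simp add: tgt_unt)
  next
    case False
    then show ?thesis using dual_on_outside[OF assms] unfolding cot_tgt_def by (simp add: tgt_unt)
  qed
qed

text \<open>At a unit \<open>left_inv\<close> is minus the differential of inversion, whose values
  need not lie in A; what counts is their A-component. From \<open>k k^-1 = 1_t(k)\<close> the
  product formula gives \<open>u + d inv u = d(unt o tgt) u\<close>. As
  \<open>src o inv = tgt\<close>, the right side is also the TM-component of \<open>d inv u\<close>,
  so the A-component of \<open>- d inv u\<close> is \<open>u\<close>.\<close>

lemma cot_src_cot_unit:
  assumes "\<alpha> \<in> dual_algd G x"
  shows "cot_src G (unt G x) (cot_unit G x \<alpha>) = \<alpha>"
proof
  fix u
  show "cot_src G (unt G x) (cot_unit G x \<alpha>) u = \<alpha> u"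
  proof (cases "u \<in> algd G x")
    case True
    then obtain c where c: "curve_at AG c (unt G x)" "\<forall>\<^sub>F t in nhds 0. src G (c t) = x" "velocity AG c = u"
      by (rule algd_curve)
    define k where "k t = inverse_arr G (c t)" for t
    have k: "curve_at AG k (unt G x)"
      using curve_at_compose[OF arr_manifold arr_manifold c(1) inverse_smooth_at]
      unfolding k_def by (simp add: inverse_unt)
    have uT: "u \<in> TG G (unt G x)" using True algd_iff by blast
    have "\<forall>\<^sub>F t in nhds 0. mult G (unt G x) (k t) = k t"
      using c(2)
    proof eventually_elim
      case (elim t)
      then show ?case using mult_unt_left[of "k t"] by (simp add: k_def tgt_inverse)
    qed
    from velocity_cong[OF this, of AG] have l: "left_inv G (unt G x) u = - velocity AG k"
      using left.T_velocity[of c "unt G x"] c unfolding k_def[abs_def] by (simp add: src_unt)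
    have cu: "velocity AG (\<lambda>t. unt G (tgt G (c t))) = push AG (\<lambda>k. unt G (tgt G k)) (unt G x) u"
      using velocity_compose[OF arr_manifold arr_manifold c(1) unt_tgt_smooth_at] c(3) by simp
    have "tangent_mult G (unt G x) (unt G x) u (velocity AG k)
        (velocity AG (\<lambda>t. unt G (tgt G (c t))))"
      unfolding tangent_mult_def
    proof (intro exI conjI)
      show "curve_at AG c (unt G x)" "curve_at AG k (unt G x)" "velocity AG c = u" "velocity AG k = velocity AG k"
        by (simp_all add: c k)
      show "\<forall>\<^sub>F t in nhds 0. (c t, k t) \<in> composable G"
        by (simp add: k_def composable_def tgt_inverse)
      show "velocity AG (\<lambda>t. mult G (c t) (k t)) = velocity AG (\<lambda>t. unt G (tgt G (c t)))"
        by (simp add: k_def mult_inverse_right)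
    qed
    from tangent_mult_unit[OF this] have "push AG (\<lambda>k. unt G (tgt G k)) (unt G x) u = u + velocity AG k"
      by (simp add: cu unit_vec_algd[OF True])
    moreover have "unit_vec x (velocity AG k) = push AG (\<lambda>k. unt G (tgt G k)) (unt G x) u"
      using velocity_compose[OF arr_manifold arr_manifold k unt_src_smooth_at] cu
      by (simp add: k_def src_inverse)
    ultimately have "unit_proj x (left_inv G (unt G x) u) = u"
      unfolding l unit_proj_def by (simp add: push_minus)
    moreover have "left_inv G (unt G x) u \<in> TG G (unt G x)"
      using left.T_tangent[of u "unt G x"] True by (simp add: src_unt)
    ultimately show ?thesis using True unfolding cot_src_def cot_unit_eq by (simp add: src_unt)
  next
    case False
    then show ?thesis using dual_on_outside[OF assms] unfolding cot_src_def by (simp add: src_unt)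
  qed
qed

lemma unit_tangent:
  assumes "v \<in> TM G x"
  shows "diff MG AG (unt G) x v \<in> TG G (unt G x)"
    and "diff AG MG (src G) (unt G x) (diff MG AG (unt G) x v) = v"
    and "diff AG MG (tgt G) (unt G x) (diff MG AG (unt G) x v) = v"
    and "tangent_mult G (unt G x) (unt G x) (diff MG AG (unt G) x v) (diff MG AG (unt G) x v)
      (diff MG AG (unt G) x v)"
proof -
  obtain c where c: "curve_at MG c x" "velocity MG c = v" using assms by (rule tangent_spaceE)
  note uc = curve_at_compose[OF obj_manifold arr_manifold c(1) unt_smooth_at]
  have d: "diff MG AG (unt G) x v = velocity AG (\<lambda>t. unt G (c t))"
    using diff_eq_push[OF obj_manifold arr_manifold unt_smooth_at assms]
      velocity_compose[OF obj_manifold arr_manifold c(1) unt_smooth_at] c(2) by simp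
  show "diff MG AG (unt G) x v \<in> TG G (unt G x)" unfolding d by (rule tangent_spaceI[OF uc])
  show "diff AG MG (src G) (unt G x) (diff MG AG (unt G) x v) = v"
    unfolding d diff_velocity[OF src_smooth_at uc] by (simp add: src_unt c(2))
  show "diff AG MG (tgt G) (unt G x) (diff MG AG (unt G) x v) = v"
    unfolding d diff_velocity[OF tgt_smooth_at uc] by (simp add: tgt_unt c(2))
  have "mult G (unt G (c t)) (unt G (c t)) = unt G (c t)" for t
    using mult_unt_left[of "unt G (c t)"] by (simp add: tgt_unt)
  then show "tangent_mult G (unt G x) (unt G x) (diff MG AG (unt G) x v) (diff MG AG (unt G) x v)
      (diff MG AG (unt G) x v)"
    unfolding d tangent_mult_def using uc
    by (intro exI[of _ "\<lambda>t. unt G (c t)"]) (simp add: composable_def src_unt tgt_unt)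
qed

lemma gam_unit_arrows:
  assumes "b \<in> gam_objects G p q"
  shows "gam_unit G b \<in> gam_arrows G p q"
proof -
  obtain x vs \<alpha>s where b: "b = (x, vs, \<alpha>s)" using prod_cases3 by blast
  have l: "length vs = q" "length \<alpha>s = p" and v: "set vs \<subseteq> TM G x" and a: "set \<alpha>s \<subseteq> dual_algd G x"
    using assms unfolding b gam_objects_def by auto
  have "diff MG AG (unt G) x ` set vs \<subseteq> TG G (unt G x)" using unit_tangent(1) v by blast
  moreover have "cot_unit G x ` set \<alpha>s \<subseteq> cotG G (unt G x)" using cot_unit_cotangent a by blast
  ultimately show ?thesis unfolding b gam_unit_def gam_arrows_def by (simp add: l)
qed

lemma gam_src_tgt_unit:
  assumes "b \<in> gam_objects G p q"
  shows "gam_src G (gam_unit G b) = b" and "gam_tgt G (gam_unit G b) = b"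
proof -
  obtain x vs \<alpha>s where b: "b = (x, vs, \<alpha>s)" using prod_cases3 by blast
  have v: "set vs \<subseteq> TM G x" and a: "set \<alpha>s \<subseteq> dual_algd G x"
    using assms unfolding b gam_objects_def by auto
  show "gam_src G (gam_unit G b) = b"
    unfolding b gam_src_def gam_unit_def
    using unit_tangent(2)[OF subsetD[OF v]] cot_src_cot_unit[OF subsetD[OF a]]
    by (simp add: src_unt map_idI)
  show "gam_tgt G (gam_unit G b) = b"
    unfolding b gam_tgt_def gam_unit_def
    using unit_tangent(3)[OF subsetD[OF v]] cot_tgt_cot_unit[OF subsetD[OF a]]
    by (simp add: tgt_unt map_idI)
qed

lemma cot_mult_unit:
  assumes a: "\<alpha> \<in> dual_algd G x"
  shows "cot_mult G (unt G x) (unt G x) (cot_unit G x \<alpha>) (cot_unit G x \<alpha>) (cot_unit G x \<alpha>)"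
proof -
  have m: "mult G (unt G x) (unt G x) = unt G x" using mult_unt_left[of "unt G x"] by (simp add: tgt_unt)
  have "cot_unit G x \<alpha> Z = cot_unit G x \<alpha> X + cot_unit G x \<alpha> Y"
    if t: "tangent_mult G (unt G x) (unt G x) X Y Z" for X Y Z
  proof -
    obtain c d where c: "curve_at AG c (unt G x)" and d: "curve_at AG d (unt G x)"
      and cd: "\<forall>\<^sub>F t in nhds 0. (c t, d t) \<in> composable G"
      and v: "velocity AG c = X" "velocity AG d = Y" "velocity AG (\<lambda>t. mult G (c t) (d t)) = Z"
      using t by (rule tangent_multE)
    have T: "X \<in> TG G (unt G x)" "Y \<in> TG G (unt G x)" "Z \<in> TG G (unt G x)"
      using tangent_spaceI[OF c] tangent_spaceI[OF d] tangent_spaceI[OF curve_at_mult(2)[OF c d cd]] v m by simp_all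
    then show ?thesis
      by (simp add: cot_unit_eq unit_proj_tangent_mult[OF t]
          linear_on_add[OF dual_on_linear[OF a] unit_proj_algd[OF T(1)] unit_proj_algd[OF T(2)]])
  qed
  then show ?thesis
    unfolding cot_mult_def m
    using cot_unit_cotangent[OF a] cot_src_cot_unit[OF a] cot_tgt_cot_unit[OF a] by simp
qed

lemma gam_mult_unit:
  assumes b: "b \<in> gam_objects G p q"
  shows "gam_mult G p q (gam_unit G b) (gam_unit G b) (gam_unit G b)"
proof -
  obtain x vs \<alpha>s where eq: "b = (x, vs, \<alpha>s)" using prod_cases3 by blast
  have bb: "length vs = q" "set vs \<subseteq> TM G x" "length \<alpha>s = p" "set \<alpha>s \<subseteq> dual_algd G x"
    using b unfolding eq gam_objects_def by auto
  have m: "unt G x = mult G (unt G x) (unt G x)" using mult_unt_left[of "unt G x"] by (simp add: tgt_unt)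
  have u: "gam_unit G b = (unt G x, map (diff MG AG (unt G) x) vs, map (cot_unit G x) \<alpha>s)"
    unfolding eq gam_unit_def by simp
  show ?thesis
    unfolding u gam_mult.simps
    unfolding u[symmetric]
  proof (intro conjI allI impI)
    show "gam_unit G b \<in> gam_arrows G p q" "gam_unit G b \<in> gam_arrows G p q"
      "gam_unit G b \<in> gam_arrows G p q" by (rule gam_unit_arrows[OF b])+
    show "gam_src G (gam_unit G b) = gam_tgt G (gam_unit G b)" by (simp add: gam_src_tgt_unit[OF b])
    show "unt G x = mult G (unt G x) (unt G x)" by (rule m)
    show "tangent_mult G (unt G x) (unt G x) (map (diff MG AG (unt G) x) vs ! i)
        (map (diff MG AG (unt G) x) vs ! i) (map (diff MG AG (unt G) x) vs ! i)" if "i < q" for i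
      using unit_tangent(4)[of "vs ! i" x] bb(1,2) that by (simp add: subset_iff)
    show "cot_mult G (unt G x) (unt G x) (map (cot_unit G x) \<alpha>s ! j)
        (map (cot_unit G x) \<alpha>s ! j) (map (cot_unit G x) \<alpha>s ! j)" if "j < p" for j
      using cot_mult_unit[of "\<alpha>s ! j" x] bb(3,4) that by (simp add: subset_iff)
  qed
qed

subsection \<open>Affine and multiplicative functions\<close>

text \<open>\<open>right_part\<close> and \<open>left_part\<close> are the operators R and L of the
  overview.\<close>

definition right_part :: "nat \<Rightarrow> nat \<Rightarrow> ('g gam_arr \<Rightarrow> real) \<Rightarrow> 'g gam_arr \<Rightarrow> real"
  where "right_part p q F = right_tensor G p q (unit_component G p q F)"

definition left_part :: "nat \<Rightarrow> nat \<Rightarrow> ('g gam_arr \<Rightarrow> real) \<Rightarrow> 'g gam_arr \<Rightarrow> real"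
  where "left_part p q F = left_tensor G p q (unit_component G p q F)"

lemma right_part_apply:
  "right_part p q F a = (if a \<in> gam_arrows G p q then F (gam_unit G (gam_tgt G a)) else 0)"
  unfolding right_part_def right_tensor_eq right.pull_def gam_tgt_eq by simp

lemma left_part_apply:
  "left_part p q F a = (if a \<in> gam_arrows G p q then F (gam_unit G (gam_src G a)) else 0)"
  unfolding left_part_def left_tensor_eq left.pull_def gam_src_eq by simp

lemma right_part_tensor: "F \<in> tensors G p q \<Longrightarrow> right_part p q F \<in> tensors G p q"
  unfolding right_part_def right_tensor_eq by (rule right.pull_tensor)

lemma left_part_tensor: "F \<in> tensors G p q \<Longrightarrow> left_part p q F \<in> tensors G p q"
  unfolding left_part_def left_tensor_eq by (rule left.pull_tensor)

lemma parts_linear: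
  "right_part p q (F + F') = right_part p q F + right_part p q F'"
  "right_part p q (F - F') = right_part p q F - right_part p q F'"
  "right_part p q (r *\<^sub>R F) = r *\<^sub>R right_part p q F"
  "left_part p q (F + F') = left_part p q F + left_part p q F'"
  "left_part p q (F - F') = left_part p q F - left_part p q F'"
  "left_part p q (r *\<^sub>R F) = r *\<^sub>R left_part p q F"
  by (auto simp: fun_eq_iff right_part_apply left_part_apply scaleR_fun_def)

text \<open>Each part depends on \<open>F\<close> only through its values at units. A unit is the
  unit of its own source and target, so passing to either part leaves these values
  unchanged.\<close>

lemma parts_left_part:
  "right_part p q (left_part p q F) = right_part p q F"
  "left_part p q (left_part p q F) = left_part p q F"
  by (auto simp: fun_eq_iff right_part_apply left_part_apply gam_unit_arrows gam_tgt_objects gam_src_objects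
      gam_src_tgt_unit[OF gam_tgt_objects] gam_src_tgt_unit[OF gam_src_objects])

lemma parts_right_part:
  "left_part p q (right_part p q F) = left_part p q F"
  "right_part p q (right_part p q F) = right_part p q F"
  by (auto simp: fun_eq_iff right_part_apply left_part_apply gam_unit_arrows gam_tgt_objects gam_src_objects
      gam_src_tgt_unit[OF gam_tgt_objects] gam_src_tgt_unit[OF gam_src_objects])

text \<open>Apply multiplicativity to the product of a unit with itself.\<close>

lemma multiplicative_unit:
  assumes "multiplicative_function G p q F" "b \<in> gam_objects G p q"
  shows "F (gam_unit G b) = 0"
  using assms(1)[unfolded multiplicative_function_def, rule_format, OF gam_mult_unit[OF assms(2)]]
  by simp

lemma multiplicative_parts:
  assumes "multiplicative_function G p q F"
  shows "right_part p q F = 0" "left_part p q F = 0"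
  by (auto simp: fun_eq_iff right_part_apply left_part_apply
      multiplicative_unit[OF assms gam_tgt_objects] multiplicative_unit[OF assms gam_src_objects])

lemma multiplicative_affine:
  assumes "multiplicative_function G p q F"
  shows "affine_function G p q F"
  unfolding affine_function_def
proof (intro allI impI)
  fix a b c assume m: "gam_mult G p q a b c"
  have "F (gam_unit G (gam_src G a)) = 0"
    by (rule multiplicative_unit[OF assms gam_src_objects[OF gam_mult_src_tgt(4)[OF m]]])
  then show "F c = F a + F b - F (gam_unit G (gam_src G a))"
    using assms[unfolded multiplicative_function_def, rule_format, OF m] by simp
qed

text \<open>The term of \<open>F\<close> at the unit of \<open>s(a) = t(b)\<close> is the right part
  at \<open>b\<close>, while the right part at the product is that at \<open>a\<close>.\<close>

lemma affine_diff_right_part: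
  assumes "affine_function G p q F"
  shows "multiplicative_function G p q (F - right_part p q F)"
  unfolding multiplicative_function_def
proof (intro allI impI)
  fix a b c assume m: "gam_mult G p q a b c"
  have "F c = F a + F b - F (gam_unit G (gam_src G a))" using assms m unfolding affine_function_def by blast
  then show "(F - right_part p q F) c = (F - right_part p q F) a + (F - right_part p q F) b"
    by (simp add: right_part_apply gam_mult_src_tgt[OF m])
qed

text \<open>Here the same term is the left part at \<open>a\<close>, while the left part at the
  product is that at \<open>b\<close>.\<close>

lemma affine_diff_left_part:
  assumes "affine_function G p q F"
  shows "multiplicative_function G p q (F - left_part p q F)"
  unfolding multiplicative_function_def
proof (intro allI impI)
  fix a b c assume m: "gam_mult G p q a b c"
  have "F c = F a + F b - F (gam_unit G (gam_src G a))" using assms m unfolding affine_function_def by blast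
  then show "(F - left_part p q F) c = (F - left_part p q F) a + (F - left_part p q F) b"
    by (simp add: left_part_apply gam_mult_src_tgt[OF m])
qed

text \<open>The value at a product is that at its right factor, and the value at the left factor
  cancels against the one at its source unit. This gives closure of the arrows under
  composition.\<close>

lemma left_part_affine: "affine_function G p q (left_part p q F)"
  unfolding affine_function_def
proof (intro allI impI)
  fix a b c assume m: "gam_mult G p q a b c"
  note o = gam_src_objects[OF gam_mult_src_tgt(4)[OF m]]
  show "left_part p q F c = left_part p q F a + left_part p q F b - left_part p q F (gam_unit G (gam_src G a))"
    unfolding left_part_apply
    by (simp add: gam_mult_src_tgt(2,4,5,6)[OF m] gam_unit_arrows[OF o] gam_src_tgt_unit[OF o])
qed

lemma subspace_affine_tensors: "subspace (affine_tensors G p q)"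
proof -
  have "affine_function G p q (F + F')" if F: "affine_function G p q F" "affine_function G p q F'" for F F'
    unfolding affine_function_def
  proof (intro allI impI)
    fix a b c assume m: "gam_mult G p q a b c"
    show "(F + F') c = (F + F') a + (F + F') b - (F + F') (gam_unit G (gam_src G a))"
      using F[unfolded affine_function_def, rule_format, OF m] by simp
  qed
  moreover have "affine_function G p q (r *\<^sub>R F)" if F: "affine_function G p q F" for F r
    unfolding affine_function_def
  proof (intro allI impI)
    fix a b c assume m: "gam_mult G p q a b c"
    show "(r *\<^sub>R F) c = (r *\<^sub>R F) a + (r *\<^sub>R F) b - (r *\<^sub>R F) (gam_unit G (gam_src G a))"
      using arg_cong[where f="\<lambda>y. r * y", OF F[unfolded affine_function_def, rule_format, OF m]]
      by (simp add: scaleR_fun_def algebra_simps)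
  qed
  moreover have "affine_function G p q 0" unfolding affine_function_def by simp
  ultimately show ?thesis
    using subspace_tensors[of p q] unfolding subspace_def affine_tensors_def by blast
qed

lemma subspace_multiplicative_tensors: "subspace (multiplicative_tensors G p q)"
proof -
  have "multiplicative_function G p q (F + F')"
    if F: "multiplicative_function G p q F" "multiplicative_function G p q F'" for F F'
    unfolding multiplicative_function_def
  proof (intro allI impI)
    fix a b c assume m: "gam_mult G p q a b c"
    show "(F + F') c = (F + F') a + (F + F') b"
      using F[unfolded multiplicative_function_def, rule_format, OF m] by simp
  qed
  moreover have "multiplicative_function G p q (r *\<^sub>R F)" if F: "multiplicative_function G p q F" for F r
    unfolding multiplicative_function_def
  proof (intro allI impI)
    fix a b c assume m: "gam_mult G p q a b c"
    show "(r *\<^sub>R F) c = (r *\<^sub>R F) a + (r *\<^sub>R F) b"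
      using F[unfolded multiplicative_function_def, rule_format, OF m] by (simp add: scaleR_fun_def algebra_simps)
  qed
  moreover have "multiplicative_function G p q 0" unfolding multiplicative_function_def by simp
  ultimately show ?thesis
    using subspace_tensors[of p q] unfolding subspace_def multiplicative_tensors_def by blast
qed

section \<open>The axioms of a 2-vector space\<close>

lemma two_vector_space_affine_tensors:
  "two_vector_space (affine_tensors G p q) (multiplicative_tensors G p q)
    (\<lambda>F. F - right_part p q F) (\<lambda>F. F - left_part p q F) (\<lambda>F. F) (\<lambda>F F'. F + left_part p q F')"
proof
  show "subspace (affine_tensors G p q)" by (rule subspace_affine_tensors)
  show "subspace (multiplicative_tensors G p q)" by (rule subspace_multiplicative_tensors)
  fix F assume F: "F \<in> affine_tensors G p q"
  show "F - right_part p q F \<in> multiplicative_tensors G p q"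
    using F affine_diff_right_part subspace_diff[OF subspace_tensors] right_part_tensor
    unfolding affine_tensors_def multiplicative_tensors_def by blast
  show "F - left_part p q F \<in> multiplicative_tensors G p q"
    using F affine_diff_left_part subspace_diff[OF subspace_tensors] left_part_tensor
    unfolding affine_tensors_def multiplicative_tensors_def by blast
  \<comment> \<open>L R = L gives \<open>L (F - R F) = 0\<close>, so composing with the identity of
    the source adds nothing.\<close>
  show "F + left_part p q (F - right_part p q F) = F"
    by (simp add: parts_linear parts_right_part)
  show "F - left_part p q F + left_part p q F = F" by simp
next
  fix F assume F: "F \<in> multiplicative_tensors G p q"
  then have m: "multiplicative_function G p q F" unfolding multiplicative_tensors_def by blast
  show "F \<in> affine_tensors G p q"
    using F multiplicative_affine unfolding affine_tensors_def multiplicative_tensors_def by blast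
  show "F - right_part p q F = F" "F - left_part p q F = F" by (simp_all add: multiplicative_parts[OF m])
next
  fix F F' assume F: "F \<in> affine_tensors G p q" "F' \<in> affine_tensors G p q"
    and eq: "F - right_part p q F = F' - left_part p q F'"
  have "left_part p q F' \<in> affine_tensors G p q"
    using F(2) left_part_affine left_part_tensor unfolding affine_tensors_def by blast
  then show "F + left_part p q F' \<in> affine_tensors G p q" using F(1) subspace_add[OF subspace_affine_tensors] by blast
  \<comment> \<open>With R L = R the left side is \<open>(F - R F) + L F' - R F'\<close>, and
    composability replaces the bracket by \<open>F' - L F'\<close>.\<close>
  show "F + left_part p q F' - right_part p q (F + left_part p q F') = F' - right_part p q F'"
    using eq by (simp add: parts_linear parts_left_part parts_right_part algebra_simps)
  show "F + left_part p q F' - left_part p q (F + left_part p q F') = F - left_part p q F"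
    by (simp add: parts_linear parts_left_part)
  show "r *\<^sub>R F + left_part p q (r *\<^sub>R F') = r *\<^sub>R (F + left_part p q F')" for r
    by (simp add: parts_linear scaleR_add_right)
  fix F''
  \<comment> \<open>By L L = L both sides are \<open>F + L F' + L F''\<close>.\<close>
  show "F + left_part p q F' + left_part p q F'' = F + left_part p q (F' + left_part p q F'')"
    by (simp add: parts_linear parts_left_part)
  fix F'''
  show "F + F'' + left_part p q (F' + F''') = F + left_part p q F' + (F'' + left_part p q F''')"
    by (simp add: parts_linear)
next
  show "linear_on (affine_tensors G p q) (\<lambda>F. F - right_part p q F)"
    "linear_on (affine_tensors G p q) (\<lambda>F. F - left_part p q F)"
    "linear_on (multiplicative_tensors G p q) (\<lambda>F. F)"
    unfolding linear_on_def by (simp_all add: parts_linear scaleR_diff_right)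
qed

end

theorem theorem5p8:
  fixes G :: "('g::{t2_space,second_countable_topology}, 'm::{t2_space,second_countable_topology},
      'e::banach, 'b::banach) groupoid_data"
    and p q :: nat
  assumes "lie_groupoid G"
  shows "two_vector_space (affine_tensors G p q) (multiplicative_tensors G p q)
    (\<lambda>F. F - right_tensor G p q (unit_component G p q F))
    (\<lambda>F. F - left_tensor G p q (unit_component G p q F))
    (\<lambda>F. F)
    (\<lambda>F\<^sub>1 F\<^sub>2. F\<^sub>1 + left_tensor G p q (unit_component G p q F\<^sub>2))"
proof -
  interpret lie_groupoid G by (rule assms)
  show ?thesis using two_vector_space_affine_tensors[of p q] unfolding right_part_def left_part_def .
qed

end
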